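(* Let $0<\lambda\le\Lambda$, let $N\ge2$ be an integer, and let $g:\mathbb{R}\to\mathbb{R}$ satisfy: (g1) $g$ is locally Lipschitz; (g2) $g$ is odd; (g3) there exists $\alpha\in(0,+\infty]$ such that $g$ is positive on $(0,\alpha)$ and negative on $(\alpha,+\infty)$; (g4) $g$ is differentiable at $0$ and $g'(0)>0$. For any $\xi\in\mathbb{R}$ there exists a solution $u_\xi\in C^2([0,R_\xi))$ of the Cauchy problem $$\theta u''+\frac{N-1}{r}\Theta u'+g(u)=0,\qquad u(0)=\xi,\qquad u'(0)=0,$$ where $\theta=\Lambda$ when $u''\ge0$, $\theta=\lambda$ when $u''<0$, $\Theta=\Lambda$ when $u'\ge0$, $\Theta=\lambda$ when $u'<0$, and $R_\xi\in(0,+\infty]$ is such that $[0,R_\xi)$ is the maximal interval where $u_\xi$ is defined. Moreover: (i) if $|\xi|=\alpha\in\mathbb{R}$ or $\xi=0$, then $u_\xi\equiv\xi$; (ii) if $\alpha\in\mathbb{R}$ and $|\xi|>\alpha$, then $|u_\xi|$ strictly increases to $+\infty$ on $[0,R_\xi)$; (iii) if $0<\xi<\alpha$ and $\Lambda G(\xi)\le\lambda G(\alpha)$, then $R_\xi=+\infty$ and $u_\xi$ is oscillating and localized with $\|u_\xi\|_{L^\infty(\mathbb{R}_+)}<\alpha$; (iv) if $-\alpha<\xi<0$, then $R_\xi=+\infty$ and $u_\xi$ is oscillating and localized with $\|u_\xi\|_{L^\infty(\mathbb{R}_+)}=-\xi<\alpha$.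
   Context: The Cauchy problem is the radial form ($r=|x|$, $u(x)=u(r)$, $x\in\mathbb{R}^N$) of $\mathcal{M}^+_{\lambda,\Lambda}(D^2u)+g(u)=0$, where $\mathcal{M}^+_{\lambda,\Lambda}(D^2u)=\lambda\sum_{e_i<0}e_i+\Lambda\sum_{e_i\ge0}e_i$ and the $e_i$ are the eigenvalues of the Hessian $D^2u$. In the ODE, $\theta$ and $\Theta$ are evaluated pointwise according to the signs of $u''(r)$ and $u'(r)$, and the equation is required for $r>0$. Notation: $G(t)=\int_0^t g(s)\,ds$; if $\alpha=+\infty$, $G(\alpha)$ means $\lim_{t\to+\infty}G(t)\in(0,+\infty]$. $\mathbb{R}_+=[0,+\infty)$. A solution is oscillating if it has an unbounded sequence of zeros. It is localized if (viewed as a radial function on $\mathbb{R}^N$) it converges to zero at infinity together with its partial derivatives up to order $2$. When $\alpha=+\infty$ the condition in (g3) on $(\alpha,+\infty)$ is void. *)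

theory Defs
  imports "HOL-Analysis.Analysis" "HOL-Probability.Essential_Supremum"
begin

text \<open>The interval \<open>[0, R)\<close> for \<open>0 < R \<le> \<infinity>\<close>, and the filter \<open>r \<rightarrow> R\<close> from the left.\<close>

definition ivl :: "ereal \<Rightarrow> real set" where
  "ivl R = {r. 0 \<le> r \<and> ereal r < R}"

definition right_end :: "ereal \<Rightarrow> real filter" where
  "right_end R = (if R = \<infinity> then at_top else at_left (real_of_ereal R))"

text \<open>Evaluated at \<open>u''\<close> this is \<open>\<theta>\<close>, evaluated at \<open>u'\<close> it is \<open>\<Theta>\<close>.\<close>

definition pucci_coeff :: "real \<Rightarrow> real \<Rightarrow> real \<Rightarrow> real" where
  "pucci_coeff lam Lam s = (if s \<ge> 0 then Lam else lam)"

text \<open>\<open>u1\<close> and \<open>u2\<close> are \<open>u'\<close> and \<open>u''\<close>, one-sided at \<open>0\<close>. Only the values of \<open>u\<close> on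
  \<open>[0, R)\<close> are relevant.\<close>

definition cauchy_solution ::
  "real \<Rightarrow> real \<Rightarrow> nat \<Rightarrow> (real \<Rightarrow> real) \<Rightarrow> real \<Rightarrow> ereal \<Rightarrow> (real \<Rightarrow> real) \<Rightarrow> bool" where
  "cauchy_solution lam Lam N g \<xi> R u \<longleftrightarrow>
     (\<exists>u1 u2.
        (\<forall>r\<in>ivl R. (u has_real_derivative u1 r) (at r within ivl R)) \<and>
        (\<forall>r\<in>ivl R. (u1 has_real_derivative u2 r) (at r within ivl R)) \<and>
        continuous_on (ivl R) u2 \<and>
        (\<forall>r\<in>ivl R. r > 0 \<longrightarrow>
           pucci_coeff lam Lam (u2 r) * u2 r
           + (real N - 1) / r * pucci_coeff lam Lam (u1 r) * u1 r + g (u r) = 0) \<and>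
        u 0 = \<xi> \<and> u1 0 = 0)"

definition maximal_solution ::
  "real \<Rightarrow> real \<Rightarrow> nat \<Rightarrow> (real \<Rightarrow> real) \<Rightarrow> real \<Rightarrow> ereal \<Rightarrow> (real \<Rightarrow> real) \<Rightarrow> bool" where
  "maximal_solution lam Lam N g \<xi> R u \<longleftrightarrow>
     0 < R \<and> cauchy_solution lam Lam N g \<xi> R u \<and>
     \<not> (\<exists>R' v. R < R' \<and> cauchy_solution lam Lam N g \<xi> R' v \<and> (\<forall>r\<in>ivl R. v r = u r))"

text \<open>The primitive \<open>G\<close> of \<open>g\<close>, with the usual sign convention for negative arguments, and
  its extension to \<open>+\<infinity>\<close>.\<close>

definition primitive :: "(real \<Rightarrow> real) \<Rightarrow> real \<Rightarrow> real" where
  "primitive g t = (LBINT s=0..ereal t. g s)"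

definition primitive_ext :: "(real \<Rightarrow> real) \<Rightarrow> ereal \<Rightarrow> ereal" where
  "primitive_ext g a =
     (if a = \<infinity> then Lim at_top (\<lambda>t. ereal (primitive g t))
      else ereal (primitive g (real_of_ereal a)))"

definition oscillating :: "(real \<Rightarrow> real) \<Rightarrow> bool" where
  "oscillating u \<longleftrightarrow>
     (\<exists>s :: nat \<Rightarrow> real. (\<forall>n. 0 \<le> s n \<and> u (s n) = 0) \<and> \<not> bdd_above (range s))"

definition has_partial :: "(real ^ 'n \<Rightarrow> real) \<Rightarrow> 'n \<Rightarrow> real ^ 'n \<Rightarrow> real \<Rightarrow> bool" where
  "has_partial U i x d \<longleftrightarrow> ((\<lambda>t. U (x + t *\<^sub>R axis i 1)) has_real_derivative d) (at 0)"

definition localized :: "(real ^ 'n \<Rightarrow> real) \<Rightarrow> bool" where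
  "localized U \<longleftrightarrow>
     (U \<longlongrightarrow> 0) at_infinity \<and>
     (\<exists>D D2.
        (\<forall>i x. has_partial U i x (D i x)) \<and>
        (\<forall>i j x. has_partial (D i) j x (D2 i j x)) \<and>
        (\<forall>i. (D i \<longlongrightarrow> 0) at_infinity) \<and>
        (\<forall>i j. (D2 i j \<longlongrightarrow> 0) at_infinity))"

definition Linf_norm :: "(real \<Rightarrow> real) \<Rightarrow> ereal" where
  "Linf_norm u = esssup (restrict_space lborel {0..}) (\<lambda>r. ereal \<bar>u r\<bar>)"

end

theory Submission
  imports Defs
begin

text \<open>With \<open>M(s) = pucci_coeff lam Lam s * s\<close> the equation is
  \<open>M(u'') + (N - 1)/r M(u') + g(u) = 0\<close>, where \<open>M\<close> is increasing, piecewise linear and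
  positively homogeneous. If \<open>g\<close> is odd, \<open>u \<mapsto> - u\<close> exchanges the two ellipticity constants, so
  every fact about positive solutions that is proved for arbitrary positive constants also
  covers negative ones.

  \<^bold>\<open>Existence.\<close> The singularity at \<open>r = 0\<close> disappears in the unknown \<open>z = u'/r\<close>: by homogeneity
  \<open>u'' = M\<^sup>-(- (N - 1) M(z) - g(u))\<close>, with \<open>M\<^sup>-\<close> the inverse of \<open>M\<close>, has no singular term.
  The right-hand side is decreasing in \<open>z\<close>; adding \<open>\<mu> z\<close> with \<open>\<mu>\<close> large turns the equation into
  \<open>(r\<^sup>\<mu> u')' = r\<^sup>\<mu> \<Psi>(z, u)\<close> with \<open>\<Psi>\<close> of Lipschitz constant at most \<open>\<mu>\<close> in \<open>z\<close>. Integration divides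
  by \<open>\<mu> + 1\<close>, and a weight \<open>exp(- A r)\<close> makes the dependence on \<open>u\<close> small, so for bounded
  Lipschitz sources a contraction gives a solution on all of \<open>[0, \<infinity>)\<close>
  (\<open>bounded_lipschitz_solution_exists\<close>). In the energy of a difference of two solutions the
  singular term has the good sign, which gives uniqueness (\<open>c2_solution_unique\<close>). Truncating \<open>g\<close>
  and taking the supremum of all existence times yields a maximal solution that is global
  whenever it is bounded (\<open>maximal_solution_exists\<close>).

  \<^bold>\<open>Beyond the well.\<close> For \<open>\<xi> > \<alpha>\<close>, and after reflection for \<open>\<xi> < - \<alpha>\<close>, at a point where \<open>u'/r\<close> attains a running minimum one has
  \<open>u'' \<le> u'/r\<close>, so the equation bounds \<open>N M(u'/r)\<close> from below by \<open>- g(u) > 0\<close>. Hence \<open>u\<close>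
  increases, and while it is bounded it grows at least quadratically, so it cannot stay bounded
  (\<open>supercritical_blow_up\<close>).

  \<^bold>\<open>Inside the well.\<close> Let \<open>H = G\<close> on \<open>[0, \<infinity>)\<close> and \<open>H = (lam/Lam) G\<close> on \<open>(- \<infinity>, 0)\<close>. Then
  \<open>V = lam u'\<^sup>2/2 + H(u)\<close> satisfies \<open>V' \<le> - c u'\<^sup>2/r\<close> for some \<open>c > 0\<close> as long as \<open>|u| < \<alpha>\<close>
  (\<open>energy_dissipation\<close>). Comparing \<open>V(0) = H(\<xi>)\<close> with \<open>H(\<plusminus>\<beta>)\<close> traps \<open>u\<close> in some \<open>[- \<beta>, \<beta>]\<close>
  with \<open>\<beta> < \<alpha>\<close>: for \<open>\<xi> < 0\<close> any \<open>\<beta> \<in> (- \<xi>, \<alpha>)\<close> will do, while for \<open>\<xi> > 0\<close> the condition is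
  \<open>G(\<xi>) \<le> (lam/Lam) G(\<alpha>)\<close>, the equality case being saved by an initial strict loss of \<open>V\<close>.
  If such a solution, or its reflection, were eventually positive, \<open>w = - u'/u\<close> would satisfy \<open>w' \<ge> w\<^sup>2/2 + \<delta>\<close> and
  blow up; so it oscillates (\<open>bounded_solution_oscillates\<close>). If \<open>V\<close> did not tend to 0, then
  \<open>u u'/r + K V\<close> would decrease at least like \<open>- c log r\<close>, although it is bounded below; so \<open>V\<close>,
  and with it \<open>u\<close>, \<open>u'\<close> and \<open>u''\<close>, tend to 0 (\<open>decay\<close>).\<close>

section \<open>The one-dimensional Pucci operator\<close>

definition pucci :: "real \<Rightarrow> real \<Rightarrow> real \<Rightarrow> real" where
  "pucci lam Lam s = pucci_coeff lam Lam s * s"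

lemma pucci_eq_max_min: "pucci lam Lam s = Lam * max s 0 + lam * min s 0"
  by (auto simp: pucci_def pucci_coeff_def)

lemma pucci_nonneg: "0 \<le> s \<Longrightarrow> pucci lam Lam s = Lam * s"
  and pucci_nonpos: "s \<le> 0 \<Longrightarrow> pucci lam Lam s = lam * s"
  and pucci_zero [simp]: "pucci lam Lam 0 = 0"
  by (auto simp: pucci_def pucci_coeff_def)

lemma continuous_on_pucci [continuous_intros]:
  "continuous_on S f \<Longrightarrow> continuous_on S (\<lambda>x. pucci lam Lam (f x))"
  unfolding pucci_eq_max_min by (intro continuous_intros)

lemma tendsto_pucci [tendsto_intros]:
  "(f \<longlongrightarrow> l) F \<Longrightarrow> ((\<lambda>x. pucci lam Lam (f x)) \<longlongrightarrow> pucci lam Lam l) F"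
  unfolding pucci_eq_max_min by (intro tendsto_intros)

lemma pucci_scale: "0 \<le> c \<Longrightarrow> pucci lam Lam (c * s) = c * pucci lam Lam s"
  by (auto simp: pucci_def pucci_coeff_def zero_le_mult_iff)

text \<open>Reflection exchanges the two constants. For this reason \<open>lam \<le> Lam\<close> is assumed only where the
  order matters: results for positive solutions with arbitrary constants transfer to negative
  ones.\<close>

lemma pucci_minus: "pucci lam Lam (- s) = - pucci Lam lam s"
  by (auto simp: pucci_def pucci_coeff_def)

text \<open>The inverse is an operator of the same kind, with reciprocal constants.\<close>

lemma pucci_inverse_left:
  assumes "0 < lam" "0 < Lam"
  shows "pucci (1 / lam) (1 / Lam) (pucci lam Lam s) = s"
  using assms by (auto simp: pucci_def pucci_coeff_def zero_le_mult_iff)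

lemma pucci_inverse_right:
  assumes "0 < lam" "0 < Lam"
  shows "pucci lam Lam (pucci (1 / lam) (1 / Lam) s) = s"
  using assms by (auto simp: pucci_def pucci_coeff_def zero_le_divide_iff)

text \<open>Between \<open>s\<close> and \<open>t\<close> the operator increases by \<open>Lam\<close> times the increment of the positive part plus
  \<open>lam\<close> times that of the negative part, and both increments are nonnegative.\<close>

lemma pucci_slope:
  assumes "0 < lam" "0 < Lam" "s \<le> t"
  shows "min lam Lam * (t - s) \<le> pucci lam Lam t - pucci lam Lam s"
    and "pucci lam Lam t - pucci lam Lam s \<le> max lam Lam * (t - s)"
proof -
  define p q where "p = max t 0 - max s 0" and "q = min t 0 - min s 0"
  have pq: "0 \<le> p" "0 \<le> q" "t - s = p + q"
    using assms by (auto simp: p_def q_def)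
  have e: "pucci lam Lam t - pucci lam Lam s = Lam * p + lam * q"
    by (simp add: pucci_eq_max_min p_def q_def algebra_simps)
  have "min lam Lam * p \<le> Lam * p" "min lam Lam * q \<le> lam * q"
      "Lam * p \<le> max lam Lam * p" "lam * q \<le> max lam Lam * q"
    using pq by (auto intro!: mult_right_mono)
  then show "min lam Lam * (t - s) \<le> pucci lam Lam t - pucci lam Lam s"
    and "pucci lam Lam t - pucci lam Lam s \<le> max lam Lam * (t - s)"
    unfolding e pq(3) by (auto simp: distrib_left)
qed

lemma pucci_less_iff:
  assumes "0 < lam" "0 < Lam"
  shows "pucci lam Lam s < pucci lam Lam t \<longleftrightarrow> s < t"
proof -
  have *: "pucci lam Lam s < pucci lam Lam t" if "s < t" for s t
  proof -
    have "0 < min lam Lam * (t - s)" using assms that by simp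
    then show ?thesis using pucci_slope(1)[OF assms, of s t] that by simp
  qed
  show ?thesis using *[of s t] *[of t s] by (cases s t rule: linorder_cases) auto
qed

lemma pucci_le_iff:
  assumes "0 < lam" "0 < Lam"
  shows "pucci lam Lam s \<le> pucci lam Lam t \<longleftrightarrow> s \<le> t"
  using pucci_less_iff[OF assms, of t s] by linarith

lemma pucci_sign [simp]:
  assumes "0 < lam" "0 < Lam"
  shows "0 < pucci lam Lam s \<longleftrightarrow> 0 < s" "pucci lam Lam s < 0 \<longleftrightarrow> s < 0"
    "0 \<le> pucci lam Lam s \<longleftrightarrow> 0 \<le> s" "pucci lam Lam s \<le> 0 \<longleftrightarrow> s \<le> 0"
  using pucci_less_iff[OF assms, of 0 s] pucci_less_iff[OF assms, of s 0]
    pucci_le_iff[OF assms, of 0 s] pucci_le_iff[OF assms, of s 0] by auto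

lemma pucci_lipschitz:
  assumes "0 < lam" "0 < Lam"
  shows "\<bar>pucci lam Lam t - pucci lam Lam s\<bar> \<le> max lam Lam * \<bar>t - s\<bar>"
proof -
  have *: "0 \<le> pucci lam Lam t - pucci lam Lam s"
      "pucci lam Lam t - pucci lam Lam s \<le> max lam Lam * (t - s)" if "s \<le> t" for s t
    using pucci_slope[OF assms that] assms that
    by (auto intro: order_trans[rotated] simp: pucci_le_iff)
  show ?thesis using *[of s t] *[of t s] by (cases "s \<le> t") auto
qed

lemma pucci_abs_le:
  assumes "0 < lam" "0 < Lam"
  shows "\<bar>pucci lam Lam s\<bar> \<le> max lam Lam * \<bar>s\<bar>"
  using pucci_lipschitz[OF assms, of s 0] by simp

section \<open>A contraction for the quotient \<open>u'/r\<close>\<close>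

text \<open>If \<open>z = u'/r\<close>, this is \<open>u(r) = \<xi> + \<integral>\<^sub>0\<^sup>r s z(s) ds\<close>. The substitution \<open>s = r t\<close> to the unit interval
  makes the expression meaningful for every real \<open>r\<close> and regular at \<open>r = 0\<close>.\<close>

definition radial_primitive :: "real \<Rightarrow> (real \<Rightarrow> real) \<Rightarrow> real \<Rightarrow> real" where
  "radial_primitive \<xi> z r = \<xi> + r\<^sup>2 * integral {0..1} (\<lambda>t. t * z (r * t))"

text \<open>The integrated equation \<open>r\<^sup>\<mu>\<^sup>+\<^sup>1 z(r) = \<integral>\<^sub>0\<^sup>r s\<^sup>\<mu> \<Psi>(z(s), u(s)) ds\<close> for \<open>z = u'/r\<close>, after the same
  substitution: its solutions are the fixed points of this map.\<close>

definition radial_average :: "nat \<Rightarrow> (real \<Rightarrow> real \<Rightarrow> real) \<Rightarrow> real \<Rightarrow> (real \<Rightarrow> real) \<Rightarrow> real \<Rightarrow> real" where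
  "radial_average \<mu> \<Psi> \<xi> z r =
     integral {0..1} (\<lambda>t. t ^ \<mu> * \<Psi> (z (r * t)) (radial_primitive \<xi> z (r * t)))"

lemma continuous_on_radial_primitive:
  assumes "continuous_on UNIV z"
  shows "continuous_on UNIV (radial_primitive \<xi> z)"
proof -
  have "continuous_on UNIV (\<lambda>r. integral (cbox 0 1) (\<lambda>t. t * z (r * t)))"
    by (rule integral_continuous_on_param)
       (auto simp: split_def intro!: continuous_intros continuous_on_compose2[OF assms])
  then show ?thesis
    unfolding radial_primitive_def by (auto intro!: continuous_intros)
qed

lemma continuous_on_lipschitz_pair:
  fixes \<Psi> :: "real \<Rightarrow> real \<Rightarrow> real"
  assumes lip: "\<And>z1 z2 y1 y2. \<bar>\<Psi> z1 y1 - \<Psi> z2 y2\<bar> \<le> a * \<bar>z1 - z2\<bar> + b * \<bar>y1 - y2\<bar>"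
    and "continuous_on S f" "continuous_on S h"
  shows "continuous_on S (\<lambda>x. \<Psi> (f x) (h x))"
  unfolding continuous_on_def
proof
  fix x assume x: "x \<in> S"
  have "((\<lambda>y. a * \<bar>f y - f x\<bar> + b * \<bar>h y - h x\<bar>) \<longlongrightarrow> a * \<bar>f x - f x\<bar> + b * \<bar>h x - h x\<bar>) (at x within S)"
    using assms(2,3) x by (intro tendsto_intros) (auto simp: continuous_on_def)
  then have "((\<lambda>y. a * \<bar>f y - f x\<bar> + b * \<bar>h y - h x\<bar>) \<longlongrightarrow> 0) (at x within S)" by simp
  then have "((\<lambda>y. \<Psi> (f y) (h y) - \<Psi> (f x) (h x)) \<longlongrightarrow> 0) (at x within S)"
    by (rule Lim_null_comparison[rotated]) (auto intro!: lip always_eventually)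
  then show "((\<lambda>y. \<Psi> (f y) (h y)) \<longlongrightarrow> \<Psi> (f x) (h x)) (at x within S)"
    by (rule LIM_zero_cancel)
qed

text \<open>Each integration of the weight \<open>exp(c t)\<close> gains a factor \<open>1/c\<close>. Written as a product, the estimate
  includes \<open>c = 0\<close>.\<close>

lemma exp_average_bound: "c * integral {0..1} (\<lambda>t. exp (c * t)) \<le> exp (c::real)"
proof -
  have "((\<lambda>t. c * exp (c * t)) has_integral (exp (c * 1) - exp (c * 0))) {0..1}"
    by (rule fundamental_theorem_of_calculus)
       (auto intro!: derivative_eq_intros simp: has_real_derivative_iff_has_vector_derivative[symmetric])
  then have "c * integral {0..1} (\<lambda>t. exp (c * t)) = exp c - 1"
    by (metis integral_mult_right integral_unique mult_cancel_left1 mult.right_neutral mult_zero_right exp_zero)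
  then show ?thesis by simp
qed

lemma integral_power_01: "integral {0..1} (\<lambda>t::real. t ^ \<mu>) = 1 / (real \<mu> + 1)"
proof -
  have "((\<lambda>x::real. x ^ Suc \<mu> / real (Suc \<mu>)) has_real_derivative x ^ \<mu>) (at x within {0..1})" for x
    using DERIV_cdivide[OF DERIV_pow[of "Suc \<mu>" x "{0..1}"], of "real (Suc \<mu>)"] by simp
  then have "((\<lambda>t::real. t ^ \<mu>) has_integral (1 ^ Suc \<mu> / real (Suc \<mu>) - 0 ^ Suc \<mu> / real (Suc \<mu>))) {0..1}"
    by (intro fundamental_theorem_of_calculus)
       (auto simp: has_real_derivative_iff_has_vector_derivative[symmetric])
  then show ?thesis by (auto dest: integral_unique simp: add.commute)
qed

lemma abs_integral_01_le:
  assumes "continuous_on {0..1} f" "continuous_on {0..1} h"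
    and "\<And>t. 0 \<le> t \<Longrightarrow> t \<le> 1 \<Longrightarrow> \<bar>f t\<bar> \<le> h t"
  shows "\<bar>integral {0..1} f\<bar> \<le> integral {0..1::real} (h :: real \<Rightarrow> real)"
  using integral_norm_bound_integral[of f "{0..1}" h] assms
  by (auto intro!: integrable_continuous_real)

text \<open>The Lipschitz constant in the first argument is the exponent \<open>\<mu>\<close> itself, which is exactly what
  the factor \<open>1/(\<mu> + 1)\<close> from averaging \<open>t\<^sup>\<mu>\<close> can absorb.\<close>

locale radial_contraction =
  fixes \<mu> :: nat and C B \<xi> :: real and \<Psi> :: "real \<Rightarrow> real \<Rightarrow> real"
  assumes lip: "\<And>z1 z2 y1 y2. \<bar>\<Psi> z1 y1 - \<Psi> z2 y2\<bar> \<le> real \<mu> * \<bar>z1 - z2\<bar> + C * \<bar>y1 - y2\<bar>"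
    and bnd: "\<And>y. \<bar>\<Psi> 0 y\<bar> \<le> B"
    and C: "0 \<le> C"
begin

lemma continuous_on_integrand:
  assumes "continuous_on UNIV z"
  shows "continuous_on UNIV (\<lambda>s. \<Psi> (z s) (radial_primitive \<xi> z s))"
  by (rule continuous_on_lipschitz_pair[OF lip]) (intro assms continuous_on_radial_primitive)+

lemma continuous_on_average:
  assumes "continuous_on UNIV z"
  shows "continuous_on UNIV (radial_average \<mu> \<Psi> \<xi> z)"
proof -
  have "continuous_on UNIV (\<lambda>r. integral (cbox 0 1)
      (\<lambda>t. t ^ \<mu> * \<Psi> (z (r * t)) (radial_primitive \<xi> z (r * t))))"
    by (rule integral_continuous_on_param)
       (auto simp: split_def intro!: continuous_intros continuous_on_compose2[OF continuous_on_integrand[OF assms]])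
  then show ?thesis
    by (simp add: radial_average_def[abs_def])
qed

lemma average_bounded:
  assumes z: "continuous_on UNIV z" and A: "0 \<le> A" and le: "\<And>s. \<bar>z s\<bar> \<le> D * exp (A * \<bar>s\<bar>)"
  shows "\<bar>radial_average \<mu> \<Psi> \<xi> z r\<bar> \<le> (real \<mu> * D + B) * exp (A * \<bar>r\<bar>)"
proof -
  have D: "0 \<le> D" using le[of 0] by simp
  have B: "0 \<le> B" using bnd[of 0] by simp
  have "\<bar>radial_average \<mu> \<Psi> \<xi> z r\<bar> \<le> integral {0..1} (\<lambda>t::real. (real \<mu> * D + B) * exp (A * \<bar>r\<bar>))"
    unfolding radial_average_def
  proof (rule abs_integral_01_le)
    fix t :: real assume t: "0 \<le> t" "t \<le> 1"
    let ?y = "radial_primitive \<xi> z (r * t)"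
    have e: "exp (A * \<bar>r * t\<bar>) \<le> exp (A * \<bar>r\<bar>)"
      using t A by (auto simp: abs_mult intro!: mult_left_mono mult_left_le)
    have "\<bar>\<Psi> (z (r * t)) ?y\<bar> \<le> real \<mu> * \<bar>z (r * t)\<bar> + B"
      using lip[of "z (r*t)" ?y 0 ?y] bnd[of ?y] by simp
    also have "\<dots> \<le> real \<mu> * (D * exp (A * \<bar>r\<bar>)) + B * exp (A * \<bar>r\<bar>)"
      using le[of "r*t"] mult_left_mono[OF e D] A B
      by (intro add_mono mult_left_mono) (auto simp: mult_le_cancel_left1)
    also have "\<dots> = (real \<mu> * D + B) * exp (A * \<bar>r\<bar>)" by (simp add: algebra_simps)
    finally have "\<bar>\<Psi> (z (r * t)) ?y\<bar> \<le> (real \<mu> * D + B) * exp (A * \<bar>r\<bar>)" .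
    moreover have "t ^ \<mu> * \<bar>\<Psi> (z (r * t)) ?y\<bar> \<le> 1 * \<bar>\<Psi> (z (r * t)) ?y\<bar>"
      using t by (intro mult_right_mono) (auto simp: power_le_one)
    ultimately show "\<bar>t ^ \<mu> * \<Psi> (z (r * t)) ?y\<bar> \<le> (real \<mu> * D + B) * exp (A * \<bar>r\<bar>)"
      using t by (simp add: abs_mult)
  qed (auto intro!: continuous_intros continuous_on_compose2[OF continuous_on_integrand[OF z]])
  then show ?thesis by simp
qed

text \<open>The two parts of the factor come from the two arguments of \<open>\<Psi>\<close>: averaging \<open>t\<^sup>\<mu>\<close> gives
  \<open>\<mu>/(\<mu> + 1) < 1\<close>, and the exponential weight is integrated twice on the way through the primitive,
  which gives \<open>C/A\<^sup>2\<close>.\<close>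

lemma average_contraction:
  assumes z: "continuous_on UNIV z1" "continuous_on UNIV z2" and A: "0 < A"
    and le: "\<And>s. \<bar>z1 s - z2 s\<bar> \<le> d * exp (A * \<bar>s\<bar>)"
  shows "\<bar>radial_average \<mu> \<Psi> \<xi> z1 r - radial_average \<mu> \<Psi> \<xi> z2 r\<bar>
           \<le> (real \<mu> / (real \<mu> + 1) + C / A\<^sup>2) * d * exp (A * \<bar>r\<bar>)"
proof -
  have d: "0 \<le> d" using le[of 0] by (auto intro: order_trans)
  have exp_int: "\<bar>s\<bar> * integral {0..1} (\<lambda>t. exp (A * \<bar>s\<bar> * t)) \<le> exp (A * \<bar>s\<bar>) / A" for s
    using exp_average_bound[of "A * \<bar>s\<bar>"] A by (simp add: field_simps)
  have prim: "\<bar>radial_primitive \<xi> z1 s - radial_primitive \<xi> z2 s\<bar> \<le> d * \<bar>s\<bar> * exp (A * \<bar>s\<bar>) / A" for s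
  proof -
    have "\<bar>radial_primitive \<xi> z1 s - radial_primitive \<xi> z2 s\<bar>
        = s\<^sup>2 * \<bar>integral {0..1} (\<lambda>t. t * z1 (s * t) - t * z2 (s * t))\<bar>"
      unfolding radial_primitive_def
      by (subst integral_diff)
         (auto simp: abs_mult right_diff_distrib[symmetric] intro!: integrable_continuous_real
            continuous_intros continuous_on_compose2[OF z(1)] continuous_on_compose2[OF z(2)])
    also have "\<dots> \<le> s\<^sup>2 * integral {0..1} (\<lambda>t. d * exp (A * \<bar>s\<bar> * t))"
    proof (intro mult_left_mono abs_integral_01_le)
      fix t :: real assume t: "0 \<le> t" "t \<le> 1"
      have "\<bar>t * z1 (s * t) - t * z2 (s * t)\<bar> = t * \<bar>z1 (s * t) - z2 (s * t)\<bar>"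
        using t by (simp add: right_diff_distrib[symmetric] abs_mult)
      also have "\<dots> \<le> 1 * (d * exp (A * \<bar>s * t\<bar>))"
        using t le[of "s * t"] by (intro mult_mono) auto
      finally show "\<bar>t * z1 (s * t) - t * z2 (s * t)\<bar> \<le> d * exp (A * \<bar>s\<bar> * t)"
        using t by (simp add: abs_mult mult.assoc)
    qed (auto intro!: continuous_intros continuous_on_compose2[OF z(1)] continuous_on_compose2[OF z(2)])
    also have "\<dots> = d * \<bar>s\<bar> * (\<bar>s\<bar> * integral {0..1} (\<lambda>t. exp (A * \<bar>s\<bar> * t)))"
    proof -
      have "s\<^sup>2 = \<bar>s\<bar> * \<bar>s\<bar>" by (simp add: power2_eq_square)
      then show ?thesis by simp
    qed
    also have "\<dots> \<le> d * \<bar>s\<bar> * (exp (A * \<bar>s\<bar>) / A)"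
      using d exp_int by (intro mult_left_mono) auto
    finally show ?thesis by simp
  qed
  let ?e = "exp (A * \<bar>r\<bar>)"
  have "\<bar>radial_average \<mu> \<Psi> \<xi> z1 r - radial_average \<mu> \<Psi> \<xi> z2 r\<bar>
     = \<bar>integral {0..1} (\<lambda>t. t ^ \<mu> * \<Psi> (z1 (r * t)) (radial_primitive \<xi> z1 (r * t))
          - t ^ \<mu> * \<Psi> (z2 (r * t)) (radial_primitive \<xi> z2 (r * t)))\<bar>"
    unfolding radial_average_def
    by (subst integral_diff)
       (auto intro!: integrable_continuous_real continuous_intros
          continuous_on_compose2[OF continuous_on_integrand[OF z(1)]]
          continuous_on_compose2[OF continuous_on_integrand[OF z(2)]])
  also have "\<dots> \<le> integral {0..1} (\<lambda>t. real \<mu> * d * ?e * t ^ \<mu> + C * d / A * \<bar>r\<bar> * exp (A * \<bar>r\<bar> * t))"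
  proof (rule abs_integral_01_le)
    fix t :: real assume t: "0 \<le> t" "t \<le> 1"
    let ?s = "r * t"
    have e: "exp (A * \<bar>?s\<bar>) \<le> ?e"
      using t A by (auto simp: abs_mult intro!: mult_left_mono mult_left_le)
    have tm: "t ^ \<mu> \<le> 1" "0 \<le> t ^ \<mu>" using t by (auto simp: power_le_one)
    have "\<bar>t ^ \<mu> * \<Psi> (z1 ?s) (radial_primitive \<xi> z1 ?s) - t ^ \<mu> * \<Psi> (z2 ?s) (radial_primitive \<xi> z2 ?s)\<bar>
       = t ^ \<mu> * \<bar>\<Psi> (z1 ?s) (radial_primitive \<xi> z1 ?s) - \<Psi> (z2 ?s) (radial_primitive \<xi> z2 ?s)\<bar>"
      using t by (simp add: right_diff_distrib[symmetric] abs_mult)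
    also have "\<dots> \<le> t ^ \<mu> * (real \<mu> * \<bar>z1 ?s - z2 ?s\<bar> + C * \<bar>radial_primitive \<xi> z1 ?s - radial_primitive \<xi> z2 ?s\<bar>)"
      by (intro mult_left_mono lip tm)
    also have "\<dots> \<le> t ^ \<mu> * (real \<mu> * (d * ?e) + C * (d * \<bar>?s\<bar> * exp (A * \<bar>?s\<bar>) / A))"
      using order_trans[OF le[of ?s] mult_left_mono[OF e d]] C tm(2)
      by (intro mult_left_mono add_mono prim) auto
    also have "\<dots> = real \<mu> * d * ?e * t ^ \<mu> + C * d / A * \<bar>r\<bar> * exp (A * \<bar>?s\<bar>) * (t ^ \<mu> * t)"
      using t by (simp add: algebra_simps abs_mult)
    also have "\<dots> \<le> real \<mu> * d * ?e * t ^ \<mu> + C * d / A * \<bar>r\<bar> * exp (A * \<bar>?s\<bar>) * 1"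
      using t tm C d A by (intro add_mono mult_left_mono mult_le_one order_refl) auto
    finally show "\<bar>t ^ \<mu> * \<Psi> (z1 ?s) (radial_primitive \<xi> z1 ?s) - t ^ \<mu> * \<Psi> (z2 ?s) (radial_primitive \<xi> z2 ?s)\<bar>
      \<le> real \<mu> * d * ?e * t ^ \<mu> + C * d / A * \<bar>r\<bar> * exp (A * \<bar>r\<bar> * t)"
      using t by (simp add: abs_mult mult.assoc)
  qed (use A in \<open>auto intro!: continuous_intros continuous_on_compose2[OF continuous_on_integrand[OF z(1)]]
          continuous_on_compose2[OF continuous_on_integrand[OF z(2)]]\<close>)
  also have "\<dots> = real \<mu> * d * ?e * (1 / (real \<mu> + 1)) + C * d / A * (\<bar>r\<bar> * integral {0..1} (\<lambda>t. exp (A * \<bar>r\<bar> * t)))"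
    using A by (subst integral_add)
       (auto intro!: integrable_continuous_real continuous_intros simp: integral_power_01)
  also have "\<dots> \<le> real \<mu> * d * ?e * (1 / (real \<mu> + 1)) + C * d / A * (?e / A)"
    using C d A exp_int by (intro add_mono mult_left_mono order_refl) auto
  also have "\<dots> = (real \<mu> / (real \<mu> + 1) + C / A\<^sup>2) * d * ?e"
    by (simp add: power2_eq_square algebra_simps)
  finally show ?thesis .
qed

text \<open>Banach's theorem for the bounded function \<open>exp(- A |r|) z(r)\<close>, with \<open>A\<close> so large that the total
  factor stays below 1. Working on the whole line at once yields a global solution.\<close>

lemma fixed_point_exists: "\<exists>z. continuous_on UNIV z \<and> radial_average \<mu> \<Psi> \<xi> z = z"
proof -
  define A where "A = C * (real \<mu> + 1) + 1"
  define c where "c = real \<mu> / (real \<mu> + 1) + C / A\<^sup>2"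
  have A: "1 \<le> A" using C by (simp add: A_def)
  have "C / A\<^sup>2 \<le> C / A"
    using A C by (intro divide_left_mono) (auto simp: power2_eq_square mult_le_cancel_left1)
  also have "C / A < 1 / (real \<mu> + 1)"
  proof -
    have "C * (real \<mu> + 1) < A" using C by (simp add: A_def)
    then show ?thesis using A by (simp add: divide_simps)
  qed
  finally have "c < real \<mu> / (real \<mu> + 1) + 1 / (real \<mu> + 1)" unfolding c_def by (rule add_strict_left_mono)
  also have "\<dots> = 1" by (simp add: add_divide_distrib[symmetric])
  finally have c: "c < 1" "0 \<le> c" using C by (auto simp: c_def)
  define lift where "lift w s = exp (A * \<bar>s\<bar>) * apply_bcontfun w s" for w :: "real \<Rightarrow>\<^sub>C real" and s
  define T where "T w s = exp (- (A * \<bar>s\<bar>)) * radial_average \<mu> \<Psi> \<xi> (lift w) s" for w s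
  have lift_cont: "continuous_on UNIV (lift w)" for w
    unfolding lift_def[abs_def] by (intro continuous_intros) auto
  have "T w \<in> bcontfun" for w
  proof -
    have "bounded (range (apply_bcontfun w))" by simp
    then obtain D where D: "\<And>s. \<bar>apply_bcontfun w s\<bar> \<le> D"
      by (auto simp: bounded_iff)
    have "\<bar>lift w s\<bar> \<le> D * exp (A * \<bar>s\<bar>)" for s
      using D[of s] by (simp add: lift_def abs_mult mult.commute)
    from average_bounded[OF lift_cont _ this] A
    have "\<bar>radial_average \<mu> \<Psi> \<xi> (lift w) s\<bar> \<le> (real \<mu> * D + B) * exp (A * \<bar>s\<bar>)" for s by simp
    then have "\<bar>T w s\<bar> \<le> real \<mu> * D + B" for s
      by (simp add: T_def abs_mult exp_minus field_simps)
    then show ?thesis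
      unfolding bcontfun_def bounded_iff T_def[abs_def]
      by (auto intro!: continuous_intros continuous_on_average lift_cont)
  qed
  then have TB: "apply_bcontfun (Bcontfun (T w)) = T w" for w
    by (rule Bcontfun_inverse)
  have "dist (Bcontfun (T w1)) (Bcontfun (T w2)) \<le> c * dist w1 w2" for w1 w2
  proof (rule dist_bound)
    fix r
    have "\<bar>lift w1 s - lift w2 s\<bar> \<le> dist w1 w2 * exp (A * \<bar>s\<bar>)" for s
    proof -
      have "lift w1 s - lift w2 s = (apply_bcontfun w1 s - apply_bcontfun w2 s) * exp (A * \<bar>s\<bar>)"
        by (simp add: lift_def algebra_simps)
      then show ?thesis
        using dist_bounded[of w1 s w2] by (simp add: abs_mult dist_real_def)
    qed
    from average_contraction[OF lift_cont lift_cont _ this] A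
    have "\<bar>radial_average \<mu> \<Psi> \<xi> (lift w1) r - radial_average \<mu> \<Psi> \<xi> (lift w2) r\<bar>
       \<le> c * dist w1 w2 * exp (A * \<bar>r\<bar>)" by (simp add: c_def)
    then show "dist (apply_bcontfun (Bcontfun (T w1)) r) (apply_bcontfun (Bcontfun (T w2)) r) \<le> c * dist w1 w2"
      by (simp add: TB T_def dist_real_def right_diff_distrib[symmetric] abs_mult exp_minus field_simps)
  qed
  then obtain w where w: "Bcontfun (T w) = w"
    using banach_fix_type[of c "\<lambda>w. Bcontfun (T w)"] c by blast
  have "lift w s = radial_average \<mu> \<Psi> \<xi> (lift w) s" for s
    by (subst (1) lift_def, subst w[symmetric]) (simp add: TB T_def exp_minus)
  then show ?thesis using lift_cont by (metis ext)
qed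

end

section \<open>Twice differentiable solutions and existence for bounded Lipschitz sources\<close>

text \<open>The derivatives are parameters, so that estimates can refer to them, and the value at the origin
  is left free.\<close>

definition c2_solution ::
  "real \<Rightarrow> real \<Rightarrow> nat \<Rightarrow> (real \<Rightarrow> real) \<Rightarrow> ereal \<Rightarrow> (real \<Rightarrow> real) \<Rightarrow> (real \<Rightarrow> real) \<Rightarrow> (real \<Rightarrow> real) \<Rightarrow> bool" where
  "c2_solution lam Lam N g R u u1 u2 \<longleftrightarrow>
     (\<forall>r\<in>ivl R. (u has_real_derivative u1 r) (at r within ivl R)) \<and>
     (\<forall>r\<in>ivl R. (u1 has_real_derivative u2 r) (at r within ivl R)) \<and>
     continuous_on (ivl R) u2 \<and>
     (\<forall>r\<in>ivl R. r > 0 \<longrightarrow>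
        pucci lam Lam (u2 r) + (real N - 1) / r * pucci lam Lam (u1 r) + g (u r) = 0) \<and>
     u1 0 = 0"

lemma cauchy_solution_iff:
  "cauchy_solution lam Lam N g \<xi> R u \<longleftrightarrow> (\<exists>u1 u2. c2_solution lam Lam N g R u u1 u2 \<and> u 0 = \<xi>)"
  by (simp add: cauchy_solution_def c2_solution_def pucci_def mult.assoc conj_ac)

lemma mem_ivl: "r \<in> ivl R \<longleftrightarrow> 0 \<le> r \<and> ereal r < R"
  by (simp add: ivl_def)

lemma ivl_infinity [simp]: "ivl \<infinity> = {0..}"
  by (auto simp: ivl_def)

lemma zero_in_ivl: "0 < R \<Longrightarrow> 0 \<in> ivl R"
  by (simp add: mem_ivl zero_ereal_def)

lemma ivl_ereal [simp]: "ivl (ereal b) = {0..<b}"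
  by (auto simp: ivl_def)

text \<open>The substitution \<open>s = r t\<close>, expressed through an antiderivative so that one identity serves for
  every real \<open>r\<close>.\<close>

lemma scaled_average_eq:
  fixes F Q :: "real \<Rightarrow> real"
  assumes Q: "\<And>s. (Q has_real_derivative s ^ n * F s) (at s)"
  shows "r ^ Suc n * integral {0..1} (\<lambda>t. t ^ n * F (r * t)) = Q r - Q 0"
proof -
  have "((\<lambda>t. Q (r * t)) has_real_derivative r ^ Suc n * (t ^ n * F (r * t))) (at t within {0..1})" for t
  proof -
    have "((*) r has_real_derivative r) (at t within {0..1})"
      by (rule DERIV_cmult_Id)
    from DERIV_chain2[where f = Q, OF Q this] show ?thesis
      by (simp add: power_mult_distrib mult_ac)
  qed
  then have "((\<lambda>t. r ^ Suc n * (t ^ n * F (r * t))) has_integral (Q (r * 1) - Q (r * 0))) {0..1}"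
    by (intro fundamental_theorem_of_calculus)
       (auto simp: has_real_derivative_iff_has_vector_derivative[symmetric])
  then show ?thesis
    by (metis integral_mult_right integral_unique mult.right_neutral mult_zero_right)
qed

lemma continuous_antiderivative:
  fixes F :: "real \<Rightarrow> real"
  assumes "continuous_on UNIV F"
  obtains Q where "\<And>s. (Q has_real_derivative F s) (at s)"
proof -
  have "\<exists>Q. \<forall>x. -\<infinity> < ereal x \<longrightarrow> ereal x < \<infinity> \<longrightarrow> (Q has_vector_derivative F x) (at x)"
    using assms by (intro einterval_antiderivative) (auto simp: continuous_on_eq_continuous_at)
  then show ?thesis
    using that by (auto simp: has_real_derivative_iff_has_vector_derivative)
qed

text \<open>Solving for \<open>u''\<close> gives the decreasing function \<open>z \<mapsto> M\<^sup>-(- (N - 1) M(z) - f(u))\<close> of \<open>z = u'/r\<close>,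
  whose slopes are at least \<open>- (N - 1) max/min\<close> of the ellipticity constants. With \<open>\<mu>\<close> above this
  bound, \<open>\<Psi>\<close> is increasing in \<open>z\<close> with slopes at most \<open>\<mu>\<close>, so the contraction applies, and
  differentiating the fixed point equation recovers the differential equation.\<close>

lemma bounded_lipschitz_solution_exists:
  fixes f :: "real \<Rightarrow> real"
  assumes pos: "0 < lam" "0 < Lam" and N: "1 \<le> N"
    and L: "\<And>x y. \<bar>f x - f y\<bar> \<le> L * \<bar>x - y\<bar>" and B: "\<And>x. \<bar>f x\<bar> \<le> B"
  shows "\<exists>u u1 u2. c2_solution lam Lam N f \<infinity> u u1 u2 \<and> u 0 = \<xi>"
proof -
  define k where "k = real N - 1"
  define c where "c = min lam Lam"
  define m where "m = max lam Lam"
  define \<mu> where "\<mu> = nat \<lceil>k * m / c\<rceil>"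
  define inv where "inv = pucci (1 / lam) (1 / Lam)"
  define \<Psi> where "\<Psi> z y = inv (- k * pucci lam Lam z - f y) + real \<mu> * z" for z y
  have k: "0 \<le> k" and c: "0 < c" and m: "0 < m"
    using N pos by (auto simp: k_def c_def m_def)
  have \<mu>: "k * m / c \<le> real \<mu>" unfolding \<mu>_def by linarith
  have L0: "0 \<le> L" using L[of 1 0] by simp
  have pos': "0 < 1 / lam" "0 < 1 / Lam" using pos by auto
  have max_inv: "max (1 / lam) (1 / Lam) = 1 / c"
    using pos by (auto simp: c_def max_def min_def field_simps)
  have inv_mono: "x \<le> y \<Longrightarrow> inv x \<le> inv y" for x y
    unfolding inv_def using pucci_le_iff[OF pos'] by simp
  have inv_lip: "\<bar>inv x - inv y\<bar> \<le> \<bar>x - y\<bar> / c" for x y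
    using pucci_lipschitz[OF pos', of x y] by (simp add: inv_def max_inv)
  have lip_z: "\<bar>\<Psi> s y - \<Psi> t y\<bar> \<le> real \<mu> * \<bar>s - t\<bar>" if "t \<le> s" for s t y
  proof -
    let ?a = "- k * pucci lam Lam s - f y" and ?b = "- k * pucci lam Lam t - f y"
    have le: "?a \<le> ?b" using that k pos by (simp add: mult_left_mono pucci_le_iff)
    have "k * (pucci lam Lam s - pucci lam Lam t) \<le> k * (m * (s - t))"
      using pucci_slope(2)[OF pos that] k by (intro mult_left_mono) (auto simp: m_def)
    then have "\<bar>?a - ?b\<bar> \<le> k * m * (s - t)"
      using le by (simp add: algebra_simps)
    then have "\<bar>inv ?a - inv ?b\<bar> \<le> k * m * (s - t) / c"
      using inv_lip[of ?a ?b] c by (meson divide_right_mono less_imp_le order_trans)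
    also have "\<dots> = k * m / c * (s - t)" by simp
    also have "\<dots> \<le> real \<mu> * (s - t)" using \<mu> that by (intro mult_right_mono) auto
    finally show ?thesis
      using inv_mono[OF le] that unfolding \<Psi>_def by (simp add: algebra_simps abs_le_iff)
  qed
  have lip_y: "\<bar>\<Psi> s x - \<Psi> s y\<bar> \<le> L / c * \<bar>x - y\<bar>" for s x y
    using order_trans[OF inv_lip[of "- k * pucci lam Lam s - f x" "- k * pucci lam Lam s - f y"]
        divide_right_mono[of _ "L * \<bar>x - y\<bar>" c]] L[of y x] c
    by (simp add: \<Psi>_def abs_minus_commute)
  interpret radial_contraction \<mu> "L / c" "B / c" \<xi> \<Psi>
  proof
    fix s t x y
    have "\<bar>\<Psi> s x - \<Psi> t x\<bar> \<le> real \<mu> * \<bar>s - t\<bar>"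
      using lip_z[of s t x] lip_z[of t s x] by (cases "s \<le> t") (auto simp: abs_minus_commute)
    then show "\<bar>\<Psi> s x - \<Psi> t y\<bar> \<le> real \<mu> * \<bar>s - t\<bar> + L / c * \<bar>x - y\<bar>"
      using lip_y[of t x y] by linarith
  next
    fix y
    show "\<bar>\<Psi> 0 y\<bar> \<le> B / c"
      using order_trans[OF inv_lip[of "- f y" 0] divide_right_mono[of "\<bar>- f y - 0\<bar>" B c]] B[of y] c
      by (simp add: \<Psi>_def inv_def)
  next
    show "0 \<le> L / c" using L0 c by simp
  qed
  obtain z where z: "continuous_on UNIV z" "radial_average \<mu> \<Psi> \<xi> z = z"
    using fixed_point_exists by blast
  define u where "u = radial_primitive \<xi> z"
  define u1 where "u1 r = r * z r" for r
  define F where "F s = \<Psi> (z s) (u s)" for s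
  define u2 where "u2 r = F r - real \<mu> * z r" for r
  have F: "continuous_on UNIV F"
    unfolding F_def[abs_def] u_def by (rule continuous_on_integrand[OF z(1)])
  obtain Q1 where Q1: "\<And>s. (Q1 has_real_derivative s * z s) (at s)"
    by (rule continuous_antiderivative[of "\<lambda>s. s * z s"]) (auto intro!: continuous_intros z(1))
  obtain Q2 where Q2: "\<And>s. (Q2 has_real_derivative s ^ \<mu> * F s) (at s)"
    by (rule continuous_antiderivative[of "\<lambda>s. s ^ \<mu> * F s"]) (auto intro!: continuous_intros F)
  have u_eq: "u = (\<lambda>r. \<xi> + (Q1 r - Q1 0))"
    using scaled_average_eq[of Q1 1 z] Q1
    by (auto simp: u_def radial_primitive_def power2_eq_square fun_eq_iff)
  have z_eq: "r ^ Suc \<mu> * z r = Q2 r - Q2 0" for r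
  proof -
    have "z r = integral {0..1} (\<lambda>t. t ^ \<mu> * F (r * t))"
      using fun_cong[OF z(2), of r] by (simp add: radial_average_def F_def u_def)
    then show ?thesis
      using scaled_average_eq[of Q2 \<mu> F r] Q2 by simp
  qed
  have du: "(u has_real_derivative u1 r) (at r)" for r
    unfolding u_eq u1_def by (auto intro!: derivative_eq_intros Q1)
  have du1: "(u1 has_real_derivative u2 r) (at r)" for r
  proof (cases "r = 0")
    case False
    have "((\<lambda>r. (Q2 r - Q2 0) / r ^ Suc \<mu>) has_real_derivative
        ((r ^ \<mu> * F r) * r ^ Suc \<mu> - (Q2 r - Q2 0) * (real (Suc \<mu>) * r ^ \<mu>)) / (r ^ Suc \<mu> * r ^ Suc \<mu>)) (at r)"
    proof (rule DERIV_divide)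
      show "((\<lambda>r. r ^ Suc \<mu>) has_real_derivative real (Suc \<mu>) * r ^ \<mu>) (at r)"
        using DERIV_pow[of "Suc \<mu>" r UNIV] by simp
    qed (use False in \<open>auto intro!: derivative_eq_intros Q2\<close>)
    also have "((r ^ \<mu> * F r) * r ^ Suc \<mu> - (Q2 r - Q2 0) * (real (Suc \<mu>) * r ^ \<mu>)) / (r ^ Suc \<mu> * r ^ Suc \<mu>)
        = (F r - real (Suc \<mu>) * z r) / r"
      unfolding z_eq[symmetric] using False by (simp add: field_simps)
    finally have "((\<lambda>r. (Q2 r - Q2 0) / r ^ Suc \<mu>) has_real_derivative (F r - real (Suc \<mu>) * z r) / r) (at r)" .
    then have "(z has_real_derivative (F r - real (Suc \<mu>) * z r) / r) (at r)"
    proof (rule has_field_derivative_transform_within_open[of _ _ _ "- {0}"])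
      show "(Q2 x - Q2 0) / x ^ Suc \<mu> = z x" if "x \<in> - {0}" for x
        using that z_eq[of x] by (auto simp: field_simps)
    qed (use False in auto)
    then show ?thesis
      unfolding u1_def u2_def using False
      by (auto intro!: derivative_eq_intros simp: field_simps)
  next
    case True
    (* at the origin the fixed point equation reads F 0 = (\<mu> + 1) z 0, that is, u'' = lim u'/r *)
    have "z 0 = radial_average \<mu> \<Psi> \<xi> z 0" by (simp add: z(2))
    also have "\<dots> = integral {0..1} (\<lambda>t. t ^ \<mu>) * F 0"
      by (simp add: radial_average_def F_def u_def)
    finally have "F 0 = (real \<mu> + 1) * z 0"
      by (simp add: integral_power_01 field_simps)
    then have "u2 0 = z 0" by (simp add: u2_def algebra_simps)
    moreover have "z \<midarrow>0\<rightarrow> z 0" using z(1) by (simp add: continuous_on_def)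
    then have "(\<lambda>h. (u1 (0 + h) - u1 0) / h) \<midarrow>0\<rightarrow> z 0"
      by (rule Lim_transform_eventually) (auto simp: eventually_at_filter u1_def)
    ultimately show ?thesis
      using True by (simp add: DERIV_def)
  qed
  have "c2_solution lam Lam N f \<infinity> u u1 u2"
    unfolding c2_solution_def ivl_infinity
  proof (intro conjI ballI impI)
    fix r :: real assume r: "0 < r"
    have "pucci lam Lam (u2 r) = - k * pucci lam Lam (z r) - f (u r)"
      unfolding u2_def F_def \<Psi>_def inv_def using pucci_inverse_right[OF pos] by simp
    moreover have "(real N - 1) / r * pucci lam Lam (u1 r) = k * pucci lam Lam (z r)"
      using r by (simp add: u1_def pucci_scale k_def)
    ultimately show "pucci lam Lam (u2 r) + (real N - 1) / r * pucci lam Lam (u1 r) + f (u r) = 0"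
      by simp
  next
    show "continuous_on {0..} u2"
      unfolding u2_def[abs_def] by (intro continuous_intros continuous_on_subset[OF F] continuous_on_subset[OF z(1)]) auto
  next
    show "u1 0 = 0" by (simp add: u1_def)
  qed (auto intro: has_field_derivative_at_within[OF du] has_field_derivative_at_within[OF du1])
  moreover have "u 0 = \<xi>" by (simp add: u_eq)
  ultimately show ?thesis by blast
qed

section \<open>Restriction, localisation and uniqueness of solutions\<close>

lemma open_less_ereal: "open {s. ereal s < R}"
  by (cases R) (auto simp: lessThan_def[symmetric])

lemma at_within_ivl_mono:
  assumes "R' \<le> R" "r \<in> ivl R'"
  shows "at r within ivl R' = at r within ivl R"
proof (rule at_within_nhd)
  show "open {s. ereal s < R'}" by (rule open_less_ereal)
qed (use assms in \<open>auto simp: mem_ivl\<close>)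

lemma at_within_ivl_interior:
  assumes "r \<in> ivl R" "0 < r"
  shows "at r within ivl R = at r"
proof (rule at_within_open_subset)
  show "open ({0<..} \<inter> {s. ereal s < R})" by (intro open_Int open_less_ereal) auto
qed (use assms in \<open>auto simp: mem_ivl\<close>)

lemma ivl_initial_segment: "\<rho> \<in> ivl R \<Longrightarrow> {0..\<rho>} \<subseteq> ivl R"
  by (auto simp: mem_ivl) (metis ereal_less_eq(3) le_less_trans)

lemma ivl_right_neighbourhood:
  assumes "r \<in> ivl R"
  obtains \<epsilon> where "0 < \<epsilon>" "{r..<r + \<epsilon>} \<subseteq> ivl R"
proof -
  obtain e where e: "0 < e" "ball r e \<subseteq> {s. ereal s < R}"
    using open_less_ereal[of R] assms by (auto simp: mem_ivl open_contains_ball)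
  have "{r..<r + e} \<subseteq> ivl R"
    using e(2) assms by (auto simp: mem_ivl subset_iff dist_real_def)
  with e(1) that show ?thesis by blast
qed

lemma ivl_derivative_unique:
  assumes "r \<in> ivl R"
    and "(f has_real_derivative D) (at r within ivl R)" "(f has_real_derivative D') (at r within ivl R)"
  shows "D = D'"
proof -
  obtain \<epsilon> where \<epsilon>: "0 < \<epsilon>" "{r..<r + \<epsilon>} \<subseteq> ivl R"
    using ivl_right_neighbourhood[OF assms(1)] by blast
  have "r islimpt ivl R"
  proof (rule islimpt_subset[OF _ \<epsilon>(2)])
    show "r islimpt {r..<r + \<epsilon>}"
      using \<epsilon>(1) by (simp add: islimpt_greaterThanLessThan1 islimpt_subset[of _ "{r<..<r + \<epsilon>}"] subset_iff)
  qed
  then have "at r within ivl R \<noteq> bot" by (simp add: trivial_limit_within)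
  then show ?thesis
    using has_field_derivative_unique assms(2,3) by blast
qed

context
  fixes lam Lam :: real and N :: nat and g :: "real \<Rightarrow> real"
begin

abbreviation sol where "sol \<equiv> c2_solution lam Lam N g"

lemma c2_solution_deriv:
  assumes "sol R u u1 u2" "r \<in> ivl R"
  shows "(u has_real_derivative u1 r) (at r within ivl R)" "(u1 has_real_derivative u2 r) (at r within ivl R)"
  using assms by (auto simp: c2_solution_def)

lemma c2_solution_deriv_interior:
  assumes "sol R u u1 u2" "r \<in> ivl R" "0 < r"
  shows "(u has_real_derivative u1 r) (at r)" "(u1 has_real_derivative u2 r) (at r)"
  using c2_solution_deriv[OF assms(1,2)] at_within_ivl_interior[OF assms(2,3)] by auto

lemma c2_solution_continuous:
  assumes "sol R u u1 u2"
  shows "continuous_on (ivl R) u" "continuous_on (ivl R) u1" "continuous_on (ivl R) u2"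
  using assms by (auto simp: c2_solution_def intro!: DERIV_continuous_on)

lemma c2_solution_equation:
  assumes "sol R u u1 u2" "r \<in> ivl R" "0 < r"
  shows "pucci lam Lam (u2 r) + (real N - 1) / r * pucci lam Lam (u1 r) + g (u r) = 0"
  using assms by (auto simp: c2_solution_def)

lemma c2_solution_u1_0: "sol R u u1 u2 \<Longrightarrow> u1 0 = 0"
  by (simp add: c2_solution_def)

lemma c2_solution_restrict:
  assumes "sol R u u1 u2" "R' \<le> R"
  shows "sol R' u u1 u2"
proof -
  have sub: "ivl R' \<subseteq> ivl R" using assms(2) by (auto simp: mem_ivl)
  show ?thesis
    unfolding c2_solution_def
  proof (intro conjI ballI impI)
    show "continuous_on (ivl R') u2" by (rule continuous_on_subset[OF c2_solution_continuous(3)[OF assms(1)] sub])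
  qed (use c2_solution_deriv[OF assms(1)] c2_solution_equation[OF assms(1)] c2_solution_u1_0[OF assms(1)]
      sub at_within_ivl_mono[OF assms(2)] in \<open>auto simp: subset_iff\<close>)
qed

lemma c2_solution_cong:
  assumes "sol R u u1 u2" and eq: "\<And>r. r \<in> ivl R \<Longrightarrow> v r = u r \<and> v1 r = u1 r \<and> v2 r = u2 r" and "0 < R"
  shows "sol R v v1 v2"
proof -
  have "(v has_real_derivative v1 r) (at r within ivl R)" "(v1 has_real_derivative v2 r) (at r within ivl R)"
    if "r \<in> ivl R" for r
    using has_field_derivative_transform_within[OF c2_solution_deriv(1)[OF assms(1) that] zero_less_one that, of v]
      has_field_derivative_transform_within[OF c2_solution_deriv(2)[OF assms(1) that] zero_less_one that, of v1]
      eq that by auto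
  moreover have "continuous_on (ivl R) v2"
    using c2_solution_continuous(3)[OF assms(1)] eq by (auto cong: continuous_on_cong_simp)
  moreover have "0 \<in> ivl R" using assms(3) by (rule zero_in_ivl)
  ultimately show ?thesis
    using assms(1) eq unfolding c2_solution_def by simp
qed

lemma c2_solution_derivs_unique:
  assumes "sol R u u1 u2" "sol R' u v1 v2" "r \<in> ivl R" "r \<in> ivl R'"
  shows "u1 r = v1 r \<and> u2 r = v2 r"
proof -
  let ?R = "min R R'"
  have sols: "sol ?R u u1 u2" "sol ?R u v1 v2"
    using assms(1,2) by (auto intro: c2_solution_restrict)
  have 1: "u1 s = v1 s" if "s \<in> ivl ?R" for s
    using sols[THEN c2_solution_deriv(1), OF that] by (rule ivl_derivative_unique[OF that])
  have r: "r \<in> ivl ?R" using assms(3,4) by (auto simp: mem_ivl)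
  have "(u1 has_real_derivative v2 r) (at r within ivl ?R)"
    using has_field_derivative_transform_within[OF c2_solution_deriv(2)[OF sols(2) r] zero_less_one r, of u1] 1 by simp
  then show ?thesis
    using ivl_derivative_unique[OF r c2_solution_deriv(2)[OF sols(1) r]] 1[OF r] by simp
qed

text \<open>Solutions can be glued: derivatives are unique, so those belonging to different subintervals
  agree automatically where the subintervals overlap.\<close>

lemma c2_solution_local:
  assumes "0 < R" and loc: "\<And>r. r \<in> ivl R \<Longrightarrow> \<exists>R'\<le>R. ereal r < R' \<and> (\<exists>u1 u2. sol R' u u1 u2)"
  shows "\<exists>u1 u2. sol R u u1 u2"
proof -
  obtain S U1 U2 where *: "\<And>r. r \<in> ivl R \<Longrightarrow> S r \<le> R \<and> ereal r < S r \<and> sol (S r) u (U1 r) (U2 r)"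
    using loc by metis
  define u1 where "u1 r = U1 r r" for r
  define u2 where "u2 r = U2 r r" for r
  have glob: "sol (S r) u u1 u2" if r: "r \<in> ivl R" for r
  proof (rule c2_solution_cong)
    show "sol (S r) u (U1 r) (U2 r)" using * r by blast
    fix s assume s: "s \<in> ivl (S r)"
    then have sR: "s \<in> ivl R" using *[OF r] by (auto simp: mem_ivl intro: less_le_trans)
    then have "s \<in> ivl (S s)" using *[OF sR] by (simp add: mem_ivl)
    then show "u s = u s \<and> u1 s = U1 r s \<and> u2 s = U2 r s"
      using c2_solution_derivs_unique[of "S s" u "U1 s" "U2 s" "S r" "U1 r" "U2 r" s] *[OF sR] *[OF r] s
      by (auto simp: u1_def u2_def)
  next
    have "0 \<le> ereal r" using r by (simp add: mem_ivl)
    then show "0 < S r" using *[OF r] by (meson le_less_trans)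
  qed
  have mem: "r \<in> ivl (S r)" if "r \<in> ivl R" for r
    using that *[OF that] by (simp add: mem_ivl)
  have "continuous_on (ivl R) u2"
    unfolding continuous_on_eq_continuous_within
  proof
    fix r assume r: "r \<in> ivl R"
    have "continuous (at r within ivl (S r)) u2"
      using c2_solution_continuous(3)[OF glob[OF r]] mem[OF r] by (simp add: continuous_on_eq_continuous_within)
    then show "continuous (at r within ivl R) u2"
      using at_within_ivl_mono[of "S r" R r] * r mem by simp
  qed
  moreover have "(u has_real_derivative u1 r) (at r within ivl R)" "(u1 has_real_derivative u2 r) (at r within ivl R)"
    if r: "r \<in> ivl R" for r
    using c2_solution_deriv[OF glob[OF r] mem[OF r]] at_within_ivl_mono[of "S r" R r] * r mem by auto
  moreover have "0 \<in> ivl R" using assms(1) by (rule zero_in_ivl)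
  then have "u1 0 = 0" using c2_solution_u1_0[OF glob] by blast
  ultimately have "sol R u u1 u2"
    using c2_solution_equation[OF glob mem] unfolding c2_solution_def by blast
  then show ?thesis by blast
qed

end

lemma c2_solution_change_source:
  assumes "c2_solution lam Lam N f R u u1 u2" "\<And>r. r \<in> ivl R \<Longrightarrow> f (u r) = g (u r)"
  shows "c2_solution lam Lam N g R u u1 u2"
  using assms by (auto simp: c2_solution_def)

text \<open>Strict monotonicity in product form: it turns a bound on \<open>e (M(s) - M(t))\<close> into one on
  \<open>e (s - t)\<close> when the latter is nonnegative.\<close>

lemma pucci_mult_diff:
  assumes "0 < lam" "0 < Lam" "0 \<le> e * (s - t)"
  shows "min lam Lam * (e * (s - t)) \<le> e * (pucci lam Lam s - pucci lam Lam t)"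
proof (cases s t rule: linorder_cases)
  case less
  then have "e \<le> 0" using assms(3) by (simp add: zero_le_mult_iff)
  then show ?thesis
    using mult_left_mono[OF pucci_slope(1)[OF assms(1,2), of s t], of "- e"] less by (simp add: algebra_simps)
next
  case greater
  then have "e \<ge> 0" using assms(3) by (simp add: zero_le_mult_iff)
  then show ?thesis
    using mult_left_mono[OF pucci_slope(1)[OF assms(1,2), of t s], of "e"] greater by (simp add: algebra_simps)
qed simp

text \<open>Gronwall's argument for \<open>(u - v)\<^sup>2 + (u' - v')\<^sup>2\<close>. The coefficient \<open>1/r\<close> is harmless because it
  multiplies \<open>(u' - v') (M(u') - M(v')) \<ge> 0\<close>.\<close>

lemma c2_solution_unique:
  assumes pos: "0 < lam" "0 < Lam" and N: "1 \<le> N"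
    and lip: "\<And>K. \<exists>L. \<forall>x y. \<bar>x\<bar> \<le> K \<and> \<bar>y\<bar> \<le> K \<longrightarrow> \<bar>g x - g y\<bar> \<le> L * \<bar>x - y\<bar>"
    and u: "c2_solution lam Lam N g R u u1 u2" and v: "c2_solution lam Lam N g R v v1 v2"
    and init: "u 0 = v 0" and \<rho>: "\<rho> \<in> ivl R"
  shows "u \<rho> = v \<rho>"
proof -
  have \<rho>0: "0 \<le> \<rho>" using \<rho> by (simp add: mem_ivl)
  have sub: "{0..\<rho>} \<subseteq> ivl R" using \<rho> by (rule ivl_initial_segment)
  note cont = continuous_on_subset[OF c2_solution_continuous(1)[OF u] sub]
    continuous_on_subset[OF c2_solution_continuous(2)[OF u] sub]
    continuous_on_subset[OF c2_solution_continuous(1)[OF v] sub]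
    continuous_on_subset[OF c2_solution_continuous(2)[OF v] sub]
  obtain K1 where K1: "\<forall>r\<in>{0..\<rho>}. \<bar>u r\<bar> \<le> K1"
    using compact_imp_bounded[OF compact_continuous_image[OF cont(1)]] by (auto simp: bounded_iff)
  obtain K2 where K2: "\<forall>r\<in>{0..\<rho>}. \<bar>v r\<bar> \<le> K2"
    using compact_imp_bounded[OF compact_continuous_image[OF cont(3)]] by (auto simp: bounded_iff)
  obtain L' where L': "\<And>x y. \<bar>x\<bar> \<le> max K1 K2 \<Longrightarrow> \<bar>y\<bar> \<le> max K1 K2 \<Longrightarrow> \<bar>g x - g y\<bar> \<le> L' * \<bar>x - y\<bar>"
    using lip[of "max K1 K2"] by blast
  define L where "L = max L' 0"
  have L0: "0 \<le> L" by (simp add: L_def)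
  have L: "\<bar>g (u r) - g (v r)\<bar> \<le> L * \<bar>u r - v r\<bar>" if "r \<in> {0..\<rho>}" for r
  proof -
    have "\<bar>g (u r) - g (v r)\<bar> \<le> L' * \<bar>u r - v r\<bar>"
      using K1 K2 that by (intro L') (auto simp: le_max_iff_disj)
    also have "\<dots> \<le> L * \<bar>u r - v r\<bar>" by (intro mult_right_mono) (auto simp: L_def)
    finally show ?thesis .
  qed
  define c where "c = min lam Lam"
  have c: "0 < c" using pos by (simp add: c_def)
  define M where "M = 1 + L / c"
  define E where "E r = (u r - v r)\<^sup>2 + (u1 r - v1 r)\<^sup>2" for r
  define F where "F r = E r * exp (- M * r)" for r
  have "F \<rho> \<le> F 0"
  proof (rule DERIV_nonpos_imp_decreasing_open[OF \<rho>0])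
    fix r assume r: "0 < r" "r < \<rho>"
    then have rm: "r \<in> {0..\<rho>}" "r \<in> ivl R" using sub by auto
    define d e w where "d = u r - v r" and "e = u1 r - v1 r" and "w = u2 r - v2 r"
    let ?k = "(real N - 1) / r"
    let ?a = "pucci lam Lam (u2 r) - pucci lam Lam (v2 r)"
    have eq: "?a = - ?k * (pucci lam Lam (u1 r) - pucci lam Lam (v1 r)) - (g (u r) - g (v r))"
      using c2_solution_equation[OF u rm(2) r(1)] c2_solution_equation[OF v rm(2) r(1)]
      by (simp add: algebra_simps)
    (* monotonicity of the operator gives the singular first-order term the dissipative sign *)
    have "0 \<le> e * (pucci lam Lam (u1 r) - pucci lam Lam (v1 r))"
      unfolding e_def using pos by (auto simp: zero_le_mult_iff pucci_le_iff)
    then have "0 \<le> ?k * (e * (pucci lam Lam (u1 r) - pucci lam Lam (v1 r)))"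
      using N r by simp
    then have "e * ?a \<le> - (e * (g (u r) - g (v r)))"
      unfolding eq by (simp add: algebra_simps)
    also have "\<dots> \<le> \<bar>e\<bar> * \<bar>g (u r) - g (v r)\<bar>"
      by (metis abs_ge_minus_self abs_mult)
    also have "\<dots> \<le> \<bar>e\<bar> * (L * \<bar>d\<bar>)"
      unfolding d_def by (intro mult_left_mono L rm) auto
    finally have ea: "e * ?a \<le> \<bar>e\<bar> * (L * \<bar>d\<bar>)" .
    have ew: "e * w \<le> L / c * (\<bar>e\<bar> * \<bar>d\<bar>)"
    proof (cases "0 \<le> e * w")
      case True
      have "c * (e * w) \<le> e * ?a"
        using pucci_mult_diff[OF pos, of e "u2 r" "v2 r"] True by (simp add: c_def w_def)
      with ea have "c * (e * w) \<le> L * (\<bar>e\<bar> * \<bar>d\<bar>)" by (simp add: mult_ac)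
      then show ?thesis using c by (simp add: field_simps)
    next
      case False
      moreover have "0 \<le> L / c * (\<bar>e\<bar> * \<bar>d\<bar>)" using L0 c by simp
      ultimately show ?thesis by linarith
    qed
    have "2 * (d * e + e * w) \<le> 2 * (M * (\<bar>e\<bar> * \<bar>d\<bar>))"
    proof -
      have "d * e \<le> \<bar>e\<bar> * \<bar>d\<bar>" by (metis abs_ge_self abs_mult mult.commute)
      with ew have "d * e + e * w \<le> M * (\<bar>e\<bar> * \<bar>d\<bar>)"
        unfolding M_def distrib_right by linarith
      then show ?thesis by (intro mult_left_mono) auto
    qed
    also have "\<dots> = M * (2 * \<bar>e\<bar> * \<bar>d\<bar>)" by simp
    also have "\<dots> \<le> M * (d\<^sup>2 + e\<^sup>2)"
    proof (rule mult_left_mono)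
      show "2 * \<bar>e\<bar> * \<bar>d\<bar> \<le> d\<^sup>2 + e\<^sup>2"
        using sum_squares_bound[of "\<bar>e\<bar>" "\<bar>d\<bar>"] by (simp add: add.commute)
    qed (use L0 c in \<open>simp add: M_def\<close>)
    finally have le: "2 * (d * e + e * w) \<le> M * E r" by (simp add: E_def d_def e_def)
    have "(F has_real_derivative (2 * (d * e + e * w) - M * E r) * exp (- M * r)) (at r)"
      unfolding F_def E_def d_def e_def w_def
      using c2_solution_deriv_interior[OF u rm(2) r(1)] c2_solution_deriv_interior[OF v rm(2) r(1)]
      by (auto intro!: derivative_eq_intros simp: algebra_simps)
    moreover have "(2 * (d * e + e * w) - M * E r) * exp (- M * r) \<le> 0"
      using le by (intro mult_nonpos_nonneg) auto
    ultimately show "\<exists>y. (F has_real_derivative y) (at r) \<and> y \<le> 0" by blast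
  next
    show "continuous_on {0..\<rho>} F"
      unfolding F_def E_def using cont by (intro continuous_intros)
  qed
  also have "F 0 = 0"
    using init c2_solution_u1_0[OF u] c2_solution_u1_0[OF v] by (simp add: F_def E_def)
  finally have "E \<rho> \<le> 0" by (simp add: F_def mult_le_0_iff)
  moreover have "0 \<le> (u \<rho> - v \<rho>)\<^sup>2" "0 \<le> (u1 \<rho> - v1 \<rho>)\<^sup>2" by simp_all
  ultimately have "(u \<rho> - v \<rho>)\<^sup>2 = 0" unfolding E_def by linarith
  then show ?thesis by simp
qed

section \<open>Maximal solutions\<close>

lemma clamp_lipschitz: "\<bar>max (- n) (min n x) - max (- n) (min n y)\<bar> \<le> \<bar>x - y\<bar>" for x y n :: real
  by (auto simp: max_def min_def)

text \<open>Clamping the argument of \<open>g\<close> to \<open>[- n, n]\<close> makes it bounded and globally Lipschitz.\<close>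

lemma truncated_solution_exists:
  assumes pos: "0 < lam" "0 < Lam" and N: "1 \<le> N" and n: "0 \<le> n"
    and lip: "\<And>K. \<exists>L. \<forall>x y. \<bar>x\<bar> \<le> K \<and> \<bar>y\<bar> \<le> K \<longrightarrow> \<bar>g x - g y\<bar> \<le> L * \<bar>x - y\<bar>"
  shows "\<exists>f L w w1 w2. (\<forall>x. \<bar>x\<bar> \<le> n \<longrightarrow> f x = g x) \<and> (\<forall>x y. \<bar>f x - f y\<bar> \<le> L * \<bar>x - y\<bar>) \<and>
    c2_solution lam Lam N f \<infinity> w w1 w2 \<and> w 0 = \<xi>"
proof -
  define tr where "tr x = max (- n) (min n x)" for x
  obtain L where L: "\<And>x y. \<bar>x\<bar> \<le> n \<Longrightarrow> \<bar>y\<bar> \<le> n \<Longrightarrow> \<bar>g x - g y\<bar> \<le> L * \<bar>x - y\<bar>"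
    using lip[of n] by blast
  have tr: "\<bar>tr x\<bar> \<le> n" for x using n by (auto simp: tr_def)
  have fL: "\<bar>g (tr x) - g (tr y)\<bar> \<le> max L 0 * \<bar>x - y\<bar>" for x y
  proof -
    have "\<bar>g (tr x) - g (tr y)\<bar> \<le> L * \<bar>tr x - tr y\<bar>" by (intro L tr)
    also have "\<dots> \<le> max L 0 * \<bar>tr x - tr y\<bar>" by (intro mult_right_mono) auto
    also have "\<dots> \<le> max L 0 * \<bar>x - y\<bar>"
      unfolding tr_def by (intro mult_left_mono clamp_lipschitz) auto
    finally show ?thesis .
  qed
  have fB: "\<bar>g (tr x)\<bar> \<le> \<bar>g 0\<bar> + max L 0 * n" for x
  proof -
    have "\<bar>g (tr x) - g 0\<bar> \<le> max L 0 * \<bar>tr x\<bar>"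
      using fL[of "tr x" 0] n tr[of x] by (simp add: tr_def)
    also have "\<dots> \<le> max L 0 * n" by (intro mult_left_mono tr) auto
    finally show ?thesis by linarith
  qed
  obtain w w1 w2 where "c2_solution lam Lam N (\<lambda>x. g (tr x)) \<infinity> w w1 w2" "w 0 = \<xi>"
    using bounded_lipschitz_solution_exists[OF pos N fL fB] by blast
  moreover have "g (tr x) = g x" if "\<bar>x\<bar> \<le> n" for x
    using that by (simp add: tr_def abs_le_iff)
  ultimately show ?thesis
    using fL by (intro exI[of _ "\<lambda>x. g (tr x)"]) blast
qed

text \<open>As long as the solution of the truncated equation stays below the truncation level it solves the
  original equation, by continuity also slightly beyond the last point considered.\<close>

lemma truncated_solution_continues:
  assumes w: "c2_solution lam Lam N f \<infinity> w w1 w2"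
    and fg: "\<forall>x. \<bar>x\<bar> \<le> n \<longrightarrow> f x = g x"
    and \<rho>: "0 \<le> \<rho>" and small: "\<And>s. 0 \<le> s \<Longrightarrow> s \<le> \<rho> \<Longrightarrow> \<bar>w s\<bar> < n"
  obtains \<epsilon> where "0 < \<epsilon>" "cauchy_solution lam Lam N g (w 0) (ereal (\<rho> + \<epsilon>)) w"
proof -
  have "continuous_on {0..} w" using c2_solution_continuous(1)[OF w] by simp
  then have "((\<lambda>s. \<bar>w s\<bar>) \<longlongrightarrow> \<bar>w \<rho>\<bar>) (at \<rho> within {0..})"
    using \<rho> by (intro tendsto_rabs) (auto simp: continuous_on_def)
  then have "eventually (\<lambda>s. \<bar>w s\<bar> < n) (at \<rho> within {0..})"
    using small[OF \<rho>] by (rule order_tendstoD(2)) simp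
  then obtain e where e: "0 < e" "\<And>s. 0 \<le> s \<Longrightarrow> s \<noteq> \<rho> \<Longrightarrow> dist s \<rho> < e \<Longrightarrow> \<bar>w s\<bar> < n"
    by (auto simp: eventually_at)
  have "\<bar>w s\<bar> < n" if "s \<in> ivl (ereal (\<rho> + e))" for s
    using that small[of s] e(2)[of s] by (cases "s \<le> \<rho>") (auto simp: dist_real_def)
  then have "c2_solution lam Lam N g (ereal (\<rho> + e)) w w1 w2"
    by (intro c2_solution_change_source[OF c2_solution_restrict[OF w]] fg[rule_format]) (auto intro: less_imp_le)
  then show ?thesis using that e(1) by (auto simp: cauchy_solution_iff)
qed

text \<open>The maximal interval ends at the supremum of all existence times, and uniqueness glues the
  solutions. If the glued solution is bounded by \<open>B\<close> on a finite interval, it coincides there with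
  the global solution of an equation truncated above \<open>B\<close>, which then continues it past the
  supremum.\<close>

lemma maximal_solution_exists:
  assumes pos: "0 < lam" "0 < Lam" and N: "1 \<le> N"
    and lip: "\<And>K. \<exists>L. \<forall>x y. \<bar>x\<bar> \<le> K \<and> \<bar>y\<bar> \<le> K \<longrightarrow> \<bar>g x - g y\<bar> \<le> L * \<bar>x - y\<bar>"
  shows "\<exists>R u. maximal_solution lam Lam N g \<xi> R u \<and> ((\<exists>B. \<forall>r\<in>ivl R. \<bar>u r\<bar> \<le> B) \<longrightarrow> R = \<infinity>)"
proof -
  define S where "S = {R. 0 < R \<and> (\<exists>v. cauchy_solution lam Lam N g \<xi> R v)}"
  have S_ne: "\<exists>\<epsilon>>0. ereal \<epsilon> \<in> S"
  proof -
    have n: "0 \<le> \<bar>\<xi>\<bar> + 1" by simp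
    obtain f L w w1 w2 where *: "\<forall>x. \<bar>x\<bar> \<le> \<bar>\<xi>\<bar> + 1 \<longrightarrow> f x = g x" "\<forall>x y. \<bar>f x - f y\<bar> \<le> L * \<bar>x - y\<bar>"
        "c2_solution lam Lam N f \<infinity> w w1 w2" "w 0 = \<xi>"
      using truncated_solution_exists[where \<xi> = \<xi>, OF pos N n lip] by blast
    have small: "\<bar>w s\<bar> < \<bar>\<xi>\<bar> + 1" if "0 \<le> s" "s \<le> 0" for s
      using that *(4) by simp
    obtain \<epsilon> where "0 < \<epsilon>" "cauchy_solution lam Lam N g (w 0) (ereal (0 + \<epsilon>)) w"
      by (rule truncated_solution_continues[OF *(3,1) order_refl small])
    then show ?thesis using *(4) by (auto simp: S_def)
  qed
  define R where "R = Sup S"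
  have R: "0 < R" using S_ne unfolding R_def
    by (metis Sup_upper ereal_less(2) less_le_trans)
  have uniq: "u r = v r" if uv: "cauchy_solution lam Lam N g \<xi> R1 u" "cauchy_solution lam Lam N g \<xi> R2 v"
      "r \<in> ivl R1" "r \<in> ivl R2" for u v R1 R2 r
  proof -
    obtain u1 u2 v1 v2 where "c2_solution lam Lam N g R1 u u1 u2" "c2_solution lam Lam N g R2 v v1 v2" "u 0 = v 0"
      using uv by (auto simp: cauchy_solution_iff)
    note sols = this
    have r: "r \<in> ivl (min R1 R2)" using uv(3,4) by (simp add: mem_ivl)
    show ?thesis
      by (rule c2_solution_unique[OF pos N lip c2_solution_restrict[OF sols(1)] c2_solution_restrict[OF sols(2)] sols(3) r])
         simp_all
  qed
  have "\<forall>r\<in>ivl R. \<exists>R' v. R' \<in> S \<and> ereal r < R' \<and> cauchy_solution lam Lam N g \<xi> R' v"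
  proof
    fix r assume "r \<in> ivl R"
    then obtain R' where "R' \<in> S" "ereal r < R'" by (auto simp: mem_ivl R_def less_Sup_iff)
    then show "\<exists>R' v. R' \<in> S \<and> ereal r < R' \<and> cauchy_solution lam Lam N g \<xi> R' v"
      unfolding S_def by blast
  qed
  then obtain S' V where V: "\<And>r. r \<in> ivl R \<Longrightarrow> S' r \<in> S \<and> ereal r < S' r \<and> cauchy_solution lam Lam N g \<xi> (S' r) (V r)"
    by metis
  define u where "u r = V r r" for r
  have u_eq: "u s = V r s" if "r \<in> ivl R" "s \<in> ivl (S' r)" for r s
  proof -
    have "S' r \<le> R" using V[OF that(1)] by (simp add: R_def Sup_upper)
    then have s: "s \<in> ivl R" using that(2) by (auto simp: mem_ivl intro: less_le_trans)
    then have "s \<in> ivl (S' s)" using V[OF s] by (simp add: mem_ivl)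
    then show ?thesis
      unfolding u_def using V[OF s] V[OF that(1)] that(2) uniq by blast
  qed
  have zero: "0 \<in> ivl R" using R by (rule zero_in_ivl)
  have "u 0 = \<xi>" using V[OF zero] by (auto simp: u_def cauchy_solution_iff)
  moreover have "\<exists>u1 u2. c2_solution lam Lam N g R u u1 u2"
  proof (rule c2_solution_local[OF R])
    fix r assume r: "r \<in> ivl R"
    obtain v1 v2 where v: "c2_solution lam Lam N g (S' r) (V r) v1 v2"
      using V[OF r] by (auto simp: cauchy_solution_iff)
    have "c2_solution lam Lam N g (S' r) u v1 v2"
      by (rule c2_solution_cong[OF v]) (use u_eq[OF r] V[OF r] in \<open>auto simp: S_def\<close>)
    then show "\<exists>R'\<le>R. ereal r < R' \<and> (\<exists>u1 u2. c2_solution lam Lam N g R' u u1 u2)"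
      using V[OF r] by (auto simp: R_def intro: Sup_upper)
  qed
  ultimately have u: "cauchy_solution lam Lam N g \<xi> R u"
    by (auto simp: cauchy_solution_iff)
  have top: "R' \<le> R" if "cauchy_solution lam Lam N g \<xi> R' v" for R' v
    using that R by (cases "0 < R'") (auto simp: R_def S_def intro: Sup_upper)
  have "maximal_solution lam Lam N g \<xi> R u"
    unfolding maximal_solution_def using R u top by (auto simp: not_less[symmetric])
  moreover have "R = \<infinity>" if bd: "\<forall>r\<in>ivl R. \<bar>u r\<bar> \<le> B" for B
  proof (rule ccontr)
    assume "R \<noteq> \<infinity>"
    with R obtain b where b: "R = ereal b" "0 < b" by (cases R) auto
    define n where "n = max B 0 + 1"
    have n: "0 \<le> n" by (simp add: n_def)
    obtain f L w w1 w2 where *: "\<forall>x. \<bar>x\<bar> \<le> n \<longrightarrow> f x = g x" "\<forall>x y. \<bar>f x - f y\<bar> \<le> L * \<bar>x - y\<bar>"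
        "c2_solution lam Lam N f \<infinity> w w1 w2" "w 0 = \<xi>"
      using truncated_solution_exists[where \<xi> = \<xi>, OF pos N n lip] by blast
    obtain u1 u2 where "c2_solution lam Lam N g R u u1 u2" using u by (auto simp: cauchy_solution_iff)
    then have "c2_solution lam Lam N f R u u1 u2"
    proof (rule c2_solution_change_source)
      fix r assume "r \<in> ivl R"
      then have "\<bar>u r\<bar> \<le> n" using bd unfolding n_def by fastforce
      then show "g (u r) = f (u r)" using *(1) by simp
    qed
    then have wu: "w r = u r" if "r \<in> ivl R" for r
    proof -
      assume u': "c2_solution lam Lam N f R u u1 u2"
      have init: "w 0 = u 0" using *(4) \<open>u 0 = \<xi>\<close> by simp
      have lipf: "\<exists>L. \<forall>x y. \<bar>x\<bar> \<le> K \<and> \<bar>y\<bar> \<le> K \<longrightarrow> \<bar>f x - f y\<bar> \<le> L * \<bar>x - y\<bar>" for K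
        using *(2) by blast
      show ?thesis
        by (rule c2_solution_unique[OF pos N lipf c2_solution_restrict[OF *(3)] u' init that]) simp
    qed
    have wB: "\<bar>w r\<bar> \<le> B" if "r \<in> {0..<b}" for r
      using wu[of r] bd that by (auto simp: b)
    have "continuous_on {0..} w" using c2_solution_continuous(1)[OF *(3)] by simp
    then have "continuous_on (closure {0..<b}) w" using b(2) by (auto intro: continuous_on_subset)
    then have "\<bar>w r\<bar> \<le> B" if "r \<in> {0..b}" for r
      using continuous_le_on_closure[of "{0..<b}" "\<lambda>r. \<bar>w r\<bar>" r B] wB that b(2)
      by (auto intro!: continuous_intros)
    then have "\<bar>w s\<bar> < n" if "0 \<le> s" "s \<le> b" for s
      using that by (force simp: n_def)
    then obtain \<epsilon> where "0 < \<epsilon>" "cauchy_solution lam Lam N g \<xi> (ereal (b + \<epsilon>)) w"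
      using truncated_solution_continues[OF *(3,1), of b] b(2) *(4) by auto
    then show False using top[of "ereal (b + \<epsilon>)" w] b by auto
  qed
  ultimately show ?thesis by blast
qed

section \<open>The quotient \<open>u'/r\<close> and supercritical initial values\<close>

text \<open>The value at the origin is the limit of \<open>u'/r\<close>.\<close>

definition radial_quotient :: "(real \<Rightarrow> real) \<Rightarrow> (real \<Rightarrow> real) \<Rightarrow> real \<Rightarrow> real" where
  "radial_quotient u1 u2 r = (if r = 0 then u2 0 else u1 r / r)"

lemma c2_solution_uminus:
  assumes "c2_solution lam Lam N g R u u1 u2" and odd: "\<forall>t. g (- t) = - g t"
  shows "c2_solution Lam lam N g R (\<lambda>r. - u r) (\<lambda>r. - u1 r) (\<lambda>r. - u2 r)"
  unfolding c2_solution_def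
proof (intro conjI ballI impI)
  show "continuous_on (ivl R) (\<lambda>r. - u2 r)"
    by (intro continuous_on_minus c2_solution_continuous[OF assms(1)])
next
  fix r assume "r \<in> ivl R" "0 < r"
  then show "pucci Lam lam (- u2 r) + (real N - 1) / r * pucci Lam lam (- u1 r) + g (- u r) = 0"
    using c2_solution_equation[OF assms(1), of r] odd by (simp add: pucci_minus)
qed (auto intro!: DERIV_minus c2_solution_deriv[OF assms(1)] simp: c2_solution_u1_0[OF assms(1)])

context
  fixes lam Lam :: real and N :: nat and g :: "real \<Rightarrow> real" and R :: ereal and u u1 u2 :: "real \<Rightarrow> real"
  assumes pos: "0 < lam" "0 < Lam" and N: "1 \<le> N" and cont_g: "continuous_on UNIV g"
    and R: "0 < R" and u: "c2_solution lam Lam N g R u u1 u2"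
begin

lemma radial_quotient_mult: "r * radial_quotient u1 u2 r = u1 r"
  using c2_solution_u1_0[OF u] by (simp add: radial_quotient_def)

lemma continuous_on_radial_quotient: "continuous_on (ivl R) (radial_quotient u1 u2)"
  unfolding continuous_on_eq_continuous_within
proof
  fix r assume r: "r \<in> ivl R"
  show "continuous (at r within ivl R) (radial_quotient u1 u2)"
  proof (cases "r = 0")
    case True
    have "((\<lambda>y. (u1 y - u1 0) / (y - 0)) \<longlongrightarrow> u2 0) (at 0 within ivl R)"
      using c2_solution_deriv(2)[OF u zero_in_ivl[OF R]] by (simp add: has_field_derivative_iff)
    then have "(radial_quotient u1 u2 \<longlongrightarrow> u2 0) (at 0 within ivl R)"
      by (rule Lim_transform_eventually)
         (auto simp: eventually_at_filter radial_quotient_def c2_solution_u1_0[OF u])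
    then show ?thesis
      using True by (simp add: continuous_within radial_quotient_def)
  next
    case False
    then have r0: "0 < r" using r by (simp add: mem_ivl)
    have "isCont u1 r" using c2_solution_deriv_interior(2)[OF u r r0] by (rule DERIV_isCont)
    then have "(\<lambda>s. u1 s / s) \<midarrow>r\<rightarrow> u1 r / r" using r0 by (intro tendsto_intros) (auto simp: isCont_def)
    then have "radial_quotient u1 u2 \<midarrow>r\<rightarrow> u1 r / r"
    proof (rule Lim_transform_eventually)
      have "eventually (\<lambda>s. 0 < s) (at r)"
        using r0 order_tendstoD(1)[OF tendsto_ident_at] by blast
      then show "eventually (\<lambda>s. u1 s / s = radial_quotient u1 u2 s) (at r)"
        by eventually_elim (simp add: radial_quotient_def)
    qed
    then show ?thesis
      using r0 at_within_ivl_interior[OF r r0] by (simp add: continuous_within radial_quotient_def)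
  qed
qed

text \<open>For \<open>r > 0\<close> this is the equation rewritten by homogeneity; at \<open>r = 0\<close> it is its limit, which
  determines \<open>u''(0)\<close>.\<close>

lemma radial_quotient_equation:
  assumes r: "r \<in> ivl R"
  shows "pucci lam Lam (u2 r) + (real N - 1) * pucci lam Lam (radial_quotient u1 u2 r) + g (u r) = 0"
proof -
  define h where "h r = pucci lam Lam (u2 r) + (real N - 1) * pucci lam Lam (radial_quotient u1 u2 r) + g (u r)" for r
  have h_pos: "h r = 0" if "r \<in> ivl R" "0 < r" for r
  proof -
    have "pucci lam Lam (u1 r) = r * pucci lam Lam (radial_quotient u1 u2 r)"
      using pucci_scale[of r lam Lam "radial_quotient u1 u2 r"] that radial_quotient_mult[of r] by simp
    then show ?thesis
      using c2_solution_equation[OF u that] that by (simp add: h_def)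
  qed
  have "continuous_on (ivl R) h"
    unfolding h_def
    by (intro continuous_intros c2_solution_continuous[OF u] continuous_on_radial_quotient
        continuous_on_compose2[OF cont_g c2_solution_continuous(1)[OF u]]) auto
  then have "(h \<longlongrightarrow> h 0) (at 0 within ivl R)"
    using zero_in_ivl[OF R] by (simp add: continuous_on_def)
  moreover have "(h \<longlongrightarrow> 0) (at 0 within ivl R)"
    by (rule tendsto_eventually) (auto simp: eventually_at_filter mem_ivl intro!: always_eventually h_pos)
  moreover have "at 0 within ivl R \<noteq> bot"
  proof
    assume "at 0 within ivl R = bot"
    then have "((\<lambda>_. 0) has_real_derivative 1) (at 0 within ivl R)" "((\<lambda>_. 0::real) has_real_derivative 0) (at 0 within ivl R)"
      by (simp_all add: has_field_derivative_iff)
    then show False using ivl_derivative_unique[OF zero_in_ivl[OF R]] by (metis zero_neq_one)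
  qed
  ultimately have "h 0 = 0" using tendsto_unique by blast
  then have "h r = 0" using h_pos[OF r] r by (cases "r = 0") (auto simp: mem_ivl)
  then show ?thesis by (simp add: h_def)
qed

text \<open>At a running minimum of \<open>u'/r\<close> the function \<open>u'\<close> touches the line through the origin
  from above, so its derivative does not exceed the slope of that line.\<close>

lemma radial_quotient_min:
  assumes r: "r \<in> ivl R" and min: "\<And>s. 0 \<le> s \<Longrightarrow> s \<le> r \<Longrightarrow> radial_quotient u1 u2 r \<le> radial_quotient u1 u2 s"
  shows "- g (u r) \<le> real N * pucci lam Lam (radial_quotient u1 u2 r)"
proof -
  let ?z = "radial_quotient u1 u2 r"
  have "u2 r \<le> ?z"
  proof (cases "r = 0")
    case True
    then show ?thesis by (simp add: radial_quotient_def)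
  next
    case False
    then have r0: "0 < r" using r by (simp add: mem_ivl)
    show ?thesis
    proof (rule ccontr)
      assume "\<not> u2 r \<le> ?z"
      moreover have "((\<lambda>s. u1 s - ?z * s) has_real_derivative u2 r - ?z) (at r)"
        using c2_solution_deriv_interior(2)[OF u r r0] by (auto intro!: derivative_eq_intros)
      ultimately obtain d where d: "d > 0" "\<And>h. h > 0 \<Longrightarrow> h < d \<Longrightarrow> u1 (r - h) - ?z * (r - h) < u1 r - ?z * r"
        using DERIV_pos_inc_left[of "\<lambda>s. u1 s - ?z * s" "u2 r - ?z" r] by auto
      define h where "h = min (d / 2) r"
      have h: "0 < h" "h < d" "h \<le> r" using d r0 by (auto simp: h_def)
      have "?z * (r - h) \<le> radial_quotient u1 u2 (r - h) * (r - h)"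
        using h by (intro mult_right_mono min) auto
      then have "0 \<le> u1 (r - h) - ?z * (r - h)"
        using radial_quotient_mult[of "r - h"] by (simp add: mult.commute)
      moreover have "u1 r - ?z * r = 0" using radial_quotient_mult[of r] by (simp add: mult.commute)
      ultimately show False using d(2)[OF h(1,2)] by simp
    qed
  qed
  then have "pucci lam Lam (u2 r) \<le> pucci lam Lam ?z" using pucci_le_iff[OF pos] by simp
  then show ?thesis using radial_quotient_equation[OF r] by (simp add: algebra_simps)
qed

lemma c2_solution_strict_mono:
  assumes ivl: "a \<in> ivl R" "b \<in> ivl R" "a < b"
    and z: "\<And>s. 0 \<le> s \<Longrightarrow> s < b \<Longrightarrow> 0 < radial_quotient u1 u2 s"
  shows "u a < u b"
proof (rule DERIV_pos_imp_increasing_open[OF ivl(3)])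
  have sub: "{a..b} \<subseteq> ivl R"
    using ivl_initial_segment[OF ivl(2)] ivl(1) by (auto simp: mem_ivl)
  then show "continuous_on {a..b} u" by (rule continuous_on_subset[OF c2_solution_continuous(1)[OF u]])
  fix s assume s: "a < s" "s < b"
  then have s': "s \<in> ivl R" "0 < s" using subsetD[OF sub, of s] ivl(1) by (auto simp: mem_ivl[of a])
  have "0 < u1 s" using z[of s] s s' radial_quotient_mult[of s] by (metis less_imp_le mult_pos_pos)
  then show "\<exists>y. (u has_real_derivative y) (at s) \<and> 0 < y"
    using c2_solution_deriv_interior(1)[OF u s'] by blast
qed

text \<open>Up to the first point where \<open>u'/r\<close> fails to be positive, \<open>u\<close> stays above its initial value. That
  point is a running minimum of \<open>u'/r\<close>, so \<open>u'/r\<close> is positive there after all.\<close>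

lemma radial_quotient_pos:
  assumes neg: "\<And>y. u 0 \<le> y \<Longrightarrow> g y < 0" and r: "r \<in> ivl R"
  shows "0 < radial_quotient u1 u2 r"
proof (rule ccontr)
  let ?z = "radial_quotient u1 u2"
  assume "\<not> 0 < ?z r"
  (* the infimum of S is the first point at which the quotient fails to be positive *)
  define S where "S = {s \<in> {0..r}. ?z s \<le> 0}"
  have r0: "0 \<le> r" using r by (simp add: mem_ivl)
  have sub: "{0..r} \<subseteq> ivl R" using r by (rule ivl_initial_segment)
  have "closed S"
    unfolding S_def using continuous_on_subset[OF continuous_on_radial_quotient sub]
    by (intro continuous_on_closed_Collect_le) auto
  moreover have "r \<in> S" using \<open>\<not> 0 < ?z r\<close> r0 by (simp add: S_def)
  moreover have bdd: "bdd_below S" by (rule bdd_belowI[of _ 0]) (simp add: S_def)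
  ultimately have Inf: "Inf S \<in> S" using closed_contains_Inf[of S] by blast
  define s where "s = Inf S"
  have s: "0 \<le> s" "s \<le> r" "?z s \<le> 0" using Inf by (auto simp: S_def s_def)
  have less: "0 < ?z t" if "0 \<le> t" "t < s" for t
    using that s(2) cInf_lower[OF _ bdd, of t] by (force simp: S_def s_def)
  have sR: "s \<in> ivl R" using s sub by auto
  have "- g (u s) \<le> real N * pucci lam Lam (?z s)"
    by (rule radial_quotient_min[OF sR]) (metis less s(3) less_eq_real_def order.strict_trans1 order_refl)
  also have "\<dots> \<le> 0" using s(3) pos by (auto intro: mult_nonneg_nonpos)
  finally have "0 \<le> g (u s)" by simp
  moreover have "u 0 \<le> u s"
    using c2_solution_strict_mono[OF zero_in_ivl[OF R] sR _ less] s(1) by (cases "s = 0") auto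
  ultimately show False using neg by (meson not_less)
qed

text \<open>The running minimum of \<open>u'/r\<close> is controlled by \<open>- g(u)\<close>, and \<open>- g\<close> is bounded below on the range
  of \<open>u\<close> as long as \<open>u \<le> b\<close>.\<close>

lemma radial_quotient_lower_bound:
  assumes neg: "\<And>y. u 0 \<le> y \<Longrightarrow> g y < 0" and c: "\<And>y. u 0 \<le> y \<Longrightarrow> y \<le> b \<Longrightarrow> c \<le> - g y"
    and r: "r \<in> ivl R" and le: "u r \<le> b"
  shows "c \<le> real N * Lam * radial_quotient u1 u2 r"
proof -
  let ?z = "radial_quotient u1 u2"
  have r0: "0 \<le> r" using r by (simp add: mem_ivl)
  have sub: "{0..r} \<subseteq> ivl R" using r by (rule ivl_initial_segment)
  obtain s where s: "s \<in> {0..r}" "\<And>t. t \<in> {0..r} \<Longrightarrow> ?z s \<le> ?z t"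
    using continuous_attains_inf[of "{0..r}" ?z] continuous_on_subset[OF continuous_on_radial_quotient sub] r0
    by fastforce
  have sR: "s \<in> ivl R" using s sub by auto
  have mono: "u x \<le> u y" if "x \<in> ivl R" "y \<in> ivl R" "x \<le> y" for x y
    using c2_solution_strict_mono[of x y] that radial_quotient_pos[OF neg] ivl_initial_segment[OF that(2)]
    by (cases "x = y") (auto simp: less_imp_le subset_iff)
  have "c \<le> - g (u s)"
    using mono[OF zero_in_ivl[OF R] sR] mono[OF sR r] s(1) le by (intro c) auto
  also have "\<dots> \<le> real N * pucci lam Lam (?z s)"
    using s by (intro radial_quotient_min[OF sR]) auto
  also have "\<dots> = real N * Lam * ?z s"
    using radial_quotient_pos[OF neg sR] by (simp add: pucci_nonneg)
  also have "\<dots> \<le> real N * Lam * ?z r"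
    using s(2)[of r] r0 pos by (intro mult_left_mono) auto
  finally show ?thesis .
qed

text \<open>A bounded global solution would satisfy \<open>u' \<ge> m r\<close> with \<open>m > 0\<close> and so grow quadratically.\<close>

lemma supercritical_unbounded:
  assumes neg: "\<And>y. u 0 \<le> y \<Longrightarrow> g y < 0" and inf: "R = \<infinity>"
  shows "\<exists>r\<in>ivl R. b < u r"
proof (rule ccontr)
  assume "\<not> (\<exists>r\<in>ivl R. b < u r)"
  then have le: "u r \<le> b" if "0 \<le> r" for r using that inf by (auto simp: not_less)
  have "compact {u 0..b}" "{u 0..b} \<noteq> {}" using le[of 0] by auto
  then obtain y0 where y0: "y0 \<in> {u 0..b}" "\<And>y. y \<in> {u 0..b} \<Longrightarrow> g y \<le> g y0"
    using continuous_attains_sup[of "{u 0..b}" g] continuous_on_subset[OF cont_g] by blast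
  define m where "m = - g y0 / (real N * Lam)"
  have NL: "0 < real N * Lam" using N pos by simp
  have m: "0 < m" using divide_neg_pos[OF neg[of y0] NL] y0(1) by (simp add: m_def)
  have z: "m \<le> radial_quotient u1 u2 r" if "0 \<le> r" for r
  proof -
    have "- g y0 \<le> real N * Lam * radial_quotient u1 u2 r"
      using that inf y0 le by (intro radial_quotient_lower_bound[OF neg, of b]) auto
    then show ?thesis using NL by (simp add: m_def field_simps)
  qed
  define r where "r = \<bar>b - u 0\<bar> / m + 1"
  have r: "1 \<le> r" using m by (simp add: r_def)
  have cont: "continuous_on {0..} u" using c2_solution_continuous(1)[OF u] inf by simp
  have "u 0 - m * 0\<^sup>2 / 2 \<le> u (2 * r) - m * (2 * r)\<^sup>2 / 2"
  proof (rule DERIV_nonneg_imp_increasing_open[where f = "\<lambda>s. u s - m * s\<^sup>2 / 2"])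
    fix s assume s: "0 < s" "s < 2 * r"
    have "((\<lambda>s. u s - m * s\<^sup>2 / 2) has_real_derivative u1 s - m * s) (at s)"
      using c2_solution_deriv_interior(1)[OF u, of s] s inf by (auto intro!: derivative_eq_intros)
    moreover have "m * s \<le> u1 s"
      using mult_left_mono[OF z[of s], of s] s radial_quotient_mult[of s] by (simp add: mult.commute)
    ultimately show "\<exists>y. ((\<lambda>s. u s - m * s\<^sup>2 / 2) has_real_derivative y) (at s) \<and> 0 \<le> y"
      by (auto intro: exI[of _ "u1 s - m * s"])
  next
    show "continuous_on {0..2 * r} (\<lambda>s. u s - m * s\<^sup>2 / 2)"
      by (intro continuous_intros continuous_on_subset[OF cont]) auto
  qed (use r in auto)
  then have "2 * (m * r\<^sup>2) \<le> b - u 0" using le[of "2 * r"] r by (simp add: power_mult_distrib)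
  moreover have "m * r \<le> m * r\<^sup>2" using m r by (intro mult_left_mono) (auto simp: power2_eq_square)
  moreover have "m * r = \<bar>b - u 0\<bar> + m" using m by (simp add: r_def field_simps)
  ultimately show False using m by linarith
qed

proposition supercritical_blow_up:
  assumes neg: "\<And>y. u 0 \<le> y \<Longrightarrow> g y < 0"
    and alt: "(\<exists>B. \<forall>r\<in>ivl R. \<bar>u r\<bar> \<le> B) \<longrightarrow> R = \<infinity>"
  shows "strict_mono_on (ivl R) u" "filterlim u at_top (right_end R)"
proof -
  have strict: "u x < u y" if "x \<in> ivl R" "y \<in> ivl R" "x < y" for x y
    using c2_solution_strict_mono[OF that] radial_quotient_pos[OF neg] ivl_initial_segment[OF that(2)]
    by (auto simp: subset_iff)
  then show "strict_mono_on (ivl R) u" by (auto intro: strict_mono_onI)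
  have mono: "u x \<le> u y" if "x \<in> ivl R" "y \<in> ivl R" "x \<le> y" for x y
    using strict[of x y] that by (cases "x = y") (auto simp: less_imp_le)
  have unb: "\<exists>r\<in>ivl R. b < u r" for b
  proof (rule ccontr)
    assume *: "\<not> (\<exists>r\<in>ivl R. b < u r)"
    have "\<bar>u r\<bar> \<le> max \<bar>b\<bar> \<bar>u 0\<bar>" if "r \<in> ivl R" for r
      using * mono[OF zero_in_ivl[OF R] that] that by (force simp: mem_ivl)
    then have "R = \<infinity>" using alt by blast
    then show False using supercritical_unbounded[OF neg] * by blast
  qed
  show "filterlim u at_top (right_end R)"
    unfolding filterlim_at_top
  proof
    fix b
    obtain a where a: "a \<in> ivl R" "b < u a" using unb by blast
    have "eventually (\<lambda>r. a < r \<and> r \<in> ivl R) (right_end R)"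
    proof (cases R)
      case (real c)
      then have "eventually (\<lambda>r. a < r \<and> r < c) (at_left c)"
        using a by (auto simp: mem_ivl eventually_at_left intro!: exI[of _ a])
      then have "eventually (\<lambda>r. a < r \<and> r \<in> ivl R) (at_left c)"
        by eventually_elim (use a real in \<open>auto simp: mem_ivl\<close>)
      then show ?thesis using real by (simp add: right_end_def)
    next
      case PInf
      have "eventually (\<lambda>r. a < r) at_top" by (rule eventually_gt_at_top)
      then have "eventually (\<lambda>r. a < r \<and> r \<in> ivl R) at_top"
        by eventually_elim (use a PInf in \<open>auto simp: mem_ivl\<close>)
      then show ?thesis using PInf by (simp add: right_end_def)
    next
      case MInf
      then show ?thesis using R by simp
    qed
    then show "eventually (\<lambda>r. b \<le> u r) (right_end R)"
      by eventually_elim (use a mono in \<open>force\<close>)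
  qed
qed

end

section \<open>The primitive of the source\<close>

lemma primitive_deriv:
  assumes "continuous_on UNIV g"
  shows "(primitive g has_real_derivative g t) (at t)"
proof -
  define a where "a = - \<bar>t\<bar> - 1"
  define b where "b = \<bar>t\<bar> + 1"
  have "((\<lambda>x. LBINT y=ereal 0..ereal x. g y) has_vector_derivative g t) (at t within {a..b})"
    by (rule interval_integral_FTC2) (auto simp: a_def b_def intro: continuous_on_subset[OF assms])
  moreover have "at t within {a..b} = at t"
    by (rule at_within_Icc_at) (auto simp: a_def b_def)
  ultimately show ?thesis
    by (simp add: primitive_def[abs_def] zero_ereal_def has_real_derivative_iff_has_vector_derivative)
qed

lemma primitive_0 [simp]: "primitive g 0 = 0"
  by (simp add: primitive_def flip: zero_ereal_def)

lemma primitive_even: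
  assumes "continuous_on UNIV g" "\<forall>t. g (- t) = - g t"
  shows "primitive g (- t) = primitive g t"
proof -
  have "((\<lambda>t. primitive g (- t) - primitive g t) has_real_derivative 0) (at s)" for s
  proof -
    have "(uminus has_real_derivative - 1) (at s)" by (auto intro!: derivative_eq_intros)
    from DERIV_chain2[where f = "primitive g", OF primitive_deriv[OF assms(1)] this]
    have "((\<lambda>t. primitive g (- t)) has_real_derivative g s) (at s)" using assms(2) by simp
    from DERIV_diff[OF this primitive_deriv[OF assms(1)]] show ?thesis by simp
  qed
  then have "primitive g (- t) - primitive g t = primitive g (- 0) - primitive g 0"
    using DERIV_isconst_all[of "\<lambda>t. primitive g (- t) - primitive g t" t 0] by blast
  then show ?thesis by simp
qed

text \<open>Near 0 the slope is about \<open>D\<close>; away from 0 the quotient \<open>g x / x\<close> is positive on a compact set.\<close>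

lemma linear_lower_bound:
  fixes g :: "real \<Rightarrow> real"
  assumes "continuous_on UNIV g" "g 0 = 0" and D: "(g has_real_derivative D) (at 0)" "0 < D"
    and pos: "\<And>x. 0 < x \<Longrightarrow> x \<le> b \<Longrightarrow> 0 < g x"
  shows "\<exists>k>0. \<forall>x. 0 < x \<and> x \<le> b \<longrightarrow> k * x \<le> g x"
proof -
  have "((\<lambda>x. g x - D / 2 * x) has_real_derivative D / 2) (at 0)"
    using D(1) by (auto intro!: derivative_eq_intros)
  then obtain d where d: "0 < d" "\<And>h. 0 < h \<Longrightarrow> h < d \<Longrightarrow> D / 2 * h < g h"
    using DERIV_pos_inc_right[of "\<lambda>x. g x - D / 2 * x" "D / 2" 0] D(2) assms(2) by force
  show ?thesis
  proof (cases "d / 2 \<le> b")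
    case False
    then show ?thesis using d D(2) by (intro exI[of _ "D / 2"]) (auto intro!: less_imp_le)
  next
    case True
    then obtain y where y: "y \<in> {d / 2..b}" "\<And>x. x \<in> {d / 2..b} \<Longrightarrow> g y \<le> g x"
      using continuous_attains_inf[OF _ _ continuous_on_subset[OF assms(1) subset_UNIV], of "{d / 2..b}"]
      by auto
    have b: "0 < b" using True d by simp
    have gy: "0 < g y" using y(1) d(1) by (intro pos) auto
    have "min (D / 2) (g y / b) * x \<le> g x" if x: "0 < x" "x \<le> b" for x
    proof (cases "x < d")
      case True
      have "min (D / 2) (g y / b) * x \<le> D / 2 * x"
        by (rule mult_right_mono[OF min.cobounded1]) (use x in simp)
      then show ?thesis using d(2)[OF x(1) True] by linarith
    next
      case False
      have "min (D / 2) (g y / b) * x \<le> g y / b * b"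
        by (rule mult_mono[OF min.cobounded2]) (use x gy b in auto)
      also have "\<dots> \<le> g x" using y(2)[of x] x False d(1) b by simp
      finally show ?thesis .
    qed
    then show ?thesis using D(2) gy b by (intro exI[of _ "min (D / 2) (g y / b)"]) auto
  qed
qed

section \<open>Oscillation\<close>

text \<open>The gain \<open>P\<close> is divided by the smaller and the loss \<open>Q\<close> by the larger constant, so the estimate
  is valid whatever the sign of \<open>a\<close>.\<close>

lemma pucci_le_imp:
  assumes "0 < lam" "0 < Lam" "0 \<le> P" "0 \<le> Q" and "pucci lam Lam a \<le> P - Q"
  shows "a \<le> P / min lam Lam - Q / max lam Lam"
proof -
  define e where "e = pucci_coeff lam Lam a"
  have e: "min lam Lam \<le> e" "e \<le> max lam Lam" "0 < e"
    using assms(1,2) by (auto simp: e_def pucci_coeff_def)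
  have "a \<le> P / e - Q / e"
    using assms(5) e(3) by (simp add: pucci_def e_def[symmetric] field_simps)
  moreover have "P / e \<le> P / min lam Lam" using e assms by (intro divide_left_mono) auto
  moreover have "Q / max lam Lam \<le> Q / e" using e assms by (intro divide_left_mono) auto
  ultimately show ?thesis by linarith
qed

text \<open>A Riccati inequality \<open>w' \<ge> w\<^sup>2 / 2 + \<delta>\<close> cannot persist: \<open>w\<close> passes 1, and then
  \<open>- 1 / w\<close>, which is negative, grows at least at the rate 1/2.\<close>

lemma riccati_blow_up:
  fixes w w' :: "real \<Rightarrow> real"
  assumes deriv: "\<And>r. a \<le> r \<Longrightarrow> (w has_real_derivative w' r) (at r)"
    and ineq: "\<And>r. a \<le> r \<Longrightarrow> (w r)\<^sup>2 / 2 + \<delta> \<le> w' r" and \<delta>: "0 < \<delta>"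
  shows False
proof -
  define b where "b = a + (1 + \<bar>w a\<bar>) / \<delta>"
  have ab: "a \<le> b" using \<delta> by (simp add: b_def)
  have ge1: "1 \<le> w r" if r: "b \<le> r" for r
  proof -
    have "w a - \<delta> * a \<le> w r - \<delta> * r"
    proof (rule DERIV_nonneg_imp_nondecreasing[where f = "\<lambda>r. w r - \<delta> * r"])
      show "a \<le> r" using ab r by simp
      fix x assume x: "a \<le> x" "x \<le> r"
      have "((\<lambda>r. w r - \<delta> * r) has_real_derivative w' x - \<delta>) (at x)"
        using deriv[OF x(1)] by (auto intro!: derivative_eq_intros)
      moreover have "0 \<le> (w x)\<^sup>2 / 2" by simp
      then have "0 \<le> w' x - \<delta>" using ineq[OF x(1)] by linarith
      ultimately show "\<exists>y. ((\<lambda>r. w r - \<delta> * r) has_real_derivative y) (at x) \<and> 0 \<le> y" by blast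
    qed
    moreover have "\<delta> * b - \<delta> * a = 1 + \<bar>w a\<bar>"
      using \<delta> by (simp add: b_def field_simps)
    moreover have "\<delta> * b \<le> \<delta> * r" using r \<delta> by simp
    ultimately show ?thesis by linarith
  qed
  have "- 1 / w b - b / 2 \<le> - 1 / w (b + 4) - (b + 4) / 2"
  proof (rule DERIV_nonneg_imp_nondecreasing[where f = "\<lambda>r. - 1 / w r - r / 2"])
    fix x assume x: "b \<le> x" "x \<le> b + 4"
    then have ax: "a \<le> x" using ab by simp
    have w1: "1 \<le> w x" by (rule ge1[OF x(1)])
    have "((\<lambda>r. - 1 / w r - r / 2) has_real_derivative w' x / (w x)\<^sup>2 - 1 / 2) (at x)"
      using deriv[OF ax] w1 by (auto intro!: derivative_eq_intros simp: power2_eq_square)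
    moreover have "(w x)\<^sup>2 / 2 \<le> w' x" using ineq[OF ax] \<delta> by linarith
    then have "0 \<le> w' x / (w x)\<^sup>2 - 1 / 2" using w1 by (simp add: field_simps)
    ultimately show "\<exists>y. ((\<lambda>r. - 1 / w r - r / 2) has_real_derivative y) (at x) \<and> 0 \<le> y" by blast
  qed simp
  moreover have "1 / w b \<le> 1" "0 < 1 / w (b + 4)"
    using ge1[of b] ge1[of "b + 4"] by auto
  ultimately show False by (simp add: field_simps)
qed

text \<open>For \<open>u > 0\<close> the quotient \<open>w = - u'/u\<close> satisfies \<open>w' = w\<^sup>2 - u''/u \<ge> w\<^sup>2 - D |w|/r + k/m\<close> with \<open>m\<close> the
  larger ellipticity constant, since \<open>g(u) \<ge> k u\<close>. For large \<open>r\<close> the middle term is absorbed by the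
  other two and the Riccati inequality results.\<close>

lemma no_positive_tail:
  assumes pos: "0 < lam" "0 < Lam" and N: "1 \<le> N"
    and u: "c2_solution lam Lam N g \<infinity> u u1 u2"
    and k: "0 < k" "\<And>x. 0 < x \<Longrightarrow> x \<le> \<beta> \<Longrightarrow> k * x \<le> g x"
    and bound: "\<And>r. 0 \<le> r \<Longrightarrow> u r \<le> \<beta>" and tail: "\<And>r. a \<le> r \<Longrightarrow> 0 < u r"
  shows False
proof -
  define c m where "c = min lam Lam" and "m = max lam Lam"
  have c: "0 < c" and m: "0 < m" using pos by (auto simp: c_def m_def)
  define D where "D = (real N - 1) * m / c"
  have D: "0 \<le> D" using N c m by (simp add: D_def)
  define \<delta> where "\<delta> = k / m"
  have \<delta>: "0 < \<delta>" using k m by (simp add: \<delta>_def)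
  define b where "b = max (max a 1) (D / sqrt \<delta>)"
  have b: "a \<le> b" "1 \<le> b" "D / sqrt \<delta> \<le> b" by (auto simp: b_def)
  define w where "w r = - u1 r / u r" for r
  show False
  proof (rule riccati_blow_up[of b w "\<lambda>r. (w r)\<^sup>2 - u2 r / u r" "\<delta> / 2"])
    fix r assume r: "b \<le> r"
    then have r0: "0 < r" "r \<in> ivl \<infinity>" and ur: "0 < u r" using b tail[of r] by auto
    show "(w has_real_derivative (w r)\<^sup>2 - u2 r / u r) (at r)"
      unfolding w_def using c2_solution_deriv_interior[OF u r0(2,1)] ur
      by (auto intro!: derivative_eq_intros simp: power2_eq_square field_simps)
    have "pucci lam Lam (u2 r) \<le> (real N - 1) / r * (m * \<bar>u1 r\<bar>) - k * u r"
    proof -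
      have "k * u r \<le> g (u r)" using k(2)[OF ur] bound r0 by simp
      moreover have "(real N - 1) / r * - pucci lam Lam (u1 r) \<le> (real N - 1) / r * (m * \<bar>u1 r\<bar>)"
        using pucci_abs_le[OF pos, of "u1 r"] N r0 by (intro mult_left_mono) (auto simp: m_def abs_le_iff)
      ultimately show ?thesis using c2_solution_equation[OF u r0(2,1)] by simp
    qed
    from pucci_le_imp[OF pos _ _ this]
    have "u2 r \<le> (real N - 1) / r * (m * \<bar>u1 r\<bar>) / c - k * u r / m"
      using N r0 m ur k(1) by (simp add: c_def m_def)
    then have "u2 r / u r \<le> ((real N - 1) / r * (m * \<bar>u1 r\<bar>) / c - k * u r / m) / u r"
      using ur by (intro divide_right_mono) auto
    also have "\<dots> = D / r * \<bar>w r\<bar> - \<delta>"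
      using ur by (subst diff_divide_distrib[of _ _ "u r"]) (simp add: D_def w_def \<delta>_def mult_ac)
    also have "D / r * \<bar>w r\<bar> \<le> sqrt \<delta> * \<bar>w r\<bar>"
    proof (rule mult_right_mono)
      have "D / sqrt \<delta> \<le> r" using b r by simp
      then show "D / r \<le> sqrt \<delta>" using \<delta> r0 by (simp add: field_simps)
    qed simp
    also have "sqrt \<delta> * \<bar>w r\<bar> \<le> (\<delta> + (w r)\<^sup>2) / 2"
      using sum_squares_bound[of "sqrt \<delta>" "\<bar>w r\<bar>"] \<delta> by simp
    finally show "(w r)\<^sup>2 / 2 + \<delta> / 2 \<le> (w r)\<^sup>2 - u2 r / u r" by (simp add: field_simps)
  qed (use \<delta> in simp)
qed

lemma bounded_solution_oscillates:
  assumes pos: "0 < lam" "0 < Lam" and N: "1 \<le> N"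
    and u: "c2_solution lam Lam N g \<infinity> u u1 u2" and odd: "\<forall>t. g (- t) = - g t"
    and k: "0 < k" "\<And>x. 0 < x \<Longrightarrow> x \<le> \<beta> \<Longrightarrow> k * x \<le> g x"
    and bound: "\<And>r. 0 \<le> r \<Longrightarrow> \<bar>u r\<bar> \<le> \<beta>"
  shows "oscillating u"
proof -
  have "\<exists>s. real n \<le> s \<and> u s = 0" for n
  proof (rule ccontr)
    assume no: "\<nexists>s. real n \<le> s \<and> u s = 0"
    have cont: "continuous_on {real n..} u"
      using c2_solution_continuous(1)[OF u] by (auto intro: continuous_on_subset)
    have conn: "connected (u ` {real n..})"
      by (intro connected_continuous_image cont) simp
    have zero: "0 \<notin> u ` {real n..}" using no by force
    show False
    proof (cases "0 < u (real n)")
      case True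
      have "0 < u r" if "real n \<le> r" for r
        using connectedD_interval[OF conn, of "u r" "u (real n)" 0] that zero True by (force simp: not_less)
      then show False
        using no_positive_tail[where a = "real n", OF pos N u k] bound by (auto simp: abs_le_iff)
    next
      case False
      have "0 < - u r" if "real n \<le> r" for r
        using connectedD_interval[OF conn, of "u (real n)" "u r" 0] that zero False by (force simp: not_less)
      then show False
        using no_positive_tail[where a = "real n", OF pos(2,1) N c2_solution_uminus[OF u odd] k] bound
        by (auto simp: abs_le_iff)
    qed
  qed
  then obtain s where s: "\<And>n. real n \<le> s n \<and> u (s n) = 0" by metis
  have "\<not> bdd_above (range s)"
  proof
    assume "bdd_above (range s)"
    then obtain M where "\<And>n. s n \<le> M" by (auto simp: bdd_above_def)
    then have "real n \<le> M" for n using s[of n] order_trans by blast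
    then show False using reals_Archimedean2[of M] by (meson not_less)
  qed
  moreover have "0 \<le> s n" for n using s[of n] by linarith
  ultimately show ?thesis using s unfolding oscillating_def by (intro exI[of _ s]) simp
qed

section \<open>A Lyapunov function for subcritical initial values\<close>

text \<open>Inside the well and with the original potential \<open>G\<close>, the energy that decreases along solutions
  is \<open>lam u'\<^sup>2/2 + G(u)\<close> while \<open>u > 0\<close> and \<open>Lam u'\<^sup>2/2 + G(u)\<close> while \<open>u < 0\<close>. Multiplying the second one by \<open>lam / Lam\<close> makes
  the two agree at \<open>u = 0\<close>.\<close>

definition weighted_primitive :: "real \<Rightarrow> real \<Rightarrow> (real \<Rightarrow> real) \<Rightarrow> real \<Rightarrow> real" where
  "weighted_primitive lam Lam g x = (if 0 \<le> x then primitive g x else lam / Lam * primitive g x)"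

definition energy :: "real \<Rightarrow> real \<Rightarrow> (real \<Rightarrow> real) \<Rightarrow> (real \<Rightarrow> real) \<Rightarrow> (real \<Rightarrow> real) \<Rightarrow> real \<Rightarrow> real" where
  "energy lam Lam g u u1 r = lam * (u1 r)\<^sup>2 / 2 + weighted_primitive lam Lam g (u r)"

text \<open>The potential has no kink at 0 because \<open>g 0 = 0\<close>.\<close>

lemma weighted_primitive_deriv:
  assumes cont: "continuous_on UNIV g" and g0: "g 0 = 0"
  shows "(weighted_primitive lam Lam g has_real_derivative (if 0 \<le> x then g x else lam / Lam * g x)) (at x)"
proof (cases x "0::real" rule: linorder_cases)
  case less
  have "((\<lambda>x. lam / Lam * primitive g x) has_real_derivative lam / Lam * g x) (at x)"
    by (intro DERIV_cmult primitive_deriv cont)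
  then have "(weighted_primitive lam Lam g has_real_derivative lam / Lam * g x) (at x)"
    by (rule has_field_derivative_transform_within_open[of _ _ _ "{..<0}"])
       (use less in \<open>auto simp: weighted_primitive_def\<close>)
  then show ?thesis using less by simp
next
  case greater
  have "(weighted_primitive lam Lam g has_real_derivative g x) (at x)"
    by (rule has_field_derivative_transform_within_open[OF primitive_deriv[OF cont], of "{0<..}"])
       (use greater in \<open>auto simp: weighted_primitive_def\<close>)
  then show ?thesis using greater by simp
next
  case equal
  have "(\<lambda>h. primitive g h / h) \<midarrow>0\<rightarrow> 0"
    using primitive_deriv[OF cont, of 0] g0 by (simp add: DERIV_def)
  then have "(\<lambda>h. (1 + \<bar>lam / Lam\<bar>) * \<bar>primitive g h / h\<bar>) \<midarrow>0\<rightarrow> (1 + \<bar>lam / Lam\<bar>) * \<bar>0\<bar>"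
    by (intro tendsto_intros)
  then have "(\<lambda>h. (1 + \<bar>lam / Lam\<bar>) * \<bar>primitive g h / h\<bar>) \<midarrow>0\<rightarrow> 0" by simp
  then have "(\<lambda>h. weighted_primitive lam Lam g h / h) \<midarrow>0\<rightarrow> 0"
  proof (rule Lim_null_comparison[rotated], intro always_eventually allI)
    fix h
    show "norm (weighted_primitive lam Lam g h / h) \<le> (1 + \<bar>lam / Lam\<bar>) * \<bar>primitive g h / h\<bar>"
    proof (cases "0 \<le> h")
      case True
      have "1 * \<bar>primitive g h / h\<bar> \<le> (1 + \<bar>lam / Lam\<bar>) * \<bar>primitive g h / h\<bar>"
        by (intro mult_right_mono) auto
      then show ?thesis using True by (simp add: weighted_primitive_def)
    next
      case False
      have "\<bar>lam / Lam\<bar> * \<bar>primitive g h / h\<bar> \<le> (1 + \<bar>lam / Lam\<bar>) * \<bar>primitive g h / h\<bar>"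
        by (intro mult_right_mono) auto
      then show ?thesis using False by (simp add: weighted_primitive_def abs_mult)
    qed
  qed
  then show ?thesis using equal g0 by (simp add: DERIV_def weighted_primitive_def)
qed

text \<open>Read \<open>x, p, a\<close> as \<open>u, u', u''\<close>, \<open>k\<close> as \<open>(N - 1) / r\<close> and \<open>y\<close> as \<open>g(u)\<close>: the left-hand side is the
  derivative of the energy. If \<open>u''\<close> has the sign for which the potential is scaled, the potential
  terms cancel exactly; otherwise \<open>lam \<le> Lam\<close> and the equation give what remains the good sign.\<close>

lemma energy_dissipation:
  fixes lam Lam k a p x y :: real
  assumes lam: "0 < lam" "lam \<le> Lam" and k: "0 \<le> k"
    and eq: "pucci lam Lam a + k * pucci lam Lam p + y = 0"
    and sgn: "0 \<le> x \<Longrightarrow> 0 \<le> y" "x < 0 \<Longrightarrow> y \<le> 0"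
  shows "lam * p * a + (if 0 \<le> x then y else lam / Lam * y) * p \<le> - (lam\<^sup>2 / Lam * k * p\<^sup>2)"
proof -
  define q where "q = lam / Lam"
  have Lam: "0 < Lam" and q: "0 < q" "q \<le> 1" "q * Lam = lam"
    using lam by (auto simp: q_def)
  define d where "d = k * (p * pucci lam Lam p)"
  have "lam * p\<^sup>2 \<le> p * pucci lam Lam p"
    using mult_right_mono[OF lam(2), of "p * p"] by (auto simp: pucci_def pucci_coeff_def power2_eq_square mult_ac)
  then have d: "k * (lam * p\<^sup>2) \<le> d" unfolding d_def using k by (intro mult_left_mono)
  then have d0: "0 \<le> d" using k lam by (meson mult_nonneg_nonneg order_trans less_imp_le zero_le_power2)
  have goal: ?thesis if "lam * p * a + (if 0 \<le> x then y else q * y) * p \<le> - (q * d)"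
  proof -
    have "lam\<^sup>2 / Lam * k * p\<^sup>2 = q * (k * (lam * p\<^sup>2))" by (simp add: q_def power2_eq_square)
    also have "\<dots> \<le> q * d" using d q by (intro mult_left_mono) auto
    finally show ?thesis using that unfolding q_def[symmetric] by linarith
  qed
  have qd: "q * d \<le> d" using mult_right_mono[OF q(2) d0] by simp
  have eqp: "p * pucci lam Lam a = - d - p * y"
  proof -
    have "pucci lam Lam a = - (k * pucci lam Lam p) - y" using eq by simp
    then show ?thesis unfolding d_def by (simp add: right_diff_distrib mult.left_commute)
  qed
  show ?thesis
  proof (cases "0 \<le> a")
    case True
    have "lam * p * a = q * (p * (Lam * a))" unfolding q(3)[symmetric] by (simp add: mult_ac)
    also have "p * (Lam * a) = - d - p * y" using eqp True by (simp add: pucci_nonneg)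
    finally have "lam * p * a = q * (- d - p * y)" .
    moreover have "(1 - q) * (y * p) \<le> 0" if "0 \<le> x"
    proof (cases "p \<le> 0")
      case True
      then show ?thesis using sgn(1)[OF that] q by (intro mult_nonneg_nonpos) (auto simp: mult_nonneg_nonpos)
    next
      case False
      then have "0 \<le> k * pucci lam Lam p" "0 \<le> pucci lam Lam a" using k lam Lam \<open>0 \<le> a\<close> by auto
      then have "y = 0" using eq sgn(1)[OF that] by linarith
      then show ?thesis by simp
    qed
    ultimately show ?thesis by (intro goal) (auto simp: algebra_simps)
  next
    case False
    then have a: "lam * p * a = - d - y * p" using eqp False by (simp add: pucci_nonpos mult.commute mult.left_commute)
    show ?thesis
    proof (cases "0 \<le> x")
      case True
      have "lam * p * a + y * p \<le> - (q * d)" using a qd by linarith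
      then show ?thesis using True by (intro goal) simp
    next
      case x: False
      show ?thesis
      proof (cases "p \<le> 0")
        case True
        have "y \<le> 0" by (rule sgn(2)) (use x in linarith)
        then have "0 \<le> y * p" using True by (rule mult_nonpos_nonpos)
        then have "q * (y * p) \<le> y * p" using mult_right_mono[OF q(2)] by simp
        then have "lam * p * a + q * (y * p) \<le> - (q * d)" using a qd by linarith
        then show ?thesis using x by (intro goal) (simp add: mult.assoc)
      next
        case False
        (* u' u'' is nonpositive, so lam u' u'' = q (Lam u' u'') is at most q (lam u' u''),
           and lam u'' is given by the equation *)
        have "p * a \<le> 0" by (rule mult_nonneg_nonpos) (use False \<open>\<not> 0 \<le> a\<close> in linarith)+
        then have "Lam * (p * a) \<le> lam * (p * a)" using lam by (intro mult_right_mono_neg) auto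
        then have "q * (Lam * (p * a) + y * p) \<le> q * (lam * (p * a) + y * p)"
          using q by (intro mult_left_mono) auto
        also have "lam * (p * a) + y * p = - d" using a by (simp add: mult.assoc)
        finally have "(q * Lam) * (p * a) + q * (y * p) \<le> - (q * d)" by (simp add: distrib_left mult.assoc)
        then show ?thesis unfolding q(3) using x by (intro goal) (simp add: mult.assoc)
      qed
    qed
  qed
qed

section \<open>Trapping inside the potential well\<close>

text \<open>As \<open>lam \<le> Lam\<close>, rescaling lowers the potential on the negative side, so it is that side which
  decides how far a solution can move.\<close>

locale subcritical =
  fixes lam Lam :: real and N :: nat and g :: "real \<Rightarrow> real" and \<alpha> :: ereal
  assumes lam: "0 < lam" "lam \<le> Lam" and N: "2 \<le> N"
    and cont_g: "continuous_on UNIV g" and odd: "\<forall>t. g (- t) = - g t"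
    and \<alpha>: "0 < \<alpha>" and g_pos: "\<And>t. 0 < t \<Longrightarrow> ereal t < \<alpha> \<Longrightarrow> 0 < g t"
begin

abbreviation "G \<equiv> primitive g"
abbreviation "H \<equiv> weighted_primitive lam Lam g"

lemma Lam: "0 < Lam" using lam by simp

lemma g_0: "g 0 = 0" using odd[rule_format, of 0] by simp

lemma g_sign:
  assumes "ereal \<bar>x\<bar> < \<alpha>"
  shows "0 \<le> x \<Longrightarrow> 0 \<le> g x" "x < 0 \<Longrightarrow> g x \<le> 0"
proof -
  assume "0 \<le> x"
  then show "0 \<le> g x" using g_pos[of x] g_0 assms by (cases "x = 0") auto
next
  assume "x < 0"
  then show "g x \<le> 0" using g_pos[of "- x"] odd[rule_format, of x] assms by simp
qed

lemma mult_g_nonneg: "ereal \<bar>x\<bar> < \<alpha> \<Longrightarrow> 0 \<le> x * g x"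
  using g_sign[of x] by (cases "0 \<le> x") (auto intro: mult_nonpos_nonpos)

lemma primitive_less: "0 \<le> a \<Longrightarrow> a < b \<Longrightarrow> ereal b < \<alpha> \<Longrightarrow> G a < G b"
proof (rule DERIV_pos_imp_increasing_open[of a b])
  fix x assume "0 \<le> a" "a < x" "x < b" "ereal b < \<alpha>"
  then have "0 < g x" by (intro g_pos) (auto intro: less_trans[of "ereal x" "ereal b"])
  then show "\<exists>y. (G has_real_derivative y) (at x) \<and> 0 < y"
    using primitive_deriv[OF cont_g] by blast
next
  show "continuous_on {a..b} G"
    by (rule DERIV_continuous_on[OF has_field_derivative_at_within[OF primitive_deriv[OF cont_g]]])
qed

lemma primitive_mono: "0 \<le> a \<Longrightarrow> a \<le> b \<Longrightarrow> ereal b < \<alpha> \<Longrightarrow> G a \<le> G b"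
  using primitive_less[of a b] by (cases "a = b") auto

lemma primitive_abs: "G \<bar>x\<bar> = G x"
  using primitive_even[OF cont_g odd, of x] by (cases "0 \<le> x") simp_all

lemma primitive_nonneg: "ereal \<bar>x\<bar> < \<alpha> \<Longrightarrow> 0 \<le> G x"
  using primitive_mono[of 0 "\<bar>x\<bar>"] by (simp add: primitive_abs)

lemma weighted_primitive_bounds:
  assumes "ereal \<bar>x\<bar> < \<alpha>"
  shows "lam / Lam * G \<bar>x\<bar> \<le> H x" "H x \<le> G \<bar>x\<bar>"
proof -
  have "lam / Lam * G x \<le> 1 * G x"
    using lam Lam primitive_nonneg[OF assms] by (intro mult_right_mono) auto
  then show "lam / Lam * G \<bar>x\<bar> \<le> H x" "H x \<le> G \<bar>x\<bar>"
    by (auto simp: weighted_primitive_def primitive_abs)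
qed

lemma weighted_primitive_nonneg: "ereal \<bar>x\<bar> < \<alpha> \<Longrightarrow> 0 \<le> H x"
  using weighted_primitive_bounds(1)[of x] primitive_nonneg[of "\<bar>x\<bar>"] lam Lam
  by (auto intro: order_trans[rotated])

lemma continuous_on_weighted_primitive: "continuous_on S H"
  by (rule DERIV_continuous_on[OF has_field_derivative_at_within[OF weighted_primitive_deriv[OF cont_g g_0]]])

text \<open>\<open>G\<close> increases to its limit at \<open>\<alpha>\<close>, finite or not, so a value below the limit is exceeded by
  \<open>G \<beta>\<close> for some \<open>\<beta> < \<alpha>\<close>, and \<open>\<beta>\<close> may be taken as close to \<open>\<alpha>\<close> as desired.\<close>

lemma primitive_ext_approx:
  assumes c: "ereal c < primitive_ext g \<alpha>" and b: "0 \<le> b" "ereal b < \<alpha>"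
  obtains \<beta> where "b \<le> \<beta>" "ereal \<beta> < \<alpha>" "c < G \<beta>"
proof (cases \<alpha>)
  case (real a)
  then have "c < G a" "b < a" using c b by (auto simp: primitive_ext_def)
  have "isCont G a" using primitive_deriv[OF cont_g] by (rule DERIV_isCont)
  then have "(G \<longlongrightarrow> G a) (at_left a)"
    by (auto simp: isCont_def intro: tendsto_within_subset)
  then have "eventually (\<lambda>t. c < G t) (at_left a)"
    using \<open>c < G a\<close> by (rule order_tendstoD(1))
  moreover have "eventually (\<lambda>t. b < t \<and> t < a) (at_left a)"
    by (rule eventually_at_leftI[of b a]) (use \<open>b < a\<close> in auto)
  ultimately have "eventually (\<lambda>t. c < G t \<and> b < t \<and> t < a) (at_left a)"
    by eventually_elim simp
  then obtain t where "c < G t \<and> b < t \<and> t < a"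
    using eventually_happens'[OF trivial_limit_at_left_real[of a]] by blast
  then show ?thesis using that[of t] real by auto
next
  case PInf
  define L where "L = (SUP t\<in>{0..}. ereal (G t))"
  have mono: "G s \<le> G t" if "0 \<le> s" "s \<le> t" for s t
    using primitive_mono[OF that] PInf by simp
  have "((\<lambda>t. ereal (G t)) \<longlongrightarrow> L) at_top"
  proof (rule increasing_tendsto)
    show "eventually (\<lambda>t. ereal (G t) \<le> L) at_top"
      using eventually_ge_at_top[of 0] by eventually_elim (auto simp: L_def intro: SUP_upper)
    fix x assume "x < L"
    then obtain s where s: "0 \<le> s" "x < ereal (G s)" by (auto simp: L_def less_SUP_iff)
    show "eventually (\<lambda>t. x < ereal (G t)) at_top"
    proof (rule eventually_mono[OF eventually_ge_at_top[of s]])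
      fix t assume "s \<le> t"
      then have "ereal (G s) \<le> ereal (G t)" using mono[OF s(1)] by simp
      with s(2) show "x < ereal (G t)" by (rule less_le_trans)
    qed
  qed
  then have "primitive_ext g \<alpha> = L"
    using PInf by (simp add: primitive_ext_def tendsto_Lim)
  then have "ereal c < L" using c by simp
  then obtain s where s: "0 \<le> s" "c < G s" by (auto simp: L_def less_SUP_iff)
  define t where "t = max s b"
  have t: "s \<le> t" "b \<le> t" by (auto simp: t_def)
  then have "c < G t" using mono[OF s(1) t(1)] s(2) by simp
  then show ?thesis using that[of t] t PInf by simp
qed (use \<alpha> in simp)

end

locale subcritical_solution = subcritical +
  fixes R :: ereal and u u1 u2 :: "real \<Rightarrow> real"
  assumes R: "0 < R" and sol: "c2_solution lam Lam N g R u u1 u2"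
begin

abbreviation "V \<equiv> energy lam Lam g u u1"

lemmas zero_mem = zero_in_ivl[OF R]

lemma energy_deriv:
  assumes "r \<in> ivl R" "0 < r" "ereal \<bar>u r\<bar> < \<alpha>"
  obtains D where "(V has_real_derivative D) (at r)" "D \<le> - (lam\<^sup>2 / Lam * ((real N - 1) / r) * (u1 r)\<^sup>2)"
proof
  let ?h = "if 0 \<le> u r then g (u r) else lam / Lam * g (u r)"
  note d = c2_solution_deriv_interior[OF sol assms(1,2)]
  have "((\<lambda>s. H (u s)) has_real_derivative ?h * u1 r) (at r)"
    by (rule DERIV_chain2[where f = H, OF weighted_primitive_deriv[OF cont_g g_0] d(1)])
  then show "(V has_real_derivative lam * u1 r * u2 r + ?h * u1 r) (at r)"
    unfolding energy_def[abs_def] using d(2) by (auto intro!: derivative_eq_intros)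
  show "lam * u1 r * u2 r + ?h * u1 r \<le> - (lam\<^sup>2 / Lam * ((real N - 1) / r) * (u1 r)\<^sup>2)"
    using N assms(2) by (intro energy_dissipation lam c2_solution_equation[OF sol assms(1,2)] g_sign[OF assms(3)]) auto
qed

lemma continuous_on_energy: "continuous_on (ivl R) V"
  unfolding energy_def[abs_def]
  by (intro continuous_intros c2_solution_continuous[OF sol]
      continuous_on_compose2[OF continuous_on_weighted_primitive[of UNIV] c2_solution_continuous(1)[OF sol]]) auto

lemma energy_antimono:
  assumes ab: "0 \<le> a" "a \<le> b" "b \<in> ivl R" and small: "\<And>s. a < s \<Longrightarrow> s < b \<Longrightarrow> ereal \<bar>u s\<bar> < \<alpha>"
  shows "V b \<le> V a"
proof (rule DERIV_nonpos_imp_decreasing_open[OF ab(2)])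
  have sub: "{a..b} \<subseteq> ivl R" using ivl_initial_segment[OF ab(3)] ab(1) by auto
  then show "continuous_on {a..b} V" by (rule continuous_on_subset[OF continuous_on_energy])
  fix s assume s: "a < s" "s < b"
  have "s \<in> {a..b}" using s by simp
  then have s': "s \<in> ivl R" "0 < s" using sub s ab(1) by auto
  obtain D where D: "(V has_real_derivative D) (at s)" "D \<le> - (lam\<^sup>2 / Lam * ((real N - 1) / s) * (u1 s)\<^sup>2)"
    using energy_deriv[OF s' small[OF s]] .
  have "0 \<le> lam\<^sup>2 / Lam * ((real N - 1) / s) * (u1 s)\<^sup>2" using lam Lam N s'(2) by simp
  then show "\<exists>y. (V has_real_derivative y) (at s) \<and> y \<le> 0" using D by force
qed

lemma weighted_primitive_le_energy: "H (u r) \<le> V r"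
  using lam by (simp add: energy_def)

text \<open>Until \<open>|u|\<close> first reaches \<open>\<beta>\<close> the energy decreases, but to be at \<open>\<plusminus>\<beta>\<close> requires at least the
  energy \<open>(lam / Lam) G \<beta>\<close>.\<close>

lemma trapping:
  assumes a: "0 \<le> a" "a \<in> ivl R" and \<beta>: "0 < \<beta>" "ereal \<beta> < \<alpha>"
    and init: "\<And>s. 0 \<le> s \<Longrightarrow> s \<le> a \<Longrightarrow> \<bar>u s\<bar> \<le> \<beta>" and barrier: "V a < lam / Lam * G \<beta>"
    and r: "r \<in> ivl R"
  shows "\<bar>u r\<bar> \<le> \<beta>"
proof (rule ccontr)
  assume "\<not> \<bar>u r\<bar> \<le> \<beta>"
  then have ur: "\<beta> < \<bar>u r\<bar>" by simp
  have r0: "0 \<le> r" using r by (simp add: mem_ivl)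
  have ar: "a \<le> r" using init[OF r0] ur by (cases "r \<le> a") auto
  have sub: "{a..r} \<subseteq> ivl R" using ivl_initial_segment[OF r] a(1) by auto
  have cont: "continuous_on {a..r} (\<lambda>s. \<bar>u s\<bar>)"
    by (intro continuous_intros continuous_on_subset[OF c2_solution_continuous(1)[OF sol] sub])
  have ua: "\<bar>u a\<bar> \<le> \<beta>" using init a by simp
  (* the infimum of S is the first time at which the level is reached *)
  define S where "S = {s \<in> {a..r}. \<bar>u s\<bar> = \<beta>}"
  have "\<exists>s\<ge>a. s \<le> r \<and> \<bar>u s\<bar> = \<beta>"
    using IVT'[of "\<lambda>s. \<bar>u s\<bar>" a \<beta> r] ua ur ar cont by auto
  then have "S \<noteq> {}" by (auto simp: S_def)
  moreover have "closed S"
    unfolding S_def using cont by (intro continuous_closed_preimage_constant) auto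
  moreover have bdd: "bdd_below S" by (rule bdd_belowI[of _ a]) (simp add: S_def)
  ultimately have "Inf S \<in> S" using closed_contains_Inf by blast
  define s where "s = Inf S"
  have s: "a \<le> s" "s \<le> r" "\<bar>u s\<bar> = \<beta>" using \<open>Inf S \<in> S\<close> by (auto simp: S_def s_def)
  have less: "\<bar>u t\<bar> < \<beta>" if t: "a < t" "t < s" for t
  proof (rule ccontr)
    assume "\<not> \<bar>u t\<bar> < \<beta>"
    then have "\<exists>x\<ge>a. x \<le> t \<and> \<bar>u x\<bar> = \<beta>"
      using IVT'[of "\<lambda>s. \<bar>u s\<bar>" a \<beta> t] ua t s continuous_on_subset[OF cont, of "{a..t}"] by auto
    then obtain x where "x \<in> S" "x \<le> t" using t s by (auto simp: S_def)
    then show False using cInf_lower[OF _ bdd, of x] t by (simp add: s_def)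
  qed
  have sR: "s \<in> ivl R" using s sub by auto
  have "V s \<le> V a"
  proof (rule energy_antimono[OF a(1) s(1) sR])
    fix t assume "a < t" "t < s"
    then have "\<bar>u t\<bar> < \<beta>" by (rule less)
    then show "ereal \<bar>u t\<bar> < \<alpha>" using \<beta>(2) by (meson ereal_less_eq(3) le_less_trans less_imp_le)
  qed
  moreover have "lam / Lam * G \<beta> \<le> H (u s)"
    using weighted_primitive_bounds(1)[of "u s"] s(3) \<beta>(2) by simp
  ultimately show False using barrier weighted_primitive_le_energy[of s] by linarith
qed

lemma energy_0: "V 0 = H (u 0)"
  using c2_solution_u1_0[OF sol] by (simp add: energy_def)

text \<open>Starting on the rescaled side, the initial energy is \<open>(lam / Lam) G |\<xi>|\<close>, below the barrier of
  every level \<open>\<beta> > |\<xi>|\<close>.\<close>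

lemma negative_start_bound:
  assumes \<xi>: "u 0 < 0" "- \<alpha> < ereal (u 0)" and r: "r \<in> ivl R"
  shows "\<bar>u r\<bar> \<le> - u 0"
proof (rule ccontr)
  assume "\<not> \<bar>u r\<bar> \<le> - u 0"
  have "ereal (- u 0) < \<alpha>" using \<xi>(2) by (cases \<alpha>) auto
  then have "ereal (- u 0) < min \<alpha> (ereal \<bar>u r\<bar>)" using \<open>\<not> \<bar>u r\<bar> \<le> - u 0\<close> by simp
  then obtain \<beta> where \<beta>: "ereal (- u 0) < ereal \<beta>" "ereal \<beta> < min \<alpha> (ereal \<bar>u r\<bar>)"
    using ereal_dense2 by blast
  have "V 0 = lam / Lam * G (- u 0)"
    using \<xi>(1) primitive_even[OF cont_g odd, of "u 0"] by (simp add: energy_0 weighted_primitive_def)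
  also have "\<dots> < lam / Lam * G \<beta>"
    using lam Lam \<xi>(1) \<beta> by (intro mult_strict_left_mono primitive_less) auto
  finally have "\<bar>u r\<bar> \<le> \<beta>"
    using \<xi>(1) \<beta> by (intro trapping[OF order_refl zero_mem _ _ _ _ r]) auto
  then show False using \<beta>(2) by simp
qed

text \<open>Since \<open>u''(0) < 0\<close>, the derivative \<open>u'\<close> is nonzero right after the start and energy is lost. This
  makes the comparison in \<open>positive_start_bound\<close> strict even if its hypothesis holds with equality.\<close>

lemma positive_start_initial_loss:
  assumes \<xi>: "0 < u 0" "ereal (u 0) < \<alpha>"
  shows "\<exists>\<delta> b. 0 \<le> \<delta> \<and> \<delta> \<in> ivl R \<and> u 0 < b \<and> ereal b < \<alpha> \<and>
    (\<forall>s\<in>{0..\<delta>}. \<bar>u s\<bar> \<le> b) \<and> V \<delta> < V 0"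
proof -
  let ?z = "radial_quotient u1 u2"
  have N1: "1 \<le> N" using N by simp
  obtain b where b: "u 0 < b" "ereal b < \<alpha>" using \<xi>(2) ereal_dense2 by force
  have "0 < g (u 0)" using g_pos \<xi> by blast
  then have "pucci lam Lam (?z 0) + (real N - 1) * pucci lam Lam (?z 0) < 0"
    using radial_quotient_equation[OF lam(1) Lam N1 cont_g R sol zero_mem] by (simp add: radial_quotient_def)
  then have "real N * pucci lam Lam (?z 0) < 0" by (simp add: algebra_simps)
  then have z0: "?z 0 < 0" using N lam(1) Lam by (simp add: mult_less_0_iff)
  have "(?z \<longlongrightarrow> ?z 0) (at 0 within ivl R)" "((\<lambda>s. \<bar>u s\<bar>) \<longlongrightarrow> \<bar>u 0\<bar>) (at 0 within ivl R)"
    using continuous_on_radial_quotient[OF lam(1) Lam N1 cont_g R sol] c2_solution_continuous(1)[OF sol] zero_mem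
    by (auto simp: continuous_on_def intro: tendsto_rabs)
  then have "eventually (\<lambda>s. ?z s < 0 \<and> \<bar>u s\<bar> < b) (at 0 within ivl R)"
    using z0 b(1) \<xi>(1) by (intro eventually_conj order_tendstoD(2)) auto
  then obtain d where d: "0 < d" "\<And>s. s \<in> ivl R \<Longrightarrow> s \<noteq> 0 \<Longrightarrow> \<bar>s\<bar> < d \<Longrightarrow> ?z s < 0 \<and> \<bar>u s\<bar> < b"
    by (auto simp: eventually_at)
  obtain e where e: "0 < e" "{0..<0 + e} \<subseteq> ivl R" using ivl_right_neighbourhood[OF zero_mem] .
  define \<delta> where "\<delta> = min d e / 2"
  have \<delta>: "0 < \<delta>" "\<delta> < d" "\<delta> < e" using d(1) e(1) by (auto simp: \<delta>_def)
  have near: "s \<in> ivl R \<and> ?z s < 0 \<and> \<bar>u s\<bar> < b" if "0 < s" "s \<le> \<delta>" for s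
  proof -
    have "s \<in> ivl R" using e(2) that \<delta> by auto
    then show ?thesis using d(2)[of s] that \<delta> by auto
  qed
  have \<delta>R: "\<delta> \<in> ivl R" using near[of \<delta>] \<delta> by simp
  have "V \<delta> < V 0"
  proof (rule DERIV_neg_imp_decreasing_open[OF \<delta>(1)])
    show "continuous_on {0..\<delta>} V"
      by (rule continuous_on_subset[OF continuous_on_energy ivl_initial_segment[OF \<delta>R]])
    fix s assume s: "0 < s" "s < \<delta>"
    have n: "s \<in> ivl R" "?z s < 0" "\<bar>u s\<bar> < b" using near[of s] s by auto
    have "ereal \<bar>u s\<bar> < \<alpha>" using n(3) b(2) by (meson ereal_less_eq(3) le_less_trans less_imp_le)
    then obtain D where D: "(V has_real_derivative D) (at s)" "D \<le> - (lam\<^sup>2 / Lam * ((real N - 1) / s) * (u1 s)\<^sup>2)"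
      using energy_deriv[OF n(1) s(1)] by blast
    have "u1 s \<noteq> 0" using n(2) s(1) by (auto simp: radial_quotient_def)
    then have "0 < lam\<^sup>2 / Lam * ((real N - 1) / s) * (u1 s)\<^sup>2" using lam Lam N s(1) by simp
    then show "\<exists>y. (V has_real_derivative y) (at s) \<and> y < 0" using D by force
  qed
  moreover have "\<bar>u s\<bar> \<le> b" if "0 \<le> s" "s \<le> \<delta>" for s
    using near[of s] that b \<xi>(1) by (cases "s = 0") auto
  ultimately show ?thesis using \<delta>(1) \<delta>R b by (intro exI[of _ \<delta>] exI[of _ b]) simp
qed

lemma positive_start_bound:
  assumes \<xi>: "0 < u 0" "ereal (u 0) < \<alpha>"
    and cond: "ereal Lam * ereal (G (u 0)) \<le> ereal lam * primitive_ext g \<alpha>"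
  obtains \<beta> where "ereal \<beta> < \<alpha>" "\<And>r. r \<in> ivl R \<Longrightarrow> \<bar>u r\<bar> \<le> \<beta>"
proof -
  obtain \<delta> b where \<delta>: "0 \<le> \<delta>" "\<delta> \<in> ivl R" "u 0 < b" "ereal b < \<alpha>"
      "\<forall>s\<in>{0..\<delta>}. \<bar>u s\<bar> \<le> b" "V \<delta> < V 0"
    using positive_start_initial_loss[OF \<xi>] by blast
  have "V \<delta> < G (u 0)" using \<delta>(6) \<xi>(1) by (simp add: energy_0 weighted_primitive_def)
  have "ereal (Lam / lam * V \<delta>) < primitive_ext g \<alpha>"
  proof (cases "primitive_ext g \<alpha>")
    case (real c)
    then have "Lam * G (u 0) \<le> lam * c" using cond by simp
    moreover have "Lam * V \<delta> < Lam * G (u 0)" using \<open>V \<delta> < G (u 0)\<close> Lam by simp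
    ultimately show ?thesis using real lam(1) by (simp add: field_simps)
  qed (use cond lam(1) in auto)
  then obtain \<beta> where \<beta>: "b \<le> \<beta>" "ereal \<beta> < \<alpha>" "Lam / lam * V \<delta> < G \<beta>"
    using primitive_ext_approx[of _ b] \<delta>(3,4) \<xi>(1) by auto
  have "V \<delta> < lam / Lam * G \<beta>" using \<beta>(3) lam(1) Lam by (simp add: field_simps)
  then have "\<bar>u r\<bar> \<le> \<beta>" if "r \<in> ivl R" for r
    using trapping[OF \<delta>(1,2) _ \<beta>(2) _ _ that] \<delta>(3,5) \<beta>(1) \<xi>(1) by force
  then show ?thesis using that \<beta>(2) by blast
qed

end

section \<open>Decay at infinity\<close>

context subcritical_solution
begin

lemma global_energy:
  assumes inf: "R = \<infinity>" and \<beta>: "ereal \<beta> < \<alpha>" and bound: "\<forall>r\<ge>0. \<bar>u r\<bar> \<le> \<beta>"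
  shows "0 \<le> r \<Longrightarrow> ereal \<bar>u r\<bar> < \<alpha>" "0 \<le> r \<Longrightarrow> 0 \<le> H (u r)" "0 \<le> r \<Longrightarrow> 0 \<le> V r"
    "0 \<le> a \<Longrightarrow> a \<le> b \<Longrightarrow> V b \<le> V a"
proof -
  show small: "ereal \<bar>u r\<bar> < \<alpha>" if "0 \<le> r" for r
    using bound[rule_format, OF that] \<beta> by (meson ereal_less_eq(3) le_less_trans)
  show H: "0 \<le> H (u r)" if "0 \<le> r" for r
    using weighted_primitive_nonneg small[OF that] by blast
  show "0 \<le> V r" if "0 \<le> r" for r
    using H[OF that] weighted_primitive_le_energy[of r] by linarith
  show "V b \<le> V a" if "0 \<le> a" "a \<le> b" for a b
    using that inf by (intro energy_antimono small) auto
qed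

text \<open>Multiplying the equation by \<open>u\<close>; the sign of \<open>u\<close> only exchanges the two ellipticity
  constants.\<close>

lemma product_second_derivative_bound:
  assumes r: "r \<in> ivl R" "0 < r" and small: "ereal \<bar>u r\<bar> < \<alpha>"
    and \<beta>: "\<bar>u r\<bar> \<le> \<beta>" and p: "\<bar>u1 r\<bar> \<le> p"
  shows "u r * u2 r \<le> (real N - 1) / r * (\<beta> * (Lam * p)) / lam - u r * g (u r) / Lam"
proof -
  define P where "P = (real N - 1) / r * (\<beta> * (Lam * p))"
  define Q where "Q = u r * g (u r)"
  have \<beta>0: "0 \<le> \<beta>" "0 \<le> p" using \<beta> p by linarith+
  have k: "0 \<le> (real N - 1) / r" using N r by simp
  have P0: "0 \<le> P" unfolding P_def using k \<beta>0 Lam by (intro mult_nonneg_nonneg) auto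
  have Q0: "0 \<le> Q"
    unfolding Q_def by (rule mult_g_nonneg[OF small])
  have "\<bar>pucci lam Lam (u1 r)\<bar> \<le> Lam * \<bar>u1 r\<bar>"
    using pucci_abs_le[OF lam(1) Lam, of "u1 r"] lam by (simp add: max_def)
  also have "\<dots> \<le> Lam * p" using p Lam by simp
  finally have "\<bar>u r * pucci lam Lam (u1 r)\<bar> \<le> \<beta> * (Lam * p)"
    unfolding abs_mult using \<beta> \<beta>0 by (intro mult_mono) auto
  then have "- (u r * pucci lam Lam (u1 r)) \<le> \<beta> * (Lam * p)" by linarith
  then have "(real N - 1) / r * - (u r * pucci lam Lam (u1 r)) \<le> P"
    unfolding P_def using k by (rule mult_left_mono)
  moreover have "u r * pucci lam Lam (u2 r) = (real N - 1) / r * - (u r * pucci lam Lam (u1 r)) - Q"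
  proof -
    have "pucci lam Lam (u2 r) = - ((real N - 1) / r * pucci lam Lam (u1 r)) - g (u r)"
      using c2_solution_equation[OF sol r] by simp
    then show ?thesis unfolding Q_def by (simp only: right_diff_distrib mult_minus_right mult.left_commute)
  qed
  ultimately have le: "u r * pucci lam Lam (u2 r) \<le> P - Q" by linarith
  have "u r * u2 r \<le> P / lam - Q / Lam"
  proof (cases "0 \<le> u r")
    case True
    then show ?thesis
      using pucci_le_imp[OF lam(1) Lam P0 Q0, of "u r * u2 r"] le lam
      by (simp add: pucci_scale min_def max_def)
  next
    case False
    then have "pucci Lam lam (u r * u2 r) = u r * pucci lam Lam (u2 r)"
      using pucci_scale[of "- u r" lam Lam "u2 r"] pucci_minus[of Lam lam "- u r * u2 r"] by simp
    then show ?thesis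
      using pucci_le_imp[OF Lam lam(1) P0 Q0, of "u r * u2 r"] le lam
      by (simp add: min_absorb2 max_absorb1)
  qed
  then show ?thesis by (simp add: P_def Q_def)
qed

text \<open>\<open>x g(x)\<close> is positive off 0 and the set in question is compact and avoids 0.\<close>

lemma restoring_force_lower_bound:
  assumes \<beta>: "ereal \<beta> < \<alpha>" and \<epsilon>: "0 < \<epsilon>"
  shows "\<exists>c>0. \<forall>x. \<bar>x\<bar> \<le> \<beta> \<and> \<epsilon> \<le> H x \<longrightarrow> c \<le> x * g x"
proof -
  define S where "S = {-\<beta>..\<beta>} \<inter> {x. \<epsilon> \<le> H x}"
  have "closed {x. \<epsilon> \<le> H x}"
    by (intro closed_Collect_le continuous_intros continuous_on_weighted_primitive)
  then have S: "compact S" unfolding S_def by (intro compact_Int_closed) auto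
  show ?thesis
  proof (cases "S = {}")
    case True
    moreover have "x \<in> S" if "\<bar>x\<bar> \<le> \<beta> \<and> \<epsilon> \<le> H x" for x
      using that by (simp add: S_def abs_le_iff minus_le_iff)
    ultimately have "\<not> (\<bar>x\<bar> \<le> \<beta> \<and> \<epsilon> \<le> H x)" for x by blast
    then show ?thesis by (intro exI[of _ 1]) auto
  next
    case False
    have "continuous_on S (\<lambda>x. x * g x)"
      by (intro continuous_intros continuous_on_subset[OF cont_g]) auto
    then obtain y where y: "y \<in> S" "\<And>x. x \<in> S \<Longrightarrow> y * g y \<le> x * g x"
      using continuous_attains_inf[OF S False] by blast
    have "ereal \<bar>y\<bar> \<le> ereal \<beta>" using y(1) by (simp add: S_def abs_le_iff minus_le_iff)
    then have ya: "ereal \<bar>y\<bar> < \<alpha>" using \<beta> by (rule le_less_trans)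
    have "y \<noteq> 0" using y(1) \<epsilon> by (auto simp: S_def weighted_primitive_def)
    then have "0 < y * g y"
    proof (cases y "0::real" rule: linorder_cases)
      case less
      then have "0 < g (- y)" using ya by (intro g_pos) auto
      then show ?thesis using less odd[rule_format, of y] by (simp add: zero_less_mult_iff)
    next
      case greater
      then show ?thesis using g_pos[of y] ya by simp
    qed simp
    then show ?thesis using y(2) by (intro exI[of _ "y * g y"]) (auto simp: S_def abs_le_iff minus_le_iff)
  qed
qed

text \<open>The dissipation only controls \<open>u'\<^sup>2/r\<close>. If \<open>V \<ge> \<epsilon>\<close> throughout, then wherever \<open>u'\<^sup>2\<close> is small the
  restoring force makes \<open>u u''\<close> negative, so \<open>u u'' \<le> A/r - c\<^sub>2 + K\<^sub>0 u'\<^sup>2\<close> always. Adding a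
  multiple \<open>K\<close> of \<open>V\<close> to \<open>u u'/r\<close> absorbs the terms in \<open>u'\<^sup>2\<close> and leaves a derivative of at most
  \<open>- c\<^sub>2/(2 r)\<close> for large \<open>r\<close>. The sum would therefore tend to \<open>- \<infinity>\<close> logarithmically, although it is
  bounded below.\<close>

lemma energy_tends_to_zero:
  assumes inf: "R = \<infinity>" and \<beta>: "ereal \<beta> < \<alpha>" and bound: "\<forall>r\<ge>0. \<bar>u r\<bar> \<le> \<beta>"
  shows "(V \<longlongrightarrow> 0) at_top"
proof -
  note E = global_energy[OF assms]
  have \<beta>0: "0 \<le> \<beta>" using bound[rule_format, of 0] by simp
  have "\<exists>r\<ge>0. V r < \<epsilon>" if \<epsilon>: "0 < \<epsilon>" for \<epsilon>
  proof (rule ccontr)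
    assume "\<not> (\<exists>r\<ge>0. V r < \<epsilon>)"
    then have V: "\<epsilon> \<le> V r" if "0 \<le> r" for r using that by force
    have "0 < \<epsilon> / 2" using \<epsilon> by simp
    from restoring_force_lower_bound[rule_format, OF \<beta> this] obtain c1
      where c1: "0 < c1" "\<And>x. \<bar>x\<bar> \<le> \<beta> \<Longrightarrow> \<epsilon> / 2 \<le> H x \<Longrightarrow> c1 \<le> x * g x" by blast
    define p where "p = sqrt (2 * V 0 / lam)"
    have p: "\<bar>u1 r\<bar> \<le> p" if r: "0 \<le> r" for r
    proof -
      have "lam * (u1 r)\<^sup>2 / 2 \<le> V 0"
        using E(2)[OF r] E(4)[OF order_refl r] by (simp add: energy_def)
      then have "(u1 r)\<^sup>2 \<le> 2 * V 0 / lam" using lam by (simp add: field_simps)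
      then have "sqrt ((u1 r)\<^sup>2) \<le> p" unfolding p_def by (rule real_sqrt_le_mono)
      then show ?thesis by simp
    qed
    have p0: "0 \<le> p" using p[of 0] by simp
    define A where "A = (real N - 1) * (\<beta> * (Lam * p)) / lam"
    define c2 where "c2 = c1 / Lam"
    have c2: "0 < c2" using c1 Lam by (simp add: c2_def)
    define K0 where "K0 = c2 * lam / \<epsilon>"
    have K0: "0 \<le> K0" using c2 lam \<epsilon> by (simp add: K0_def)
    have uu2: "u r * u2 r \<le> A / r - c2 + K0 * (u1 r)\<^sup>2" if r: "0 < r" for r
    proof -
      have r0: "0 \<le> r" and rR: "r \<in> ivl R" using r inf by auto
      have *: "u r * u2 r \<le> A / r - u r * g (u r) / Lam"
        using product_second_derivative_bound[rule_format, OF rR r E(1)[OF r0] bound[rule_format, OF r0] p[OF r0]]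
        by (simp add: A_def mult.commute)
      show ?thesis
      proof (cases "\<epsilon> / 2 \<le> H (u r)")
        case True
        have "c2 \<le> u r * g (u r) / Lam"
          unfolding c2_def using c1(2)[OF bound[rule_format, OF r0] True] Lam by (intro divide_right_mono) auto
        moreover have "0 \<le> K0 * (u1 r)\<^sup>2" using K0 by simp
        ultimately show ?thesis using * by linarith
      next
        case False
        then have "\<epsilon> \<le> lam * (u1 r)\<^sup>2" using V[OF r0] by (simp add: energy_def)
        then have "c2 / \<epsilon> * \<epsilon> \<le> c2 / \<epsilon> * (lam * (u1 r)\<^sup>2)" using c2 \<epsilon> by (intro mult_left_mono) auto
        then have "c2 \<le> K0 * (u1 r)\<^sup>2" using \<epsilon> by (simp add: K0_def)
        moreover have "0 \<le> u r * g (u r) / Lam"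
          using mult_g_nonneg[OF E(1)[OF r0]] Lam by simp
        ultimately show ?thesis using * by linarith
      qed
    qed
    define \<eta> where "\<eta> = lam\<^sup>2 / Lam * (real N - 1)"
    have \<eta>: "0 < \<eta>" using lam Lam N by (simp add: \<eta>_def)
    (* with this K the dissipation of K V cancels all the terms in (u')^2 *)
    define K where "K = (1 + K0) / \<eta>"
    have K: "0 \<le> K" "K * \<eta> = 1 + K0" using K0 \<eta> by (auto simp: K_def)
    (* the logarithm uses up half of the decay rate c2 / r *)
    define F where "F r = u r * u1 r / r + K * V r + c2 / 2 * ln r" for r
    define T where "T = max 1 (2 * (A + \<beta> * p) / c2)"
    have T: "1 \<le> T" "2 * (A + \<beta> * p) / c2 \<le> T" by (auto simp: T_def)
    have F_le: "F r \<le> F T" if "T \<le> r" for r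
    proof (rule DERIV_nonpos_imp_nonincreasing[OF that])
      fix s assume s: "T \<le> s" "s \<le> r"
      then have s0: "0 < s" "0 \<le> s" "s \<in> ivl R" using T(1) inf by auto
      obtain D where D: "(V has_real_derivative D) (at s)" "D \<le> - (lam\<^sup>2 / Lam * ((real N - 1) / s) * (u1 s)\<^sup>2)"
        using energy_deriv[OF s0(3,1) E(1)[OF s0(2)]] .
      let ?D = "((u1 s)\<^sup>2 + u s * u2 s - u s * u1 s / s) / s + K * D + c2 / 2 / s"
      have "(F has_real_derivative ?D) (at s)"
        unfolding F_def[abs_def] using s0(1) D(1) c2_solution_deriv_interior[OF sol s0(3,1)]
        by (auto intro!: derivative_eq_intros simp: power2_eq_square field_simps)
      moreover have "?D \<le> 0"
      proof -
        have "D * s \<le> - (lam\<^sup>2 / Lam * ((real N - 1) / s) * (u1 s)\<^sup>2) * s"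
          using D(2) s0 by (intro mult_right_mono) auto
        also have "\<dots> = - (\<eta> * (u1 s)\<^sup>2)" using s0 by (simp add: \<eta>_def)
        finally have "K * (D * s) \<le> K * - (\<eta> * (u1 s)\<^sup>2)" using K(1) by (rule mult_left_mono)
        also have "\<dots> = - ((1 + K0) * (u1 s)\<^sup>2)" unfolding K(2)[symmetric] by simp
        finally have 1: "K * (D * s) \<le> - (u1 s)\<^sup>2 - K0 * (u1 s)\<^sup>2" by (simp add: algebra_simps)
        have "\<bar>u s * u1 s\<bar> \<le> \<beta> * p"
          unfolding abs_mult using bound[rule_format, OF s0(2)] p[OF s0(2)] \<beta>0 by (intro mult_mono) auto
        then have "- (u s * u1 s) / s \<le> \<beta> * p / s" using s0 by (intro divide_right_mono) auto
        then have 2: "- (u s * u1 s / s) \<le> \<beta> * p / s" by simp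
        have "2 * (A + \<beta> * p) / c2 \<le> s" using T(2) s(1) by linarith
        then have 3: "A / s + \<beta> * p / s \<le> c2 / 2" using s0 c2 by (simp add: field_simps)
        have "?D * s = (u1 s)\<^sup>2 + u s * u2 s - u s * u1 s / s + K * (D * s) + c2 / 2"
          using s0 by (simp add: field_simps)
        also have "\<dots> \<le> 0" using 1 2 3 uu2[OF s0(1)] by linarith
        finally show ?thesis using s0(1) by (simp add: mult_le_0_iff)
      qed
      ultimately show "\<exists>y. (F has_real_derivative y) (at s) \<and> y \<le> 0" by blast
    qed
    have F_ge: "c2 / 2 * ln r - \<beta> * p \<le> F r" if r: "1 \<le> r" for r
    proof -
      have r0: "0 \<le> r" using r by simp
      have "\<bar>u r * u1 r\<bar> \<le> \<beta> * p"
        unfolding abs_mult using bound[rule_format, OF r0] p[OF r0] \<beta>0 by (intro mult_mono) auto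
      also have "\<dots> \<le> \<beta> * p * r" using r \<beta>0 p0 by (simp add: mult_le_cancel_left1 mult_less_0_iff)
      finally have "- (\<beta> * p) * r \<le> u r * u1 r" by simp
      then have "- (\<beta> * p) \<le> u r * u1 r / r" using r by (simp add: pos_le_divide_eq)
      moreover have "0 \<le> K * V r" using K(1) E(3)[OF r0] by simp
      ultimately show ?thesis by (simp add: F_def)
    qed
    define x where "x = max (ln T) (2 * (F T + \<beta> * p) / c2 + 1)"
    have "exp (ln T) \<le> exp x" unfolding exp_le_cancel_iff by (simp add: x_def)
    then have Tx: "T \<le> exp x" using T(1) by simp
    then have "c2 / 2 * ln (exp x) - \<beta> * p \<le> F (exp x)" using T(1) by (intro F_ge) linarith
    also have "\<dots> \<le> F T" by (rule F_le[OF Tx])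
    finally have "c2 / 2 * x - \<beta> * p \<le> F T" unfolding ln_exp .
    moreover have "F T + \<beta> * p < c2 / 2 * x"
    proof -
      have "2 * (F T + \<beta> * p) / c2 < x" by (simp add: x_def less_max_iff_disj)
      then show ?thesis using c2 by (simp add: field_simps)
    qed
    ultimately show False by linarith
  qed
  then have small: "\<exists>r\<ge>0. V r < \<epsilon>" if "0 < \<epsilon>" for \<epsilon> using that by blast
  show ?thesis
  proof (rule order_tendstoI)
    fix a :: real assume "a < 0"
    then have "\<forall>r\<ge>0. a < V r" using E(3) by force
    then show "eventually (\<lambda>r. a < V r) at_top" by (auto simp: eventually_at_top_linorder)
  next
    fix a :: real assume "0 < a"
    then obtain r0 where "0 \<le> r0" "V r0 < a" using small by blast
    then have "\<forall>r\<ge>r0. V r < a" using E(4)[of r0] by (meson le_less_trans)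
    then show "eventually (\<lambda>r. V r < a) at_top" by (auto simp: eventually_at_top_linorder)
  qed
qed

text \<open>Both terms of the energy are nonnegative, which gives \<open>u\<close> and \<open>u'\<close>; the equation then gives \<open>u''\<close>.\<close>

proposition decay:
  assumes inf: "R = \<infinity>" and \<beta>: "ereal \<beta> < \<alpha>" and bound: "\<forall>r\<ge>0. \<bar>u r\<bar> \<le> \<beta>"
  shows "(u \<longlongrightarrow> 0) at_top" "(u1 \<longlongrightarrow> 0) at_top" "(u2 \<longlongrightarrow> 0) at_top"
proof -
  note E = global_energy[OF assms]
  note V0 = energy_tends_to_zero[OF assms]
  show u0: "(u \<longlongrightarrow> 0) at_top"
  proof (rule tendstoI)
    fix e :: real assume "0 < e"
    then have "ereal 0 < min (ereal e) \<alpha>" using \<alpha> by (simp add: zero_ereal_def)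
    then obtain d where "ereal 0 < ereal d" "ereal d < min (ereal e) \<alpha>" using ereal_dense2 by blast
    then have d: "0 < d" "d < e" "ereal d < \<alpha>" by auto
    have "0 < lam / Lam * G d" using primitive_less[of 0 d] d lam Lam by simp
    with V0 have "eventually (\<lambda>r. V r < lam / Lam * G d) at_top" by (rule order_tendstoD(2))
    with eventually_ge_at_top[of 0] show "eventually (\<lambda>r. dist (u r) 0 < e) at_top"
    proof eventually_elim
      case (elim r)
      have "lam / Lam * G \<bar>u r\<bar> < lam / Lam * G d"
        using weighted_primitive_bounds(1)[OF E(1)[OF elim(1)]] weighted_primitive_le_energy[of r] elim(2) by linarith
      then have "G \<bar>u r\<bar> < G d" using lam Lam by (simp add: divide_less_cancel)
      then have "\<bar>u r\<bar> < d" using primitive_mono[of d "\<bar>u r\<bar>"] E(1)[OF elim(1)] d(1) by force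
      then show ?case using d(2) by simp
    qed
  qed
  have "((\<lambda>r. 2 / lam * V r) \<longlongrightarrow> 2 / lam * 0) at_top" by (intro tendsto_intros V0)
  then have lim: "((\<lambda>r. 2 / lam * V r) \<longlongrightarrow> 0) at_top" by simp
  have "((\<lambda>r. (u1 r)\<^sup>2) \<longlongrightarrow> 0) at_top"
  proof (rule Lim_null_comparison[OF eventually_mono[OF eventually_ge_at_top[of 0]] lim])
    fix r :: real assume "0 \<le> r"
    then have "lam * (u1 r)\<^sup>2 / 2 \<le> V r" using E(2) by (simp add: energy_def)
    then show "norm ((u1 r)\<^sup>2) \<le> 2 / lam * V r" using lam by (simp add: field_simps)
  qed
  then have "((\<lambda>r. sqrt ((u1 r)\<^sup>2)) \<longlongrightarrow> sqrt 0) at_top" by (rule tendsto_real_sqrt)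
  then show u10: "(u1 \<longlongrightarrow> 0) at_top" by (simp add: tendsto_rabs_zero_iff)
  let ?f = "\<lambda>r. pucci (1 / lam) (1 / Lam) (- ((real N - 1) / r * pucci lam Lam (u1 r)) - g (u r))"
  have "((\<lambda>r. (real N - 1) / r) \<longlongrightarrow> 0) at_top"
    by (rule real_tendsto_divide_at_top[OF tendsto_const filterlim_ident])
  moreover have "((\<lambda>r. g (u r)) \<longlongrightarrow> g 0) at_top"
    using cont_g u0 by (intro isCont_tendsto_compose[of 0 g]) (auto simp: continuous_on_eq_continuous_at)
  ultimately have "(?f \<longlongrightarrow> pucci (1 / lam) (1 / Lam) (- (0 * pucci lam Lam 0) - g 0)) at_top"
    by (intro tendsto_intros u10)
  then have "(?f \<longlongrightarrow> 0) at_top" by (simp add: g_0)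
  then show "(u2 \<longlongrightarrow> 0) at_top"
  proof (rule Lim_transform_eventually)
    show "eventually (\<lambda>r. ?f r = u2 r) at_top"
      using eventually_gt_at_top[of 0]
    proof eventually_elim
      case (elim r)
      have "- ((real N - 1) / r * pucci lam Lam (u1 r)) - g (u r) = pucci lam Lam (u2 r)"
        using c2_solution_equation[OF sol _ elim] elim inf by simp
      then show ?case using pucci_inverse_left[OF lam(1) Lam] by simp
    qed
  qed
qed

end

section \<open>Radial functions in space\<close>

lemma norm_partial:
  fixes x :: "real ^ 'n"
  assumes "x \<noteq> 0"
  shows "((\<lambda>t. norm (x + t *\<^sub>R axis i 1)) has_real_derivative x $ i / norm x) (at 0)"
proof -
  have "((\<lambda>t. x + t *\<^sub>R axis i (1::real)) has_derivative (\<lambda>h. h *\<^sub>R axis i 1)) (at 0)"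
    by (auto intro!: derivative_eq_intros)
  moreover have "(norm has_derivative (\<lambda>h. h \<bullet> sgn x)) (at (x + 0 *\<^sub>R axis i 1))"
    using has_derivative_norm[OF assms] by simp
  ultimately have "((\<lambda>t. norm (x + t *\<^sub>R axis i 1)) has_derivative (\<lambda>h. (h *\<^sub>R axis i 1) \<bullet> sgn x)) (at 0)"
    by (rule has_derivative_compose)
  moreover have "(\<lambda>h. (h *\<^sub>R axis i 1) \<bullet> sgn x) = (*) (x $ i / norm x)"
    by (auto simp: inner_axis' sgn_div_norm fun_eq_iff divide_inverse)
  ultimately show ?thesis by (simp add: has_field_derivative_def)
qed

lemma component_partial:
  "((\<lambda>t. (x + t *\<^sub>R axis j 1) $ i) has_real_derivative (if i = j then 1 else 0)) (at 0)"
  by (auto intro!: derivative_eq_intros simp: axis_def)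

lemma sphere_component_le: "\<bar>x $ i / norm x\<bar> \<le> 1" for x :: "real ^ 'n"
  using component_le_norm_cart[of x i] by (cases "x = 0") (auto simp: divide_le_eq)

text \<open>A one-sided derivative at 0 seen through \<open>h \<mapsto> |h|\<close>, which is the norm along a coordinate axis.\<close>

lemma abs_quotient_tendsto:
  fixes f :: "real \<Rightarrow> real"
  assumes "(f has_real_derivative D) (at 0 within {0..})"
  shows "((\<lambda>h. (f \<bar>h\<bar> - f 0) / \<bar>h\<bar>) \<longlongrightarrow> D) (at 0)"
proof -
  have "((\<lambda>y. (f y - f 0) / (y - 0)) \<longlongrightarrow> D) (at 0 within {0..})"
    using assms by (simp add: has_field_derivative_iff)
  moreover have "filterlim abs (at (0::real) within {0..}) (at 0)"
    unfolding filterlim_at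
  proof
    have "((\<lambda>x. \<bar>x\<bar>) \<longlongrightarrow> \<bar>0::real\<bar>) (at 0)" by (intro tendsto_intros)
    then show "(abs \<longlongrightarrow> (0::real)) (at 0)" by simp
  qed (auto simp: eventually_at_filter)
  ultimately have "((\<lambda>h. (f \<bar>h\<bar> - f 0) / (\<bar>h\<bar> - 0)) \<longlongrightarrow> D) (at 0)"
    by (rule filterlim_compose)
  then show ?thesis by simp
qed

text \<open>Off the origin the partial derivatives are the usual expressions in \<open>x/|x|\<close>, bounded by multiples
  of \<open>|u'|\<close> and \<open>|u''|\<close> for \<open>|x| \<ge> 1\<close>. At the origin the condition \<open>u'(0) = 0\<close> makes the first
  derivatives vanish and the Hessian equal to \<open>u''(0)\<close> times the identity.\<close>

lemma radial_localized:
  fixes u u1 u2 :: "real \<Rightarrow> real"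
  assumes sol: "c2_solution lam Lam N g \<infinity> u u1 u2"
    and lim: "(u \<longlongrightarrow> 0) at_top" "(u1 \<longlongrightarrow> 0) at_top" "(u2 \<longlongrightarrow> 0) at_top"
  shows "localized (\<lambda>x :: real ^ 'n. u (norm x))"
proof -
  define D :: "'n \<Rightarrow> real ^ 'n \<Rightarrow> real" where "D i x = u1 (norm x) * (x $ i / norm x)" for i x
  define D2 :: "'n \<Rightarrow> 'n \<Rightarrow> real ^ 'n \<Rightarrow> real" where
    "D2 i j x = (if x = 0 then (if i = j then u2 0 else 0)
       else u2 (norm x) * (x $ j / norm x) * (x $ i / norm x)
         + u1 (norm x) * (((if i = j then 1 else 0) - x $ i / norm x * (x $ j / norm x)) / norm x))" for i j x
  have u1_0: "u1 0 = 0" by (rule c2_solution_u1_0[OF sol])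
  have deriv: "(u has_real_derivative u1 r) (at r)" "(u1 has_real_derivative u2 r) (at r)" if "0 < r" for r
    using c2_solution_deriv_interior[OF sol _ that] that by auto
  have deriv0: "(u has_real_derivative 0) (at 0 within {0..})" "(u1 has_real_derivative u2 0) (at 0 within {0..})"
    using c2_solution_deriv[OF sol, of 0] u1_0 by auto
  have norm_axis: "norm (t *\<^sub>R axis i (1::real) :: real ^ 'n) = \<bar>t\<bar>" for t i by simp
  have D: "has_partial (\<lambda>x. u (norm x)) i x (D i x)" for i x
  proof (cases "x = 0")
    case False
    then have "0 < norm x" by simp
    then have "(u has_real_derivative u1 (norm x)) (at (norm (x + 0 *\<^sub>R axis i 1)))"
      using deriv(1) by simp
    from DERIV_chain2[where f = u, OF this norm_partial[OF False]] show ?thesis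
      by (simp add: has_partial_def D_def)
  next
    case True
    have "((\<lambda>h. (u \<bar>h\<bar> - u 0) / \<bar>h\<bar>) \<longlongrightarrow> 0) (at 0)" by (rule abs_quotient_tendsto[OF deriv0(1)])
    then have "((\<lambda>h. \<bar>(u \<bar>h\<bar> - u 0) / \<bar>h\<bar>\<bar>) \<longlongrightarrow> 0) (at 0)" by (rule tendsto_rabs_zero)
    then have "((\<lambda>h. (u \<bar>h\<bar> - u 0) / h) \<longlongrightarrow> 0) (at 0)"
      by (rule Lim_null_comparison[rotated]) simp
    then show ?thesis using True by (simp add: has_partial_def DERIV_def D_def)
  qed
  have D2: "has_partial (D i) j x (D2 i j x)" for i j x
  proof (cases "x = 0")
    case False
    then have nx: "0 < norm x" by simp
    then have "(u1 has_real_derivative u2 (norm x)) (at (norm (x + 0 *\<^sub>R axis j 1)))"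
      using deriv(2) by simp
    note d1 = DERIV_chain2[where f = u1, OF this norm_partial[OF False]]
    have d2: "((\<lambda>t. (x + t *\<^sub>R axis j 1) $ i / norm (x + t *\<^sub>R axis j 1)) has_real_derivative
        ((if i = j then 1 else 0) * norm (x + 0 *\<^sub>R axis j 1) - (x + 0 *\<^sub>R axis j 1) $ i * (x $ j / norm x))
          / (norm (x + 0 *\<^sub>R axis j 1) * norm (x + 0 *\<^sub>R axis j 1))) (at 0)"
      using nx by (intro DERIV_divide component_partial norm_partial[OF False]) simp
    have "u2 (norm x) * (x $ j / norm x) * ((x + 0 *\<^sub>R axis j 1) $ i / norm (x + 0 *\<^sub>R axis j 1))
        + ((if i = j then 1 else 0) * norm (x + 0 *\<^sub>R axis j 1) - (x + 0 *\<^sub>R axis j 1) $ i * (x $ j / norm x))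
          / (norm (x + 0 *\<^sub>R axis j 1) * norm (x + 0 *\<^sub>R axis j 1)) * u1 (norm (x + 0 *\<^sub>R axis j 1)) = D2 i j x"
      using nx False by (simp add: D2_def field_simps)
    with DERIV_mult[OF d1 d2] show ?thesis by (simp add: has_partial_def D_def)
  next
    case True
    show ?thesis
    proof (cases "i = j")
      case False
      then have "D i (0 + t *\<^sub>R axis j 1) = 0" for t by (simp add: D_def axis_def)
      then show ?thesis using True False by (simp add: has_partial_def D2_def)
    next
      case ij: True
      have "(h *\<^sub>R axis j (1::real) :: real ^ 'n) $ j = h" for h by (simp add: axis_def)
      then have Dj: "D j (h *\<^sub>R axis j 1) = u1 \<bar>h\<bar> * (h / \<bar>h\<bar>)" for h
        by (simp only: D_def norm_axis)
      have "((\<lambda>h. (u1 \<bar>h\<bar> - u1 0) / \<bar>h\<bar>) \<longlongrightarrow> u2 0) (at 0)" by (rule abs_quotient_tendsto[OF deriv0(2)])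
      then have "((\<lambda>h. (D j (0 + h *\<^sub>R axis j 1) - D j (0 + 0 *\<^sub>R axis j 1)) / h) \<longlongrightarrow> u2 0) (at 0)"
        by (rule Lim_transform_eventually)
           (auto simp: eventually_at_filter Dj D_def[of j 0] u1_0 intro!: always_eventually)
      then show ?thesis using True ij by (simp add: has_partial_def DERIV_def D2_def)
    qed
  qed
  have at_norm: "((\<lambda>x :: real ^ 'n. f (norm x)) \<longlongrightarrow> 0) at_infinity" if "(f \<longlongrightarrow> 0) at_top" for f :: "real \<Rightarrow> real"
    using that filterlim_norm_at_top by (rule filterlim_compose)
  have "(D i \<longlongrightarrow> 0) at_infinity" for i
  proof (rule Lim_null_comparison[OF always_eventually tendsto_rabs_zero[OF at_norm[OF lim(2)]]], rule allI)
    fix x :: "real ^ 'n"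
    have "\<bar>u1 (norm x)\<bar> * \<bar>x $ i / norm x\<bar> \<le> \<bar>u1 (norm x)\<bar> * 1"
      by (intro mult_left_mono sphere_component_le) simp
    then show "norm (D i x) \<le> \<bar>u1 (norm x)\<bar>" by (simp add: D_def abs_mult)
  qed
  moreover have "(D2 i j \<longlongrightarrow> 0) at_infinity" for i j
  proof (rule Lim_null_comparison[where g = "\<lambda>x. \<bar>u2 (norm x)\<bar> + 2 * \<bar>u1 (norm x)\<bar>"])
    show "eventually (\<lambda>x. norm (D2 i j x) \<le> \<bar>u2 (norm x)\<bar> + 2 * \<bar>u1 (norm x)\<bar>) at_infinity"
      unfolding eventually_at_infinity
    proof (intro exI[of _ 1] allI impI)
      fix x :: "real ^ 'n" assume x: "1 \<le> norm x"
      define a b where "a = x $ i / norm x" and "b = x $ j / norm x"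
      have ab: "\<bar>a\<bar> \<le> 1" "\<bar>b\<bar> \<le> 1" unfolding a_def b_def by (rule sphere_component_le)+
      then have "\<bar>a * b\<bar> \<le> 1" by (simp add: abs_mult mult_le_one)
      then have "\<bar>(if i = j then 1 else 0) - a * b\<bar> \<le> 2" by auto
      moreover have "\<bar>((if i = j then 1 else 0) - a * b) / norm x\<bar> \<le> \<bar>(if i = j then 1 else 0) - a * b\<bar>"
        using x by (simp add: divide_le_eq mult_le_cancel_left1)
      ultimately have "\<bar>((if i = j then 1 else 0) - a * b) / norm x\<bar> \<le> 2" by linarith
      define p q where "p = u2 (norm x) * (a * b)"
        and "q = u1 (norm x) * (((if i = j then 1 else 0) - a * b) / norm x)"
      have "\<bar>p\<bar> \<le> \<bar>u2 (norm x)\<bar> * 1"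
        unfolding p_def abs_mult[of "u2 (norm x)"] by (rule mult_left_mono[OF \<open>\<bar>a * b\<bar> \<le> 1\<close>]) simp
      moreover have "\<bar>q\<bar> \<le> \<bar>u1 (norm x)\<bar> * 2"
        unfolding q_def abs_mult[of "u1 (norm x)"]
        by (rule mult_left_mono[OF \<open>\<bar>((if i = j then 1 else 0) - a * b) / norm x\<bar> \<le> 2\<close>]) simp
      moreover have "D2 i j x = p + q"
        using x by (auto simp: D2_def a_def b_def p_def q_def)
      ultimately show "norm (D2 i j x) \<le> \<bar>u2 (norm x)\<bar> + 2 * \<bar>u1 (norm x)\<bar>"
        by simp
    qed
    have "((\<lambda>r. \<bar>u2 r\<bar> + 2 * \<bar>u1 r\<bar>) \<longlongrightarrow> \<bar>0\<bar> + 2 * \<bar>0\<bar>) at_top"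
      by (intro tendsto_intros lim)
    then show "((\<lambda>x :: real ^ 'n. \<bar>u2 (norm x)\<bar> + 2 * \<bar>u1 (norm x)\<bar>) \<longlongrightarrow> 0) at_infinity"
      by (intro at_norm[of "\<lambda>r. \<bar>u2 r\<bar> + 2 * \<bar>u1 r\<bar>"]) simp
  qed
  ultimately show ?thesis
    unfolding localized_def using D D2 at_norm[OF lim(1)] by blast
qed

section \<open>The essential supremum on the half-line\<close>

lemma Linf_measurable:
  assumes "continuous_on {0..} u"
  shows "(\<lambda>r. ereal \<bar>u r\<bar>) \<in> borel_measurable (restrict_space lborel {0..})"
proof -
  have "u \<in> borel_measurable (restrict_space borel {0..})"
    by (rule borel_measurable_continuous_on_restrict[OF assms])
  also have "borel_measurable (restrict_space borel {0..}) = borel_measurable (restrict_space lborel {0..})"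
    by (intro measurable_cong_sets sets_restrict_space_cong) auto
  finally show ?thesis by measurable
qed

lemma Linf_norm_le:
  assumes "continuous_on {0..} u" "\<forall>r\<ge>0. \<bar>u r\<bar> \<le> b"
  shows "Linf_norm u \<le> ereal b"
  unfolding Linf_norm_def
  by (rule esssup_I[OF Linf_measurable[OF assms(1)]])
     (use assms(2) in \<open>auto simp: space_restrict_space intro!: AE_I2\<close>)

text \<open>By continuity \<open>|u|\<close> exceeds any number below \<open>|u 0|\<close> on an interval \<open>(0, d)\<close>, which has positive
  measure.\<close>

lemma Linf_norm_ge_initial:
  assumes cont: "continuous_on {0..} u"
  shows "ereal \<bar>u 0\<bar> \<le> Linf_norm u"
proof (rule ccontr)
  let ?M = "restrict_space lborel {0::real..}"
  assume "\<not> ereal \<bar>u 0\<bar> \<le> Linf_norm u"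
  then obtain z where z: "Linf_norm u < ereal z" "ereal z < ereal \<bar>u 0\<bar>"
    using ereal_dense2[of "Linf_norm u" "ereal \<bar>u 0\<bar>"] by (auto simp: not_le)
  have "((\<lambda>r. \<bar>u r\<bar>) \<longlongrightarrow> \<bar>u 0\<bar>) (at 0 within {0..})"
    using cont by (intro tendsto_rabs) (auto simp: continuous_on_def)
  then have "eventually (\<lambda>r. z < \<bar>u r\<bar>) (at 0 within {0..})"
    by (rule order_tendstoD(1)) (use z(2) in simp)
  then obtain d where d: "0 < d" "\<And>r. 0 < r \<Longrightarrow> r < d \<Longrightarrow> z < \<bar>u r\<bar>"
    by (force simp: eventually_at)
  note [measurable] = Linf_measurable[OF cont]
  have "{0<..<d} \<subseteq> {r \<in> space ?M. Linf_norm u < ereal \<bar>u r\<bar>}"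
    using d(2) z(1) by (auto simp: space_restrict_space intro: less_trans)
  then have "emeasure ?M {0<..<d} \<le> emeasure ?M {r \<in> space ?M. Linf_norm u < ereal \<bar>u r\<bar>}"
    by (intro emeasure_mono) measurable
  also have "\<dots> = 0"
    unfolding Linf_norm_def by (rule esssup_zero_measure)
  also have "emeasure ?M {0<..<d} = emeasure lborel {0<..<d}"
    by (rule emeasure_restrict_space) auto
  also have "\<dots> = ennreal d" using d(1) by simp
  finally show False using d(1) by simp
qed

section \<open>Maximal solutions by initial value\<close>

lemma local_lipschitz_bounded:
  fixes g :: "real \<Rightarrow> real"
  assumes "local_lipschitz (UNIV :: real set) UNIV (\<lambda>_. g)"
  shows "\<exists>L. \<forall>x y. \<bar>x\<bar> \<le> K \<and> \<bar>y\<bar> \<le> K \<longrightarrow> \<bar>g x - g y\<bar> \<le> L * \<bar>x - y\<bar>"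
proof -
  have "local_lipschitz {0::real} {-K..K} (\<lambda>_. g)"
    using assms by (rule local_lipschitz_subset) auto
  then obtain L where "\<And>t. t \<in> {0::real} \<Longrightarrow> L-lipschitz_on {-K..K} g"
    by (rule local_lipschitz_compact_implies_lipschitz) auto
  then have "L-lipschitz_on {-K..K} g" by simp
  then show ?thesis
    using lipschitz_onD[of L "{-K..K}" g]
    by (intro exI[of _ L]) (simp add: abs_le_iff dist_real_def minus_le_iff)
qed

lemma constant_maximal_solution:
  assumes "g \<xi> = 0"
  shows "maximal_solution lam Lam N g \<xi> \<infinity> (\<lambda>_. \<xi>)"
proof -
  have "c2_solution lam Lam N g \<infinity> (\<lambda>_. \<xi>) (\<lambda>_. 0) (\<lambda>_. 0)"
    using assms by (auto simp: c2_solution_def)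
  then show ?thesis by (auto simp: maximal_solution_def cauchy_solution_iff)
qed

lemma sign_change_zero:
  fixes g :: "real \<Rightarrow> real"
  assumes cont: "continuous_on UNIV g" and a: "0 < a"
    and pos: "\<forall>t. 0 < t \<and> t < a \<longrightarrow> 0 < g t" and neg: "\<forall>t. a < t \<longrightarrow> g t < 0"
  shows "g a = 0"
proof (rule antisym)
  have "isCont g a" using cont by (simp add: continuous_on_eq_continuous_at)
  then have lim: "(g \<longlongrightarrow> g a) (at_left a)" "(g \<longlongrightarrow> g a) (at_right a)"
    by (auto simp: isCont_def intro: tendsto_within_subset)
  have "eventually (\<lambda>t. 0 \<le> g t) (at_left a)"
    by (rule eventually_at_leftI[of 0]) (use a pos in \<open>auto intro: less_imp_le\<close>)
  then show "0 \<le> g a" using tendsto_lowerbound[OF lim(1)] by simp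
  have "eventually (\<lambda>t. g t \<le> 0) (at_right a)"
    by (rule eventually_at_rightI[of _ "a + 1"]) (use neg in \<open>auto intro: less_imp_le\<close>)
  then show "g a \<le> 0" using tendsto_upperbound[OF lim(2)] by simp
qed

text \<open>In case (i) the constant solution is global. Otherwise one maximal solution serves for all
  the remaining cases, and its boundedness is what makes it global in (iii) and (iv).\<close>

theorem theorem3p1:
  fixes lam Lam :: real and N :: nat and g :: "real \<Rightarrow> real" and \<alpha> :: ereal and \<xi> :: real
  assumes ellip: "0 < lam" "lam \<le> Lam"
    and dim: "N = CARD('n::finite)" "N \<ge> 2"
    and g1: "local_lipschitz (UNIV :: real set) UNIV (\<lambda>_. g)"
    and g2: "\<forall>t. g (- t) = - g t"
    and g3: "0 < \<alpha>" "\<forall>t. 0 < t \<and> ereal t < \<alpha> \<longrightarrow> g t > 0" "\<forall>t. \<alpha> < ereal t \<longrightarrow> g t < 0"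
    and g4: "g differentiable (at 0)" "deriv g 0 > 0"
  shows "\<exists>R u. maximal_solution lam Lam N g \<xi> R u \<and>
     (ereal \<bar>\<xi>\<bar> = \<alpha> \<or> \<xi> = 0 \<longrightarrow> (\<forall>r\<in>ivl R. u r = \<xi>)) \<and>
     (\<alpha> \<noteq> \<infinity> \<and> ereal \<bar>\<xi>\<bar> > \<alpha> \<longrightarrow>
        strict_mono_on (ivl R) (\<lambda>r. \<bar>u r\<bar>) \<and> filterlim (\<lambda>r. \<bar>u r\<bar>) at_top (right_end R)) \<and>
     (0 < \<xi> \<and> ereal \<xi> < \<alpha> \<and> ereal Lam * ereal (primitive g \<xi>) \<le> ereal lam * primitive_ext g \<alpha> \<longrightarrow>
        R = \<infinity> \<and> oscillating u \<and> localized (\<lambda>x::real^'n. u (norm x)) \<and> Linf_norm u < \<alpha>) \<and>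
     (- \<alpha> < ereal \<xi> \<and> \<xi> < 0 \<longrightarrow>
        R = \<infinity> \<and> oscillating u \<and> localized (\<lambda>x::real^'n. u (norm x)) \<and>
        Linf_norm u = ereal (- \<xi>) \<and> ereal (- \<xi>) < \<alpha>)"
proof (cases "ereal \<bar>\<xi>\<bar> = \<alpha> \<or> \<xi> = 0")
  case True
  have cont: "continuous_on UNIV g" by (rule local_lipschitz_continuous_on[OF g1]) simp
  have "g \<xi> = 0"
  proof (cases "\<xi> = 0")
    case True
    then show ?thesis using g2[rule_format, of 0] by simp
  next
    case False
    then have a: "\<alpha> = ereal \<bar>\<xi>\<bar>" using True by simp
    have "g \<bar>\<xi>\<bar> = 0" using g3 by (intro sign_change_zero[OF cont]) (auto simp: a)
    then show ?thesis using g2[rule_format, of \<xi>] by (cases "0 \<le> \<xi>") auto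
  qed
  then have "maximal_solution lam Lam N g \<xi> \<infinity> (\<lambda>_. \<xi>)" by (rule constant_maximal_solution)
  moreover have "\<not> (- \<alpha> < ereal \<xi> \<and> \<xi> < 0)" "\<not> ereal \<bar>\<xi>\<bar> > \<alpha>" "\<not> (0 < \<xi> \<and> ereal \<xi> < \<alpha>)"
    using True g3(1) by (auto simp: zero_ereal_def)
  ultimately show ?thesis
    by (intro exI[of _ \<infinity>] exI[of _ "\<lambda>_. \<xi>"]) (auto simp del: ereal_uminus_less_reorder)
next
  case False
  have Lam: "0 < Lam" and N1: "1 \<le> N" using ellip dim(2) by auto
  have cont: "continuous_on UNIV g" by (rule local_lipschitz_continuous_on[OF g1]) simp
  obtain R u where max: "maximal_solution lam Lam N g \<xi> R u"
      and alt: "(\<exists>B. \<forall>r\<in>ivl R. \<bar>u r\<bar> \<le> B) \<longrightarrow> R = \<infinity>"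
    using maximal_solution_exists[OF ellip(1) Lam N1 local_lipschitz_bounded[OF g1]] by blast
  have R: "0 < R" using max by (simp add: maximal_solution_def)
  obtain u1 u2 where sol: "c2_solution lam Lam N g R u u1 u2" and u0: "u 0 = \<xi>"
    using max by (auto simp: maximal_solution_def cauchy_solution_iff)
  have g_neg: "g y < 0" if "\<alpha> < ereal \<bar>\<xi>\<bar>" "\<bar>\<xi>\<bar> \<le> y" for y
    using g3(3) that by (meson ereal_less_eq(3) less_le_trans)
  have ii: "strict_mono_on (ivl R) (\<lambda>r. \<bar>u r\<bar>) \<and> filterlim (\<lambda>r. \<bar>u r\<bar>) at_top (right_end R)"
    if sup: "\<alpha> < ereal \<bar>\<xi>\<bar>"
  proof -
    have *: "strict_mono_on (ivl R) (\<lambda>r. \<bar>v r\<bar>) \<and> filterlim (\<lambda>r. \<bar>v r\<bar>) at_top (right_end R)"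
      if v: "strict_mono_on (ivl R) v" "filterlim v at_top (right_end R)" "0 \<le> v 0" for v :: "real \<Rightarrow> real"
    proof
      have 0: "0 \<in> ivl R" using R by (rule zero_in_ivl)
      have "0 \<le> v r" if "r \<in> ivl R" for r
        using strict_mono_onD[OF v(1) 0 that] v(3) that by (cases "r = 0") (auto simp: mem_ivl)
      then show "strict_mono_on (ivl R) (\<lambda>r. \<bar>v r\<bar>)"
        using v(1) by (auto simp: strict_mono_on_def)
      show "filterlim (\<lambda>r. \<bar>v r\<bar>) at_top (right_end R)"
        by (rule filterlim_at_top_mono[OF v(2) always_eventually]) (simp add: abs_ge_self)
    qed
    show ?thesis
    proof (cases "0 < \<xi>")
      case True
      have "g y < 0" if "u 0 \<le> y" for y using g_neg[OF sup] that True u0 by simp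
      note blow = supercritical_blow_up[OF ellip(1) Lam N1 cont R sol this alt]
      show ?thesis using *[of u] blow True u0 by simp
    next
      case False
      have alt': "(\<exists>B. \<forall>r\<in>ivl R. \<bar>- u r\<bar> \<le> B) \<longrightarrow> R = \<infinity>" using alt by simp
      have "g y < 0" if "- u 0 \<le> y" for y using g_neg[OF sup] that False u0 by simp
      note blow = supercritical_blow_up[OF Lam ellip(1) N1 cont R c2_solution_uminus[OF sol g2] this alt']
      show ?thesis using *[of "\<lambda>r. - u r"] blow False u0 by simp
    qed
  qed
  interpret subcritical_solution lam Lam N g \<alpha> R u u1 u2
    by unfold_locales (use ellip dim(2) cont g2 g3 R sol in auto)
  have bounded: "R = \<infinity> \<and> oscillating u \<and> localized (\<lambda>x::real^'n. u (norm x)) \<and> Linf_norm u \<le> ereal \<beta>"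
    if \<beta>: "ereal \<beta> < \<alpha>" and le: "\<forall>r\<in>ivl R. \<bar>u r\<bar> \<le> \<beta>" for \<beta>
  proof -
    have inf: "R = \<infinity>" using alt le by blast
    have bound: "\<forall>r\<ge>0. \<bar>u r\<bar> \<le> \<beta>" using le inf by simp
    have sol': "c2_solution lam Lam N g \<infinity> u u1 u2" using sol inf by simp
    have "(g has_real_derivative deriv g 0) (at 0)"
      using g4(1) by (metis DERIV_deriv_iff_real_differentiable)
    moreover have "0 < g x" if "0 < x" "x \<le> \<beta>" for x
      using g_pos[OF that(1)] that(2) \<beta> by (meson ereal_less_eq(3) le_less_trans)
    ultimately obtain k where k: "0 < k" "\<forall>x. 0 < x \<and> x \<le> \<beta> \<longrightarrow> k * x \<le> g x"
      using linear_lower_bound[OF cont g_0 _ g4(2), of \<beta>] by blast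
    have "oscillating u"
      by (rule bounded_solution_oscillates[OF ellip(1) Lam N1 sol' g2 k(1), of \<beta>]) (use k(2) bound in auto)
    moreover have "localized (\<lambda>x::real^'n. u (norm x))"
      by (rule radial_localized[OF sol' decay[OF inf \<beta> bound]])
    moreover have "Linf_norm u \<le> ereal \<beta>"
      using c2_solution_continuous(1)[OF sol'] bound by (intro Linf_norm_le) auto
    ultimately show ?thesis using inf by blast
  qed
  have iii: "R = \<infinity> \<and> oscillating u \<and> localized (\<lambda>x::real^'n. u (norm x)) \<and> Linf_norm u < \<alpha>"
    if h: "0 < \<xi> \<and> ereal \<xi> < \<alpha> \<and> ereal Lam * ereal (primitive g \<xi>) \<le> ereal lam * primitive_ext g \<alpha>"
  proof -
    obtain \<beta> where \<beta>: "ereal \<beta> < \<alpha>" "\<And>r. r \<in> ivl R \<Longrightarrow> \<bar>u r\<bar> \<le> \<beta>"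
      using positive_start_bound h unfolding u0 by metis
    then show ?thesis using bounded[of \<beta>] by (auto intro: le_less_trans)
  qed
  have iv: "R = \<infinity> \<and> oscillating u \<and> localized (\<lambda>x::real^'n. u (norm x)) \<and>
      Linf_norm u = ereal (- \<xi>) \<and> ereal (- \<xi>) < \<alpha>" if h: "- \<alpha> < ereal \<xi> \<and> \<xi> < 0"
  proof -
    have less: "ereal (- \<xi>) < \<alpha>" using h by (cases \<alpha>) auto
    have "\<forall>r\<in>ivl R. \<bar>u r\<bar> \<le> - \<xi>"
      using negative_start_bound h unfolding u0 by blast
    note b = bounded[OF less this]
    then have "continuous_on {0..} u" using c2_solution_continuous(1)[OF sol] by simp
    from Linf_norm_ge_initial[OF this] have "ereal (- \<xi>) \<le> Linf_norm u"
      using h u0 by simp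
    then show ?thesis using b less by (auto intro: antisym)
  qed
  show ?thesis
    using max False ii iii iv by (intro exI[of _ R] exI[of _ u]) blast
qed

end
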